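(* Let $u\in C^\infty(\mathbb R^3;\mathbb R^3)$ be a $D$-solution of the stationary Navier--Stokes equations, and let $s\ge 1$ be arbitrary. Suppose $u=\operatorname{curl}\psi$ for some $\psi\in L^1_{loc}(\mathbb R^3;\mathbb R^3)$ such that, for some constants $C>0$ and $0<\alpha<1$, $$\left(\frac{1}{|B_R(x_0)|}\int_{B_R(x_0)}\bigl|\psi-(\psi)_{B_R(x_0)}\bigr|^s\,dx\right)^{1/s}\le C R^{\alpha}\qquad\text{for all } R>1 \text{ and all } x_0\in\mathbb R^3 .$$ Then $u\in L^{p,\infty}(\mathbb R^3)$ for every $p>\frac{4}{1-\alpha}$. Moreover, if $\alpha<\frac19$, then $u\equiv 0$.
   Context: A $D$-solution of the stationary Navier--Stokes equations in $\mathbb R^3$ is a smooth vector field $u:\mathbb R^3\to\mathbb R^3$ for which there is a smooth pressure $p:\mathbb R^3\to\mathbb R$ with $-\Delta u+u\cdot\nabla u+\nabla p=0$ and $\operatorname{div}u=0$ on $\mathbb R^3$, such that $\lim_{|x|\to\infty}u(x)=0$ and $\int_{\mathbb R^3}|\nabla u|^2\,dx<\infty$. $B_R(x_0)$ is the ball of radius $R$ centered at $x_0$; $(\psi)_{B}$ denotes the average $\frac1{|B|}\int_B\psi\,dx$. The relation $u=\operatorname{curl}\psi$ is understood in the sense of distributions. $L^{p,\infty}$ is the weak $L^p$ (Lorentz) space. *)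

theory Defs
  imports "HOL-Analysis.Analysis"
begin

definition pd :: "3 \<Rightarrow> (real^3 \<Rightarrow> 'b::real_normed_vector) \<Rightarrow> real^3 \<Rightarrow> 'b" where
  "pd i f x = frechet_derivative f (at x) (axis i 1)"

primrec Ck :: "nat \<Rightarrow> (real^3 \<Rightarrow> 'b::real_normed_vector) \<Rightarrow> bool" where
  "Ck 0 f \<longleftrightarrow> continuous_on UNIV f"
| "Ck (Suc k) f \<longleftrightarrow> f differentiable_on UNIV \<and> (\<forall>i. Ck k (pd i f))"

definition smooth :: "(real^3 \<Rightarrow> 'b::real_normed_vector) \<Rightarrow> bool" where
  "smooth f \<longleftrightarrow> (\<forall>k. Ck k f)"

definition grad :: "(real^3 \<Rightarrow> real) \<Rightarrow> real^3 \<Rightarrow> real^3" where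
  "grad p x = (\<chi> i. pd i p x)"

definition divergence :: "(real^3 \<Rightarrow> real^3) \<Rightarrow> real^3 \<Rightarrow> real" where
  "divergence u x = (\<Sum>i\<in>UNIV. pd i u x $ i)"

definition laplacian :: "(real^3 \<Rightarrow> real^3) \<Rightarrow> real^3 \<Rightarrow> real^3" where
  "laplacian u x = (\<Sum>i\<in>UNIV. pd i (pd i u) x)"

definition convection :: "(real^3 \<Rightarrow> real^3) \<Rightarrow> real^3 \<Rightarrow> real^3" where
  "convection u x = (\<Sum>i\<in>UNIV. u x $ i *\<^sub>R pd i u x)"

definition curl :: "(real^3 \<Rightarrow> real^3) \<Rightarrow> real^3 \<Rightarrow> real^3" where
  "curl u x = vector
     [pd 2 u x $ 3 - pd 3 u x $ 2,
      pd 3 u x $ 1 - pd 1 u x $ 3,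
      pd 1 u x $ 2 - pd 2 u x $ 1]"

definition D_solution :: "(real^3 \<Rightarrow> real^3) \<Rightarrow> bool" where
  "D_solution u \<longleftrightarrow>
     smooth u \<and>
     (\<exists>p :: real^3 \<Rightarrow> real. smooth p \<and>
        (\<forall>x. - laplacian u x + convection u x + grad p x = 0)) \<and>
     (\<forall>x. divergence u x = 0) \<and>
     (u \<longlongrightarrow> 0) at_infinity \<and>
     integrable lebesgue (\<lambda>x. \<Sum>i\<in>UNIV. \<Sum>j\<in>UNIV. (pd i u x $ j)\<^sup>2)"

definition locally_L1 :: "(real^3 \<Rightarrow> real^3) \<Rightarrow> bool" where
  "locally_L1 f \<longleftrightarrow> (\<forall>K. compact K \<longrightarrow> set_integrable lebesgue K f)"

definition test_field :: "(real^3 \<Rightarrow> real^3) \<Rightarrow> bool" where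
  "test_field \<phi> \<longleftrightarrow> smooth \<phi> \<and> compact (closure {x. \<phi> x \<noteq> 0})"

text \<open>The sign is \<open>+\<close> because the curl is formally self-adjoint.\<close>

definition is_weak_curl :: "(real^3 \<Rightarrow> real^3) \<Rightarrow> (real^3 \<Rightarrow> real^3) \<Rightarrow> bool" where
  "is_weak_curl u \<psi> \<longleftrightarrow>
     (\<forall>\<phi>. test_field \<phi> \<longrightarrow>
        integral\<^sup>L lebesgue (\<lambda>x. u x \<bullet> \<phi> x) = integral\<^sup>L lebesgue (\<lambda>x. \<psi> x \<bullet> curl \<phi> x))"

definition average :: "(real^3) set \<Rightarrow> (real^3 \<Rightarrow> 'b::{banach, second_countable_topology}) \<Rightarrow> 'b" where
  "average B f = (1 / measure lebesgue B) *\<^sub>R set_lebesgue_integral lebesgue B f"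

text \<open>The integrability conjunct is needed because the Bochner integral of a non-integrable
  function is \<open>0\<close>; it says that the oscillation integral is finite.\<close>

definition oscillation_bound ::
    "(real^3 \<Rightarrow> real^3) \<Rightarrow> real \<Rightarrow> real \<Rightarrow> real \<Rightarrow> bool" where
  "oscillation_bound \<psi> s C \<alpha> \<longleftrightarrow>
     (\<forall>R x0. R > 1 \<longrightarrow>
        set_integrable lebesgue (ball x0 R) (\<lambda>x. norm (\<psi> x - average (ball x0 R) \<psi>) powr s) \<and>
        average (ball x0 R) (\<lambda>x. norm (\<psi> x - average (ball x0 R) \<psi>) powr s) powr (1 / s)
          \<le> C * R powr \<alpha>)"

definition weak_Lp :: "real \<Rightarrow> (real^3 \<Rightarrow> real^3) \<Rightarrow> bool" where
  "weak_Lp p f \<longleftrightarrow>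
     f \<in> borel_measurable lebesgue \<and>
     (SUP t\<in>{0<..}. ennreal (t powr p) * emeasure lebesgue {x. norm (f x) > t}) < \<infinity>"

end

theory Submission
  imports Defs
begin

text \<open>
  Let \<open>u\<^sub>r\<close> and \<open>\<psi>\<^sub>r\<close> be the mollifications of \<open>u\<close> and of its potential at scale \<open>r > 1\<close>.
  The oscillation bound gives \<open>\<bar>\<nabla>\<psi>\<^sub>r\<bar> \<le> K r\<close> to the power \<open>\<alpha> - 1\<close>, hence the same bound for
  \<open>u\<^sub>r = curl \<psi>\<^sub>r\<close>, while the finite Dirichlet integral \<open>D\<close> gives a bound of order
  \<open>r \<surd>D\<close> for the \<open>L\<^sup>2\<close> norm of \<open>u - u\<^sub>r\<close>. On the set where \<open>\<bar>u\<bar> > t\<close>, choose \<open>r\<close> such that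
  \<open>\<bar>u\<^sub>r\<bar> \<le> t / 2\<close>; Chebyshev's inequality then
  bounds the measure of this set by a multiple of \<open>t\<close> to the power \<open>- (2 + 2 / (1 - \<alpha>))\<close>
  (\<open>level_set_decay\<close>). As \<open>2 + 2 / (1 - \<alpha>) \<le> 4 / (1 - \<alpha>)\<close> and \<open>u\<close> is bounded, this is the first claim.

  If \<open>\<alpha> < 1 / 9\<close>, the first claim and boundedness put \<open>u\<close> into \<open>L\<close> with exponent \<open>9 / 2\<close>, and
  hence the integrals of \<open>\<bar>u\<bar>\<^sup>2\<close> and of the fourth power of \<open>\<bar>u\<bar>\<close> over the ball of radius \<open>R\<close> grow
  at most like \<open>R\<close> to the powers \<open>5 / 3\<close> and \<open>1 / 3\<close>. The Liouville argument avoids any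
  estimate of the pressure: the equation is tested with \<open>curl (\<phi> \<Psi>)\<close>, where \<open>\<phi>\<close> is a cutoff and
  \<open>\<Psi>\<close> is a continuously differentiable potential of \<open>u\<close>. Writing the equation as
  \<open>curl \<omega> + \<omega> \<times> u + \<nabla>P = 0\<close> with \<open>\<omega> = curl u\<close>, the gradient disappears, the term
  \<open>(\<omega> \<times> u) \<bullet> u\<close> vanishes, and what is left expresses the integral of \<open>\<phi> \<bar>\<omega>\<bar>\<^sup>2\<close> by
  terms carrying a derivative of \<open>\<phi>\<close> (\<open>enstrophy_identity\<close>).

  The potential has to be controlled together with its full gradient. With a second scale
  \<open>r\<close>, much smaller than \<open>R\<close>, it is \<open>\<Psi> = \<psi>\<^sub>r - c + g\<close>. The dyadic comparison of mollifications
  \<open>mollify_growth\<close> bounds \<open>\<psi>\<^sub>r - c\<close> by a multiple of \<open>R\<close> to the power \<open>\<alpha>\<close>, and \<open>g\<close> is an explicit potential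
  of \<open>u - u\<^sub>r\<close>: for a constant vector \<open>y\<close> and solenoidal \<open>u\<close> one has
  \<open>(y \<bullet> \<nabla>) u = - curl (y \<times> u)\<close>, so that averaging \<open>y \<times> u (x + t y)\<close> over \<open>t\<close> in the unit interval
  and over \<open>y\<close> with the mollifier as weight gives a potential of \<open>u - u\<^sub>r\<close>
  (\<open>curl_error_potential\<close>). Averages contract Lebesgue norms, so \<open>g\<close> costs only factors \<open>r\<close>.
  With \<open>R = X ^ 8\<close> and \<open>r = X ^ 5\<close> every error term tends to zero as \<open>X\<close> grows, so \<open>\<omega> = 0\<close>. Then
  \<open>u\<close> is harmonic, its localised Dirichlet integral tends to zero in the same way, and \<open>u\<close> is
  constant, hence zero.
\<close>

section \<open>Partial derivatives on three-dimensional space\<close>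

lemma pd_eqI:
  assumes "(f has_derivative f') (at x)"
  shows "pd i f x = f' (axis i 1)"
  using frechet_derivative_at[OF assms] by (simp add: pd_def)

lemma has_derivative_pd:
  assumes "f differentiable (at x)"
  shows "(f has_derivative (\<lambda>h. \<Sum>i\<in>UNIV. h $ i *\<^sub>R pd i f x)) (at x)"
proof -
  let ?D = "frechet_derivative f (at x)"
  have D: "(f has_derivative ?D) (at x)"
    using assms by (simp add: frechet_derivative_works)
  interpret bounded_linear ?D using D by (rule has_derivative_bounded_linear)
  have "?D = (\<lambda>h. \<Sum>i\<in>UNIV. h $ i *\<^sub>R pd i f x)"
  proof
    fix h :: "real^3"
    have "?D h = ?D (\<Sum>i\<in>UNIV. h $ i *\<^sub>R axis i 1)"
      by (metis (no_types, lifting) basis_expansion scalar_mult_eq_scaleR sum.cong)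
    also have "\<dots> = (\<Sum>i\<in>UNIV. h $ i *\<^sub>R pd i f x)"
      by (simp add: sum scaleR pd_def)
    finally show "?D h = (\<Sum>i\<in>UNIV. h $ i *\<^sub>R pd i f x)" .
  qed
  with D show ?thesis by simp
qed

definition C1 :: "(real^3 \<Rightarrow> 'b::real_normed_vector) \<Rightarrow> bool" where
  "C1 f \<longleftrightarrow> (\<forall>x. f differentiable (at x)) \<and> (\<forall>i. continuous_on UNIV (pd i f))"

definition C2 :: "(real^3 \<Rightarrow> 'b::real_normed_vector) \<Rightarrow> bool" where
  "C2 f \<longleftrightarrow> C1 f \<and> (\<forall>i. C1 (pd i f))"

lemma C1_differentiable: "C1 f \<Longrightarrow> f differentiable (at x)"
  and C1_pd_cont: "C1 f \<Longrightarrow> continuous_on UNIV (pd i f)"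
  by (auto simp: C1_def)

lemma C1_cont: "C1 f \<Longrightarrow> continuous_on UNIV f"
  by (simp add: C1_def continuous_at_imp_continuous_on differentiable_imp_continuous_within)

lemma C2_C1: "C2 f \<Longrightarrow> C1 f" and C2_pd: "C2 f \<Longrightarrow> C1 (pd i f)"
  by (auto simp: C2_def)

lemma Ck_C1: "Ck (Suc k) f \<Longrightarrow> C1 f"
proof -
  have "Ck k g \<Longrightarrow> continuous_on UNIV g" for g :: "real^3 \<Rightarrow> 'a" and k
    by (cases k) (auto simp: differentiable_imp_continuous_on)
  then show "Ck (Suc k) f \<Longrightarrow> C1 f"
    by (auto simp: C1_def differentiable_on_def)
qed

lemma smooth_pd: "smooth f \<Longrightarrow> smooth (pd i f)"
  unfolding smooth_def by (metis Ck.simps(2))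

lemma smooth_C1: "smooth f \<Longrightarrow> C1 f"
  unfolding smooth_def using Ck_C1 by blast

lemma smooth_C2: "smooth f \<Longrightarrow> C2 f"
  by (simp add: C2_def smooth_C1 smooth_pd)

lemma
  assumes "bounded_bilinear P" "f differentiable (at x)" "g differentiable (at x)"
  shows pd_bilinear: "pd i (\<lambda>x. P (f x) (g x)) x = P (f x) (pd i g x) + P (pd i f x) (g x)"
    and differentiable_bilinear: "(\<lambda>x. P (f x) (g x)) differentiable (at x)"
proof -
  have "(f has_derivative frechet_derivative f (at x)) (at x)"
       "(g has_derivative frechet_derivative g (at x)) (at x)"
    using assms by (simp_all add: frechet_derivative_works)
  then have D: "((\<lambda>x. P (f x) (g x)) has_derivative
      (\<lambda>h. P (f x) (frechet_derivative g (at x) h) + P (frechet_derivative f (at x) h) (g x))) (at x)"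
    by (rule bounded_bilinear.FDERIV[OF assms(1)])
  from pd_eqI[OF D, of i] show "pd i (\<lambda>x. P (f x) (g x)) x = P (f x) (pd i g x) + P (pd i f x) (g x)"
    by (simp add: pd_def)
  from D show "(\<lambda>x. P (f x) (g x)) differentiable (at x)" by (auto simp: differentiable_def)
qed

lemma
  assumes "bounded_linear T" "f differentiable (at x)"
  shows pd_linear: "pd i (\<lambda>x. T (f x)) x = T (pd i f x)"
    and differentiable_linear: "(\<lambda>x. T (f x)) differentiable (at x)"
proof -
  have "(f has_derivative frechet_derivative f (at x)) (at x)"
    using assms by (simp_all add: frechet_derivative_works)
  then have D: "((\<lambda>x. T (f x)) has_derivative (\<lambda>h. T (frechet_derivative f (at x) h))) (at x)"
    by (rule bounded_linear.has_derivative[OF assms(1)])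
  from pd_eqI[OF D, of i] show "pd i (\<lambda>x. T (f x)) x = T (pd i f x)" by (simp add: pd_def)
  from D show "(\<lambda>x. T (f x)) differentiable (at x)" by (auto simp: differentiable_def)
qed

lemma pd_add: "f differentiable (at x) \<Longrightarrow> g differentiable (at x) \<Longrightarrow>
    pd i (\<lambda>x. f x + g x) x = pd i f x + pd i g x"
  unfolding frechet_derivative_works
  by (drule (1) has_derivative_add, drule pd_eqI) (simp add: pd_def)

lemma pd_diff: "f differentiable (at x) \<Longrightarrow> g differentiable (at x) \<Longrightarrow>
    pd i (\<lambda>x. f x - g x) x = pd i f x - pd i g x"
  unfolding frechet_derivative_works
  by (drule (1) has_derivative_diff, drule pd_eqI) (simp add: pd_def)

lemma pd_const [simp]: "pd i (\<lambda>x. c) x = 0"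
  by (simp add: pd_def)

lemma pd_sum: "(\<And>j. j \<in> A \<Longrightarrow> f j differentiable (at x)) \<Longrightarrow>
    pd i (\<lambda>x. \<Sum>j\<in>A. f j x) x = (\<Sum>j\<in>A. pd i (f j) x)"
proof -
  assume "\<And>j. j \<in> A \<Longrightarrow> f j differentiable (at x)"
  then have "((\<lambda>x. \<Sum>j\<in>A. f j x) has_derivative (\<lambda>h. \<Sum>j\<in>A. frechet_derivative (f j) (at x) h)) (at x)"
    by (intro has_derivative_sum) (simp add: frechet_derivative_works)
  from pd_eqI[OF this] show ?thesis by (simp add: pd_def)
qed

lemma C1_bilinear: "bounded_bilinear P \<Longrightarrow> C1 f \<Longrightarrow> C1 g \<Longrightarrow> C1 (\<lambda>x. P (f x) (g x))"
  unfolding C1_def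
  by (auto simp: pd_bilinear differentiable_bilinear[where P=P] continuous_at_imp_continuous_on
      differentiable_imp_continuous_within cong: continuous_on_cong
      intro!: continuous_on_add bounded_bilinear.continuous_on[where prod=P])

lemma C1_linear: "bounded_linear T \<Longrightarrow> C1 f \<Longrightarrow> C1 (\<lambda>x. T (f x))"
  unfolding C1_def
  by (simp add: pd_linear differentiable_linear cong: continuous_on_cong)
     (simp add: bounded_linear.continuous_on)

lemma C1_add: "C1 f \<Longrightarrow> C1 g \<Longrightarrow> C1 (\<lambda>x. f x + g x)"
  unfolding C1_def by (auto simp: pd_add cong: continuous_on_cong intro!: continuous_on_add)

lemma C1_minus: "C1 f \<Longrightarrow> C1 g \<Longrightarrow> C1 (\<lambda>x. f x - g x)"
  unfolding C1_def by (auto simp: pd_diff cong: continuous_on_cong intro!: continuous_on_diff)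

lemma C1_const [simp]: "C1 (\<lambda>x. c)"
  unfolding C1_def by (simp cong: continuous_on_cong)

lemma C1_sum: "(\<And>j. j \<in> A \<Longrightarrow> C1 (f j)) \<Longrightarrow> C1 (\<lambda>x. \<Sum>j\<in>A. f j x)"
  unfolding C1_def
  by (cases "finite A") (auto simp: pd_sum cong: continuous_on_cong intro!: continuous_on_sum differentiable_sum)

lemma bounded_bilinear_cross3: "bounded_bilinear cross3"
  using bilinear_cross bilinear_conv_bounded_bilinear by blast

lemmas C1_cross = C1_bilinear[OF bounded_bilinear_cross3]
lemmas C1_inner = C1_bilinear[OF bounded_bilinear_inner]
lemmas C1_scaleR = C1_bilinear[OF bounded_bilinear_scaleR]
lemmas C1_mult = C1_bilinear[OF bounded_bilinear_mult]
lemmas C1_component = C1_linear[OF bounded_linear_vec_nth]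
lemmas pd_component = pd_linear[OF bounded_linear_vec_nth]
lemmas pd_cross = pd_bilinear[OF bounded_bilinear_cross3]
lemmas pd_inner = pd_bilinear[OF bounded_bilinear_inner]
lemmas pd_scaleR = pd_bilinear[OF bounded_bilinear_scaleR]
lemmas pd_mult = pd_bilinear[OF bounded_bilinear_mult]

lemma curl_eq: "curl f x = (\<Sum>i\<in>UNIV. cross3 (axis i 1) (pd i f x))"
  by (simp add: curl_def vec_eq_iff forall_3 sum_3 cross_components axis_def)

lemma C1_curl: "C2 f \<Longrightarrow> C1 (curl f)"
  unfolding curl_eq[abs_def] by (intro C1_sum C1_cross C1_const) (auto simp: C2_def)

lemma continuous_on_curl: "C1 f \<Longrightarrow> continuous_on UNIV (curl f)"
  unfolding curl_eq[abs_def]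
  by (intro continuous_on_sum continuous_on_cross continuous_on_const) (auto simp: C1_def)

lemma norm_cross3_le: "norm (cross3 x y) \<le> norm x * norm y"
proof -
  have "(norm (cross3 x y))\<^sup>2 \<le> (norm x * norm y)\<^sup>2"
    using norm_cross_dot[of x y] zero_le_power2[of "x \<bullet> y"] by linarith
  then show ?thesis by (rule power2_le_imp_le) simp
qed

lemma norm_curl_le: "norm (curl f x) \<le> (\<Sum>i\<in>UNIV. norm (pd i f x))"
  unfolding curl_eq
  by (rule sum_norm_le, rule order_trans[OF norm_cross3_le]) (simp add: norm_axis_1)

text \<open>The mean value theorem applied in direction \<open>i\<close> and then in direction \<open>j\<close>. The second difference
  on the left is symmetric in \<open>i\<close> and \<open>j\<close>, which forces the mixed partial derivatives to agree.\<close>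

lemma second_difference_mean_value:
  fixes f :: "real^3 \<Rightarrow> real"
  assumes f: "C2 f" and "h > 0"
  shows "\<exists>y. dist y x \<le> 2 * h \<and>
    f (x + h *\<^sub>R axis i 1 + h *\<^sub>R axis j 1) - f (x + h *\<^sub>R axis i 1) - f (x + h *\<^sub>R axis j 1) + f x
      = h * h * pd j (pd i f) y"
proof -
  define a b :: "real^3" where "a = axis i 1" and "b = axis j 1"
  have line: "((\<lambda>t. g (z + t *\<^sub>R axis k 1)) has_real_derivative pd k g (z + t *\<^sub>R axis k 1)) (at t)"
    if "C1 g" for g :: "real^3 \<Rightarrow> real" and z k t
  proof -
    have "((\<lambda>t. g (z + t *\<^sub>R axis k 1)) has_derivative
        (\<lambda>s. \<Sum>l\<in>UNIV. (s *\<^sub>R axis k 1) $ l *\<^sub>R pd l g (z + t *\<^sub>R axis k 1))) (at t)"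
      by (rule has_derivative_compose[OF _ has_derivative_pd[OF C1_differentiable[OF that]],
            where f="\<lambda>t. z + t *\<^sub>R axis k 1"]) (auto intro!: derivative_eq_intros)
    moreover have "(\<lambda>s. \<Sum>l\<in>UNIV. (s *\<^sub>R axis k 1 :: real^3) $ l *\<^sub>R pd l g (z + t *\<^sub>R axis k 1)) =
        (*) (pd k g (z + t *\<^sub>R axis k 1))"
      by (auto simp: axis_def fun_eq_iff if_distrib[of "\<lambda>c. _ * c"] if_distrib[of "\<lambda>c. c * _"] mult.commute cong: if_cong)
    ultimately show ?thesis by (simp add: has_field_derivative_def)
  qed
  have "\<exists>\<xi>. 0 < \<xi> \<and> \<xi> < h \<and> (f ((x + h *\<^sub>R b) + h *\<^sub>R a) - f (x + h *\<^sub>R a)) - (f ((x + h *\<^sub>R b) + 0 *\<^sub>R a) - f (x + 0 *\<^sub>R a))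
      = (h - 0) * (pd i f ((x + h *\<^sub>R b) + \<xi> *\<^sub>R a) - pd i f (x + \<xi> *\<^sub>R a))"
    unfolding a_def by (rule MVT2[OF \<open>h > 0\<close>]) (intro DERIV_diff line C2_C1 f)
  then obtain \<xi> where \<xi>: "0 < \<xi>" "\<xi> < h"
      "f (x + h *\<^sub>R a + h *\<^sub>R b) - f (x + h *\<^sub>R a) - f (x + h *\<^sub>R b) + f x =
        h * (pd i f (x + \<xi> *\<^sub>R a + h *\<^sub>R b) - pd i f (x + \<xi> *\<^sub>R a))"
    by (auto simp: algebra_simps)
  have "\<exists>\<eta>. 0 < \<eta> \<and> \<eta> < h \<and> pd i f ((x + \<xi> *\<^sub>R a) + h *\<^sub>R b) - pd i f ((x + \<xi> *\<^sub>R a) + 0 *\<^sub>R b)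
      = (h - 0) * pd j (pd i f) ((x + \<xi> *\<^sub>R a) + \<eta> *\<^sub>R b)"
    unfolding b_def by (rule MVT2[OF \<open>h > 0\<close>]) (intro line C2_pd f)
  then obtain \<eta> where \<eta>: "0 < \<eta>" "\<eta> < h"
      "pd i f (x + \<xi> *\<^sub>R a + h *\<^sub>R b) - pd i f (x + \<xi> *\<^sub>R a) = h * pd j (pd i f) (x + \<xi> *\<^sub>R a + \<eta> *\<^sub>R b)"
    by auto
  have "norm (\<xi> *\<^sub>R a + \<eta> *\<^sub>R b) \<le> norm (\<xi> *\<^sub>R a) + norm (\<eta> *\<^sub>R b)" by (rule norm_triangle_ineq)
  also have "\<dots> \<le> 2 * h" using \<xi> \<eta> by (simp add: a_def b_def norm_axis_1)
  finally have "dist (x + \<xi> *\<^sub>R a + \<eta> *\<^sub>R b) x \<le> 2 * h" by (simp add: dist_norm add.assoc)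
  then show ?thesis using \<xi>(3) \<eta>(3) unfolding a_def b_def
    by (intro exI[of _ "x + \<xi> *\<^sub>R axis i 1 + \<eta> *\<^sub>R axis j 1"]) simp
qed

lemma pd_commute:
  fixes f :: "real^3 \<Rightarrow> real"
  assumes f: "C2 f"
  shows "pd i (pd j f) x = pd j (pd i f) x"
proof -
  (* Side lengths of squares shrinking to x: for each of them the two mixed derivatives take the same value, at possibly different points nearby. *)
  define h :: "nat \<Rightarrow> real" where "h n = inverse (real (Suc n))" for n
  have h: "h n > 0" for n by (simp add: h_def)
  have "\<forall>n. \<exists>y z. dist y x \<le> 2 * h n \<and> dist z x \<le> 2 * h n \<and> pd j (pd i f) y = pd i (pd j f) z"
  proof
    fix n
    from second_difference_mean_value[OF f h[of n], of x i j] second_difference_mean_value[OF f h[of n], of x j i]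
    obtain y z where "dist y x \<le> 2 * h n" "dist z x \<le> 2 * h n"
      "h n * h n * pd j (pd i f) y = h n * h n * pd i (pd j f) z"
      by (auto simp: algebra_simps)
    then show "\<exists>y z. dist y x \<le> 2 * h n \<and> dist z x \<le> 2 * h n \<and> pd j (pd i f) y = pd i (pd j f) z"
      using h[of n] by auto
  qed
  then obtain y z where yz: "\<And>n. dist (y n) x \<le> 2 * h n" "\<And>n. dist (z n) x \<le> 2 * h n"
      "\<And>n. pd j (pd i f) (y n) = pd i (pd j f) (z n)"
    by metis
  have h0: "(\<lambda>n. 2 * h n) \<longlonglongrightarrow> 0"
    using tendsto_mult_right_zero[OF LIMSEQ_inverse_real_of_nat, of 2] unfolding h_def .
  have "(\<lambda>n. dist (y n) x) \<longlonglongrightarrow> 0" "(\<lambda>n. dist (z n) x) \<longlonglongrightarrow> 0"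
    using yz(1,2) by (auto intro!: Lim_null_comparison[OF _ h0])
  then have "y \<longlonglongrightarrow> x" "z \<longlonglongrightarrow> x"
    by (simp_all add: tendsto_dist_iff[symmetric])
  moreover have "isCont (pd j (pd i f)) x" "isCont (pd i (pd j f)) x"
    using f by (auto simp: C2_def C1_def continuous_on_eq_continuous_at)
  ultimately have "(\<lambda>n. pd j (pd i f) (y n)) \<longlonglongrightarrow> pd j (pd i f) x" "(\<lambda>n. pd i (pd j f) (z n)) \<longlonglongrightarrow> pd i (pd j f) x"
    by (auto intro: isCont_tendsto_compose)
  with yz(3) show ?thesis by (simp add: LIMSEQ_unique)
qed

section \<open>Integration by parts\<close>

definition csupp :: "(real^3 \<Rightarrow> 'b::real_normed_vector) \<Rightarrow> bool" where
  "csupp f \<longleftrightarrow> (\<exists>R. \<forall>x. R \<le> norm x \<longrightarrow> f x = 0)"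

lemma csupp_integrable:
  fixes f :: "real^3 \<Rightarrow> 'b::{banach, second_countable_topology}"
  assumes "continuous_on UNIV f" "csupp f"
  shows "integrable lborel f"
proof -
  obtain R where R: "\<And>x. R \<le> norm x \<Longrightarrow> f x = 0" using assms(2) by (auto simp: csupp_def)
  have "integrable lborel (\<lambda>x. indicator (cball 0 R) x *\<^sub>R f x)"
    by (intro borel_integrable_compact continuous_on_subset[OF assms(1)]) auto
  also have "(\<lambda>x. indicator (cball 0 R) x *\<^sub>R f x) = f"
    using R by (auto simp: indicator_def fun_eq_iff)
  finally show ?thesis .
qed

lemma csupp_pd: assumes "csupp f" shows "csupp (pd i f)"
proof -
  obtain R where R: "\<And>x. R \<le> norm x \<Longrightarrow> f x = 0" using assms by (auto simp: csupp_def)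
  have "pd i f x = 0" if "R + 1 \<le> norm x" for x
  proof -
    have "(f has_derivative (\<lambda>h. 0)) (at x)"
    proof (rule has_derivative_transform_within_open[of "\<lambda>x. 0" _ _ _ "- cball 0 R"])
      show "x \<in> - cball 0 R" using that by auto
      show "\<And>x. x \<in> - cball 0 R \<Longrightarrow> 0 = f x" using R by auto
    qed auto
    from pd_eqI[OF this] show ?thesis .
  qed
  then show ?thesis by (auto simp: csupp_def)
qed

lemma csupp_bilinear_right: "bounded_bilinear P \<Longrightarrow> csupp g \<Longrightarrow> csupp (\<lambda>x. P (f x) (g x))"
  unfolding csupp_def by (metis bounded_bilinear.zero_right)

lemma csupp_bilinear_left: "bounded_bilinear P \<Longrightarrow> csupp f \<Longrightarrow> csupp (\<lambda>x. P (f x) (g x))"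
  unfolding csupp_def by (metis bounded_bilinear.zero_left)

lemma csupp_sum: "finite A \<Longrightarrow> (\<And>j. j \<in> A \<Longrightarrow> csupp (f j)) \<Longrightarrow> csupp (\<lambda>x. \<Sum>j\<in>A. f j x)"
proof (induction A rule: finite_induct)
  case (insert a A)
  have "csupp (f a)" using insert by blast
  then obtain R where R: "\<And>x. R \<le> norm x \<Longrightarrow> f a x = 0" by (auto simp: csupp_def)
  obtain S where S: "\<And>x. S \<le> norm x \<Longrightarrow> (\<Sum>j\<in>A. f j x) = 0" using insert by (auto simp: csupp_def)
  show ?case unfolding csupp_def
    by (rule exI[of _ "max R S"]) (use R S insert in auto)
qed (auto simp: csupp_def)

lemma csupp_curl: "csupp f \<Longrightarrow> csupp (curl f)"
  unfolding curl_eq[abs_def]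
  by (intro csupp_sum csupp_bilinear_right[OF bounded_bilinear_cross3] csupp_pd) auto

lemma lborel_translate:
  fixes c :: "'a::euclidean_space"
  shows "distr lborel borel (\<lambda>x. x + c) = lborel"
  using lborel_affine[of 1 c] by (simp add: density_1 add.commute)

lemma integral_translate:
  fixes f :: "'a::euclidean_space \<Rightarrow> 'b::{banach, second_countable_topology}"
  assumes [measurable]: "f \<in> borel_measurable borel"
  shows "integral\<^sup>L lborel (\<lambda>x. f (x + c)) = integral\<^sup>L lborel f"
proof -
  have "integral\<^sup>L lborel f = integral\<^sup>L (distr lborel borel (\<lambda>x. x + c)) f"
    by (simp add: lborel_translate)
  also have "\<dots> = integral\<^sup>L lborel (\<lambda>x. f (x + c))"
    by (rule integral_distr) auto
  finally show ?thesis ..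
qed

lemma nn_integral_translate:
  fixes f :: "'a::euclidean_space \<Rightarrow> ennreal"
  assumes [measurable]: "f \<in> borel_measurable borel"
  shows "(\<integral>\<^sup>+x. f (x + c) \<partial>lborel) = (\<integral>\<^sup>+x. f x \<partial>lborel)"
proof -
  have "(\<integral>\<^sup>+x. f x \<partial>lborel) = (\<integral>\<^sup>+x. f x \<partial>distr lborel borel (\<lambda>x. x + c))"
    by (simp add: lborel_translate)
  also have "\<dots> = (\<integral>\<^sup>+x. f (x + c) \<partial>lborel)"
    by (rule nn_integral_distr) auto
  finally show ?thesis ..
qed

lemma C1_line_derivative:
  assumes "C1 f"
  shows "((\<lambda>t. f (x + t *\<^sub>R h)) has_vector_derivative (\<Sum>i\<in>UNIV. h $ i *\<^sub>R pd i f (x + t *\<^sub>R h))) (at t within S)"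
proof -
  have "((\<lambda>t. f (x + t *\<^sub>R h)) has_derivative
      (\<lambda>s. \<Sum>i\<in>UNIV. (s *\<^sub>R h) $ i *\<^sub>R pd i f (x + t *\<^sub>R h))) (at t within S)"
    by (rule has_derivative_compose[OF _ has_derivative_pd[OF C1_differentiable[OF assms]],
          where f="\<lambda>t. x + t *\<^sub>R h"])
       (auto intro!: derivative_eq_intros)
  then show ?thesis
    by (simp add: has_vector_derivative_def scaleR_sum_right)
qed

lemma C1_line_integral:
  fixes f :: "real^3 \<Rightarrow> 'b::euclidean_space"
  assumes "C1 f"
  shows "f (x + h) - f x =
    (\<integral>t. indicator {0..1} t *\<^sub>R (\<Sum>i\<in>UNIV. h $ i *\<^sub>R pd i f (x + t *\<^sub>R h)) \<partial>lborel)"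
proof -
  have "(\<integral>t. indicator {0..1} t *\<^sub>R (\<Sum>i\<in>UNIV. h $ i *\<^sub>R pd i f (x + t *\<^sub>R h)) \<partial>lborel)
     = f (x + 1 *\<^sub>R h) - f (x + 0 *\<^sub>R h)"
  proof (rule integral_FTC_Icc)
    fix t :: real
    show "((\<lambda>t. f (x + t *\<^sub>R h)) has_vector_derivative (\<Sum>i\<in>UNIV. h $ i *\<^sub>R pd i f (x + t *\<^sub>R h)))
      (at t within {0..1})" by (rule C1_line_derivative[OF assms])
  next
    show "continuous_on {0..1} (\<lambda>t. \<Sum>i\<in>UNIV. h $ i *\<^sub>R pd i f (x + t *\<^sub>R h))"
      by (intro continuous_intros continuous_on_compose2[OF C1_pd_cont[OF assms]]) auto
  qed simp
  then show ?thesis by simp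
qed

text \<open>The difference \<open>f (x + e) - f x\<close> has integral zero by translation invariance. It is also the
  integral of the partial derivative over the segment from \<open>x\<close> to \<open>x + e\<close>, and Fubini's theorem together with
  translation invariance turns this average back into the integral of the derivative itself.\<close>

lemma integral_pd_eq_0:
  fixes f :: "real^3 \<Rightarrow> 'b::euclidean_space"
  assumes f: "C1 f" "csupp f"
  shows "integral\<^sup>L lborel (pd i f) = 0"
proof -
  define e :: "real^3" where "e = axis i 1"
  let ?g = "pd i f"
  have e: "norm e = 1" "\<And>x. (\<Sum>j\<in>UNIV. e $ j *\<^sub>R pd j f x) = ?g x"
    subgoal by (simp add: e_def norm_axis_1)
    subgoal by (simp add: e_def axis_def if_distrib[of "\<lambda>c. c *\<^sub>R _"] cong: if_cong)
    done
  obtain R where R: "\<And>x. R \<le> norm x \<Longrightarrow> ?g x = 0"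
    using csupp_pd[OF f(2), of i] by (auto simp: csupp_def)
  note [continuous_intros] = continuous_on_compose2[OF C1_pd_cont[OF f(1)]] continuous_on_compose2[OF C1_cont[OF f(1)]]
  have [measurable]: "f \<in> borel_measurable borel" "?g \<in> borel_measurable borel"
    using f by (auto intro!: borel_measurable_continuous_onI C1_cont C1_pd_cont)
  have int: "integrable (lborel \<Otimes>\<^sub>M lborel) (\<lambda>(x, t). indicator {0..1} t *\<^sub>R ?g (x + t *\<^sub>R e))"
  proof -
    have "integrable lborel (\<lambda>z. indicator (cball (0::real^3) (R + 1) \<times> {0..1}) z *\<^sub>R ?g (fst z + snd z *\<^sub>R e))"
      by (intro borel_integrable_compact compact_Times continuous_intros) auto
    also have "(\<lambda>z. indicator (cball (0::real^3) (R + 1) \<times> {0..1}) z *\<^sub>R ?g (fst z + snd z *\<^sub>R e)) =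
       (\<lambda>(x, t). indicator {0..1} t *\<^sub>R ?g (x + t *\<^sub>R e))"
    proof -
      have "?g (x + t *\<^sub>R e) = 0" if "0 \<le> t" "t \<le> 1" and x: "\<not> norm x \<le> R + 1" for x :: "real^3" and t :: real
      proof -
        have "norm x \<le> norm (x + t *\<^sub>R e) + norm (t *\<^sub>R e)"
          using norm_triangle_ineq4[of "x + t *\<^sub>R e" "t *\<^sub>R e"] by simp
        also have "norm (t *\<^sub>R e) \<le> 1" using that e by simp
        finally show "?g (x + t *\<^sub>R e) = 0" using x by (intro R) simp
      qed
      then show ?thesis by (fastforce simp: fun_eq_iff indicator_def)
    qed
    finally show ?thesis by (simp add: lborel_prod)
  qed
  have intf: "integrable lborel f" "integrable lborel (\<lambda>x. f (x + e))"
  proof -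
    show "integrable lborel f" by (intro csupp_integrable C1_cont f)
    then have "integrable (distr lborel borel (\<lambda>x. x + e)) f" by (simp add: lborel_translate)
    then show "integrable lborel (\<lambda>x. f (x + e))" by (subst (asm) integrable_distr_eq) auto
  qed
  have "0 = (\<integral>x. f (x + e) - f x \<partial>lborel)"
    using intf by (simp add: integral_translate)
  also have "\<dots> = (\<integral>x. (\<integral>t. indicator {0..1} t *\<^sub>R ?g (x + t *\<^sub>R e) \<partial>lborel) \<partial>lborel)"
    by (simp add: C1_line_integral[OF f(1)] e)
  also have "\<dots> = (\<integral>t. (\<integral>x. indicator {0..1} t *\<^sub>R ?g (x + t *\<^sub>R e) \<partial>lborel) \<partial>lborel)"
    using lborel_pair.Fubini_integral[OF int] by simp
  also have "\<dots> = integral\<^sup>L lborel ?g" by (simp add: integral_translate)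
  finally show ?thesis ..
qed

text \<open>The difference of the two integrands is minus the sum of the \<open>i\<close>-th derivatives of
  \<open>(e\<^sub>i \<times> X) \<bullet> H\<close>.\<close>

lemma integral_curl_by_parts:
  assumes X: "C1 X" and H: "C1 H" "csupp H"
  shows "(\<integral>x. X x \<bullet> curl H x \<partial>lborel) = (\<integral>x. curl X x \<bullet> H x \<partial>lborel)"
proof -
  define Z where "Z i x = cross3 (axis i 1) (X x) \<bullet> H x" for i :: 3 and x
  have Z: "C1 (Z i)" "csupp (Z i)" for i
    unfolding Z_def by (intro C1_inner C1_cross C1_const X H, 
      intro csupp_bilinear_right[OF bounded_bilinear_inner] H)
  have "X x \<bullet> curl H x - curl X x \<bullet> H x = - (\<Sum>i\<in>UNIV. pd i (Z i) x)" for x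
  proof -
    have "pd i (Z i) x = cross3 (axis i 1) (X x) \<bullet> pd i H x + cross3 (axis i 1) (pd i X x) \<bullet> H x" for i
      unfolding Z_def by (simp add: pd_inner pd_cross C1_differentiable[OF C1_cross] C1_differentiable X H)
    then show ?thesis
      by (simp only:) (simp add: curl_eq inner_sum_left inner_sum_right
       cross_components inner_vec_def sum_3 axis_def algebra_simps)
  qed
  moreover have "integrable lborel (\<lambda>x. X x \<bullet> curl H x)" "integrable lborel (\<lambda>x. curl X x \<bullet> H x)"
    by (intro csupp_integrable continuous_intros C1_cont continuous_on_curl X H
      csupp_bilinear_right[OF bounded_bilinear_inner] csupp_curl)+
  ultimately have "(\<integral>x. X x \<bullet> curl H x \<partial>lborel) - (\<integral>x. curl X x \<bullet> H x \<partial>lborel) =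
     - (\<integral>x. (\<Sum>i\<in>UNIV. pd i (Z i) x) \<partial>lborel)"
    by (subst Bochner_Integration.integral_diff[symmetric]) auto
  also have "\<dots> = 0"
    using Z by (subst Bochner_Integration.integral_sum)
      (auto simp: integral_pd_eq_0 intro!: csupp_integrable csupp_pd C1_pd_cont)
  finally show ?thesis by simp
qed

section \<open>A compactly supported mollifier\<close>

text \<open>The \<open>n\<close>-th derivative of \<open>exp (- 1 / (1 - t\<^sup>2))\<close> is this function times a polynomial in \<open>t\<close>
  and the power \<open>- 2 n\<close> of \<open>1 - t\<^sup>2\<close>; the recursion is the quotient rule for that polynomial.\<close>

primrec bump_poly :: "nat \<Rightarrow> real poly" where
  "bump_poly 0 = 1"
| "bump_poly (Suc n) = pderiv (bump_poly n) * [:1, 0, -1:]^2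
     + smult (4 * real n) ([:0, 1:] * [:1, 0, -1:] * bump_poly n) - smult 2 ([:0, 1:] * bump_poly n)"

definition bump :: "nat \<Rightarrow> real \<Rightarrow> real" where
  "bump n t = (if \<bar>t\<bar> < 1
     then poly (bump_poly n) t * inverse (1 - t\<^sup>2) ^ (2 * n) * exp (- inverse (1 - t\<^sup>2)) else 0)"

lemma DERIV_zero_of_quadratic:
  fixes f :: "real \<Rightarrow> real"
  assumes "f t = 0" "\<And>s. \<bar>f s\<bar> \<le> K * (s - t)\<^sup>2"
  shows "(f has_real_derivative 0) (at t)"
proof -
  have "((\<lambda>s. (f s - f t) / (s - t)) \<longlongrightarrow> 0) (at t)"
  proof (rule Lim_null_comparison)
    show "eventually (\<lambda>s. norm ((f s - f t) / (s - t)) \<le> K * \<bar>s - t\<bar>) (at t)"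
    proof (rule eventually_at_topological[THEN iffD2], intro exI[of _ UNIV], safe)
      fix s assume "s \<noteq> t"
      then show "norm ((f s - f t) / (s - t)) \<le> K * \<bar>s - t\<bar>"
        using assms(2)[of s] assms(1) by (simp add: divide_le_eq power2_eq_square mult.assoc)
    qed auto
    have "((\<lambda>s. K * \<bar>s - t\<bar>) \<longlongrightarrow> K * \<bar>t - t\<bar>) (at t)" by (intro tendsto_intros)
    then show "((\<lambda>s. K * \<bar>s - t\<bar>) \<longlongrightarrow> 0) (at t)" by simp
  qed
  then show ?thesis by (simp add: has_field_derivative_iff)
qed

lemma power_div_fact_le_exp: "0 \<le> x \<Longrightarrow> x ^ k / fact k \<le> exp (x::real)"
proof -
  assume x: "0 \<le> x"
  have "(\<Sum>n\<in>{k}. x ^ n /\<^sub>R fact n) \<le> (\<Sum>n. x ^ n /\<^sub>R fact n)"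
    by (rule sum_le_suminf) (use x in \<open>auto simp: summable_exp\<close>)
  then show ?thesis by (simp add: exp_def divide_inverse mult.commute)
qed

text \<open>The exponential series gives \<open>exp (- 1 / w) \<le> (2 n + 2)! w ^ (2 n + 2)\<close>, which beats the
  singular factor with a factor \<open>w\<^sup>2\<close> to spare. The resulting quadratic vanishing makes every
  derivative extend by zero across the boundary.\<close>

lemma bump_quadratic_at_boundary:
  assumes "\<bar>t\<bar> = 1"
  shows "\<exists>K. \<forall>s. \<bar>bump n s\<bar> \<le> K * (s - t)\<^sup>2"
proof -
  have "compact (poly (bump_poly n) ` {-1..1})"
    by (intro compact_continuous_image continuous_intros) auto
  then obtain B where B: "\<And>s. \<bar>s\<bar> \<le> 1 \<Longrightarrow> \<bar>poly (bump_poly n) s\<bar> \<le> B"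
    by (force dest!: compact_imp_bounded simp: bounded_iff abs_le_iff)
  have B0: "0 \<le> B" using B[of 0] by force
  define F :: real where "F = fact (2 * n + 2)"
  have "\<bar>bump n s\<bar> \<le> (B * F * 4) * (s - t)\<^sup>2" for s
  proof (cases "\<bar>s\<bar> < 1")
    case True
    define w where "w = 1 - s\<^sup>2"
    have w: "0 < w" using True by (simp add: w_def abs_square_less_1)
    have "inverse w ^ (2*n+2) / F \<le> exp (inverse w)"
      unfolding F_def by (rule power_div_fact_le_exp) (use w in simp)
    then have "inverse w ^ (2*n+2) \<le> F * exp (inverse w)"
      by (simp add: divide_le_eq F_def mult.commute)
    then have "inverse w ^ (2*n) * exp (- inverse w) \<le> F * w\<^sup>2"
      using w by (simp add: exp_minus field_simps power_add power2_eq_square)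
    then have "\<bar>poly (bump_poly n) s\<bar> * (inverse w ^ (2*n) * exp (- inverse w)) \<le> B * (F * w\<^sup>2)"
      using w True B0 \<open>_ \<le> F * w\<^sup>2\<close> by (intro mult_mono[of _ B "_ * _"] B) auto
    moreover have "\<bar>bump n s\<bar> = \<bar>poly (bump_poly n) s\<bar> * (inverse w ^ (2*n) * exp (- inverse w))"
      using w True by (simp add: bump_def w_def abs_mult power_mult)
    moreover have "w\<^sup>2 \<le> 4 * (s - t)\<^sup>2"
    proof -
      have "w = (1 - \<bar>s\<bar>) * (1 + \<bar>s\<bar>)" by (simp add: w_def algebra_simps power2_eq_square)
      also have "\<dots> \<le> \<bar>s - t\<bar> * 2" using True assms by (intro mult_mono) auto
      finally have "w\<^sup>2 \<le> (\<bar>s - t\<bar> * 2)\<^sup>2" using w by (intro power_mono) auto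
      then show ?thesis by (simp add: power_mult_distrib)
    qed
    then have "B * (F * w\<^sup>2) \<le> B * (F * (4 * (s - t)\<^sup>2))"
      using B0 by (intro mult_left_mono) (auto simp: F_def)
    ultimately show ?thesis by (simp add: mult.assoc)
  next
    case False
    then show ?thesis using B0 by (simp add: bump_def F_def)
  qed
  then show ?thesis by blast
qed

lemma bump_DERIV: "(bump n has_real_derivative bump (Suc n) t) (at t)"
proof -
  consider "\<bar>t\<bar> < 1" | "\<bar>t\<bar> = 1" | "\<bar>t\<bar> > 1" by linarith
  then show ?thesis
  proof cases
    case 1
    define w where "w = 1 - t\<^sup>2"
    have w: "w > 0" using 1 by (simp add: w_def abs_square_less_1)
    have D: "((\<lambda>t. poly (bump_poly n) t * inverse (1 - t\<^sup>2) ^ (2 * n) * exp (- inverse (1 - t\<^sup>2)))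
      has_real_derivative bump (Suc n) t) (at t)"
    proof (cases n)
      case 0
      show ?thesis using 1 w unfolding 0
        apply (auto intro!: derivative_eq_intros simp: w_def)
        apply (simp add: bump_def w_def field_simps power2_eq_square)
        done
    next
      case (Suc m)
      have "2 * n = Suc (2 * m + 1)" using Suc by simp
      then have *: "inverse w ^ (2 * n - Suc 0) = w * inverse w ^ (2 * n)"
        using w by (simp add: field_simps)
      show ?thesis using 1 w
        apply (auto intro!: derivative_eq_intros simp: w_def[symmetric] *)
        apply (simp add: bump_def w_def[symmetric] power_mult)
        apply (simp add: field_simps power2_eq_square)
        apply (simp add: w_def algebra_simps power2_eq_square)
        done
    qed
    show ?thesis
      by (rule has_field_derivative_transform_within_open[OF D, of "{-1<..<1}"])
         (use 1 in \<open>auto simp: bump_def abs_less_iff\<close>)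
  next
    case 2
    have "(bump n has_real_derivative 0) (at t)"
    proof -
      obtain K where "\<And>s. \<bar>bump n s\<bar> \<le> K * (s - t)\<^sup>2"
        using bump_quadratic_at_boundary[OF 2, of n] by blast
      then show ?thesis by (rule DERIV_zero_of_quadratic[rotated]) (use 2 in \<open>simp add: bump_def\<close>)
    qed
    then show ?thesis using 2 by (simp add: bump_def)
  next
    case 3
    have "(bump n has_real_derivative 0) (at t)"
      by (rule has_field_derivative_transform_within_open[of "\<lambda>_. 0" _ _ "- {-1..1}"])
         (use 3 in \<open>auto simp: bump_def\<close>)
    then show ?thesis using 3 by (simp add: bump_def)
  qed
qed

lemma bump_bounded: "\<exists>B. \<forall>t. \<bar>bump n t\<bar> \<le> B"
proof -
  have "continuous_on {-1..1} (bump n)"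
    by (intro continuous_at_imp_continuous_on ballI DERIV_isCont[OF bump_DERIV])
  then have "compact (bump n ` {-1..1})"
    by (rule compact_continuous_image) auto
  then obtain B where B: "\<And>s. \<bar>s\<bar> \<le> 1 \<Longrightarrow> \<bar>bump n s\<bar> \<le> B"
    by (force dest!: compact_imp_bounded simp: bounded_iff abs_le_iff)
  have "\<bar>bump n s\<bar> \<le> B" for s
    using B[of s] B[of 1] by (cases "\<bar>s\<bar> \<le> 1") (auto simp: bump_def)
  then show ?thesis by blast
qed

text \<open>Indexing by the orders of differentiation makes the family closed under partial
  derivatives, which is what smoothness of all orders asks for.\<close>

definition bump3 :: "(3 \<Rightarrow> nat) \<Rightarrow> real^3 \<Rightarrow> real" where
  "bump3 n y = bump (n 1) (y $ 1) * bump (n 2) (y $ 2) * bump (n 3) (y $ 3)"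

lemma bump3_bounded: "\<exists>B. \<forall>y. \<bar>bump3 n y\<bar> \<le> B"
proof -
  obtain B1 B2 B3 where B: "\<And>t. \<bar>bump (n 1) t\<bar> \<le> B1" "\<And>t. \<bar>bump (n 2) t\<bar> \<le> B2" "\<And>t. \<bar>bump (n 3) t\<bar> \<le> B3"
    using bump_bounded[of "n 1"] bump_bounded[of "n 2"] bump_bounded[of "n 3"] by blast
  have "0 \<le> B1" "0 \<le> B2" using B(1)[of 0] B(2)[of 0] by linarith+
  then have "\<bar>bump3 n y\<bar> \<le> B1 * B2 * B3" for y
    unfolding bump3_def abs_mult by (intro mult_mono B) auto
  then show ?thesis by blast
qed

lemma bump3_eq_0:
  assumes "2 \<le> norm y" shows "bump3 n y = 0"
proof (rule ccontr)
  assume "bump3 n y \<noteq> 0"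
  then have "bump (n 1) (y $ 1) \<noteq> 0" "bump (n 2) (y $ 2) \<noteq> 0" "bump (n 3) (y $ 3) \<noteq> 0"
    by (auto simp: bump3_def)
  then have "\<bar>y $ 1\<bar> < 1" "\<bar>y $ 2\<bar> < 1" "\<bar>y $ 3\<bar> < 1" by (auto simp: bump_def split: if_splits)
  then have "(y $ 1)\<^sup>2 < 1" "(y $ 2)\<^sup>2 < 1" "(y $ 3)\<^sup>2 < 1" by (auto simp: abs_square_less_1)
  then have "(norm y)\<^sup>2 < 2\<^sup>2"
    unfolding power2_norm_eq_inner by (simp add: inner_vec_def sum_3 power2_eq_square)
  then have "norm y < 2" by (rule power2_less_imp_less) simp
  then show False using assms by simp
qed

lemma bump3_affine_has_derivative:
  "((\<lambda>y. (c * bump3 n (a + b *\<^sub>R y)) *\<^sub>R v) has_derivative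
    (\<lambda>h. \<Sum>i\<in>UNIV. h $ i *\<^sub>R ((c * b * bump3 (n(i := Suc (n i))) (a + b *\<^sub>R x)) *\<^sub>R v))) (at x)"
proof -
  have *: "((\<lambda>y. bump m ((a + b *\<^sub>R y) $ i)) has_derivative (\<lambda>h. (b * h $ i) * bump (Suc m) ((a + b *\<^sub>R x) $ i))) (at x)" for m i
  proof (rule DERIV_compose_FDERIV[OF bump_DERIV])
    have "((\<lambda>y::real^3. y $ i) has_derivative (\<lambda>h. h $ i)) (at x)"
      by (rule bounded_linear.has_derivative[OF bounded_linear_vec_nth has_derivative_ident])
    then have "((\<lambda>y::real^3. a $ i + b * (y $ i)) has_derivative (\<lambda>h. 0 + b * h $ i)) (at x)"
      by (intro has_derivative_add has_derivative_const has_derivative_mult_right)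
    then show "((\<lambda>y. (a + b *\<^sub>R y) $ i) has_derivative (\<lambda>h. b * h $ i)) (at x)" by simp
  qed
  have "((\<lambda>y. bump3 n (a + b *\<^sub>R y)) has_derivative
     (\<lambda>h. b * (h $ 1 * bump3 (n(1 := Suc (n 1))) (a + b *\<^sub>R x) + h $ 2 * bump3 (n(2 := Suc (n 2))) (a + b *\<^sub>R x) +
       h $ 3 * bump3 (n(3 := Suc (n 3))) (a + b *\<^sub>R x)))) (at x)"
    unfolding bump3_def
    by (rule has_derivative_eq_rhs[OF has_derivative_mult[OF has_derivative_mult[OF * *] *]])
       (simp add: fun_eq_iff algebra_simps)
  from has_derivative_scaleR_left[OF has_derivative_mult_right[OF this, of c], of v]
  show ?thesis
    by (rule has_derivative_eq_rhs) (simp add: fun_eq_iff sum_3 algebra_simps)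
qed

lemma pd_bump3_affine: "pd i (\<lambda>y. (c * bump3 n (a + b *\<^sub>R y)) *\<^sub>R v) =
    (\<lambda>y. (c * b * bump3 (n(i := Suc (n i))) (a + b *\<^sub>R y)) *\<^sub>R v)"
proof
  fix x
  show "pd i (\<lambda>y. (c * bump3 n (a + b *\<^sub>R y)) *\<^sub>R v) x = (c * b * bump3 (n(i := Suc (n i))) (a + b *\<^sub>R x)) *\<^sub>R v"
    using pd_eqI[OF bump3_affine_has_derivative, of i c n a b v x]
    by (simp only: axis_def vec_lambda_beta if_distrib[of "\<lambda>r. r *\<^sub>R _"] scaleR_one scaleR_zero_left
        sum.delta finite UNIV_I if_True cong: if_cong)
qed

lemma smooth_bump3_affine: "smooth (\<lambda>y. (c * bump3 n (a + b *\<^sub>R y)) *\<^sub>R v)"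
proof -
  have d: "(\<lambda>y. (c * bump3 n (a + b *\<^sub>R y)) *\<^sub>R v) differentiable_on UNIV" for c n
    unfolding differentiable_on_def differentiable_def using bump3_affine_has_derivative by blast
  have "Ck k (\<lambda>y. (c * bump3 n (a + b *\<^sub>R y)) *\<^sub>R v)" for k
  proof (induction k arbitrary: c n)
    case 0
    show ?case using d differentiable_imp_continuous_on by auto
  next
    case (Suc k)
    show ?case using d by (simp add: pd_bump3_affine Suc)
  qed
  then show ?thesis by (simp add: smooth_def)
qed

abbreviation "bump0 \<equiv> bump3 (\<lambda>_. 0)"

lemma bump3_cont: "continuous_on UNIV (bump3 n)"
  using C1_cont[OF smooth_C1[OF smooth_bump3_affine[of 1 n 0 1 "1::real"]]] by simp

lemma bump0_nonneg: "0 \<le> bump0 y"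
  by (simp add: bump3_def bump_def)

lemma bump0_minus: "bump0 (- y) = bump0 y"
  by (simp add: bump3_def bump_def)

lemma bump0_integrable: "integrable lborel bump0"
  by (rule csupp_integrable[OF bump3_cont]) (use bump3_eq_0 in \<open>auto simp: csupp_def\<close>)

lemma bump0_integral_pos: "0 < integral\<^sup>L lborel bump0"
proof -
  define c :: real where "c = exp (- inverse (3 / 4))"
  have b: "c \<le> bump 0 t" if "\<bar>t\<bar> \<le> 1 / 2" for t
  proof -
    have "t\<^sup>2 \<le> (1 / 2)\<^sup>2" using that by (simp add: abs_le_square_iff[symmetric])
    then have "3 / 4 \<le> 1 - t\<^sup>2" by (simp add: power2_eq_square)
    then have "inverse (1 - t\<^sup>2) \<le> inverse (3 / 4)" by (intro le_imp_inverse_le) auto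
    then show ?thesis using that by (auto simp: bump_def c_def)
  qed
  have "c * c * c \<le> bump0 y" if "y \<in> ball 0 (1 / 2)" for y :: "real^3"
  proof -
    have "\<bar>y $ i\<bar> \<le> 1 / 2" for i using that component_le_norm_cart[of y i] by auto
    then show ?thesis unfolding bump3_def by (intro mult_mono b) (auto simp: c_def bump_def)
  qed
  then have "(\<integral>y. (c * c * c) * indicator (ball (0::real^3) (1 / 2)) y \<partial>lborel) \<le> integral\<^sup>L lborel bump0"
    by (intro integral_mono bump0_integrable integrable_mult_right integrable_real_indicator)
       (use emeasure_lborel_ball_finite in \<open>auto simp: bump0_nonneg less_top split: split_indicator\<close>)
  moreover have "0 < measure lborel (ball (0::real^3) (1 / 2))" by (rule content_ball_pos) simp
  moreover have "0 < c" by (simp add: c_def)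
  ultimately have "0 < c * c * c * measure lborel (ball (0::real^3) (1 / 2))" "c * c * c * measure lborel (ball (0::real^3) (1 / 2)) \<le> integral\<^sup>L lborel bump0"
    by simp_all
  then show ?thesis by linarith
qed

text \<open>The dilation by \<open>2 / r\<close> reflects that the cube of side two around the origin lies in the ball of radius \<open>2\<close>.\<close>

definition rho :: "real \<Rightarrow> real^3 \<Rightarrow> real" where
  "rho r y = (2 / r) ^ 3 / integral\<^sup>L lborel bump0 * bump0 ((2 / r) *\<^sub>R y)"

lemma rho_nonneg: "0 < r \<Longrightarrow> 0 \<le> rho r y"
  using bump0_integral_pos by (simp add: rho_def bump0_nonneg)

lemma rho_minus: "rho r (- y) = rho r y"
  by (simp add: rho_def bump0_minus)

lemma rho_eq_0: "0 < r \<Longrightarrow> r \<le> norm y \<Longrightarrow> rho r y = 0"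
  by (simp add: rho_def bump3_eq_0 field_simps)

lemma smooth_rho: "smooth (\<lambda>y. rho r (a + b *\<^sub>R y) *\<^sub>R v)"
  unfolding rho_def scaleR_add_right scaleR_scaleR by (rule smooth_bump3_affine)

lemma C1_rho: "C1 (rho r)"
  using smooth_C1[OF smooth_rho[of r 0 1 "1::real"]] by simp

lemma rho_integral:
  assumes r: "0 < r"
  shows "integral\<^sup>L lborel (rho r) = 1"
proof -
  have "integral\<^sup>L lborel bump0 = integral\<^sup>L (density (distr lborel borel (\<lambda>x. 0 + (2 / r) *\<^sub>R x)) (\<lambda>_. ennreal (\<bar>2 / r\<bar>^DIM(real^3)))) bump0"
    using r by (subst lborel_affine[of "2 / r" 0]) auto
  also have "\<dots> = (2 / r) ^ 3 * integral\<^sup>L lborel (\<lambda>x. bump0 ((2 / r) *\<^sub>R x))"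
    using r borel_measurable_continuous_onI[OF bump3_cont]
    by (subst integral_density) (auto simp: integral_distr)
  finally have *: "integral\<^sup>L lborel bump0 = (2 / r) ^ 3 * integral\<^sup>L lborel (\<lambda>x. bump0 ((2 / r) *\<^sub>R x))" .
  have "integral\<^sup>L lborel (rho r) = (2 / r) ^ 3 / integral\<^sup>L lborel bump0 * integral\<^sup>L lborel (\<lambda>x. bump0 ((2 / r) *\<^sub>R x))"
    unfolding rho_def[abs_def] by (rule integral_mult_right_zero)
  also have "\<dots> = integral\<^sup>L lborel bump0 / integral\<^sup>L lborel bump0" by (subst (2) *) simp
  also have "\<dots> = 1" using bump0_integral_pos by simp
  finally show ?thesis .
qed

lemma rho_pd_bounds:
  "\<exists>K>0. \<forall>r>0. \<forall>y. \<bar>rho r y\<bar> \<le> K / r ^ 3 \<and> (\<forall>i. \<bar>pd i (rho r) y\<bar> \<le> K / r ^ 4)"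
proof -
  define J where "J = integral\<^sup>L lborel bump0"
  have J: "J > 0" using bump0_integral_pos by (simp add: J_def)
  obtain B where B: "\<And>y. \<bar>bump0 y\<bar> \<le> B" using bump3_bounded by blast
  have "\<forall>i. \<exists>B. \<forall>y. \<bar>bump3 ((\<lambda>_. 0)(i := Suc 0)) y\<bar> \<le> B" using bump3_bounded by blast
  then obtain A where A: "\<And>i y. \<bar>bump3 ((\<lambda>_. 0)(i := Suc 0)) y\<bar> \<le> A i" by metis
  define K where "K = 16 / J * (1 + B + (\<Sum>i\<in>UNIV. A i))"
  have A0: "0 \<le> A i" for i using A[of i 0] by linarith
  have B0: "0 \<le> B" using B[of 0] by linarith
  have AS: "A i \<le> (\<Sum>i\<in>UNIV. A i)" for i by (rule member_le_sum) (use A0 in auto)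
  have "\<bar>rho r y\<bar> \<le> K / r ^ 3" if r: "r > 0" for r y
  proof -
    have "\<bar>rho r y\<bar> = (8 / J) * \<bar>bump0 ((2 / r) *\<^sub>R y)\<bar> / r ^ 3"
      using r J by (simp add: rho_def J_def abs_mult power_divide)
    also have "\<dots> \<le> (16 / J) * (1 + B + (\<Sum>i\<in>UNIV. A i)) / r ^ 3"
    proof (intro divide_right_mono mult_mono)
      have "0 \<le> (\<Sum>i\<in>UNIV. A i)" by (simp add: A0 sum_nonneg)
      then show "\<bar>bump0 ((2 / r) *\<^sub>R y)\<bar> \<le> 1 + B + (\<Sum>i\<in>UNIV. A i)"
        using B[of "(2 / r) *\<^sub>R y"] by linarith
    qed (use r J in \<open>auto simp: divide_right_mono\<close>)
    finally show ?thesis by (simp add: K_def)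
  qed
  moreover have "\<bar>pd i (rho r) y\<bar> \<le> K / r ^ 4" if r: "r > 0" for r y i
  proof -
    have "pd i (rho r) = pd i (\<lambda>y. ((2 / r) ^ 3 / J * bump0 (0 + (2 / r) *\<^sub>R y)) *\<^sub>R (1::real))"
      by (rule arg_cong[where f="pd i"]) (simp add: rho_def fun_eq_iff J_def)
    then have "pd i (rho r) y = (2 / r) ^ 3 / J * (2 / r) * bump3 ((\<lambda>_. 0)(i := Suc 0)) ((2 / r) *\<^sub>R y)"
      unfolding pd_bump3_affine by simp
    then have "\<bar>pd i (rho r) y\<bar> = (16 / J) * \<bar>bump3 ((\<lambda>_. 0)(i := Suc 0)) ((2 / r) *\<^sub>R y)\<bar> / r ^ 4"
      using r J by (simp add: abs_mult power_divide eval_nat_numeral)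
    also have "\<dots> \<le> (16 / J) * (1 + B + (\<Sum>i\<in>UNIV. A i)) / r ^ 4"
      using r J A0 B0 AS[of i] by (intro divide_right_mono mult_mono order_trans[OF A]) auto
    finally show ?thesis by (simp add: K_def)
  qed
  moreover have "0 < K" unfolding K_def using J B0 A0 by (intro mult_pos_pos divide_pos_pos add_pos_nonneg sum_nonneg) auto
  ultimately show ?thesis by blast
qed

lemma test_field_rho:
  assumes "r > 0" shows "test_field (\<lambda>y. rho r (x - y) *\<^sub>R v)"
proof -
  have "smooth (\<lambda>y. rho r (x + (-1) *\<^sub>R y) *\<^sub>R v)" by (rule smooth_rho)
  moreover have "{y. rho r (x - y) *\<^sub>R v \<noteq> 0} \<subseteq> cball x r"
    using rho_eq_0[OF assms] by (force simp: dist_norm)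
  then have "bounded {y. rho r (x - y) *\<^sub>R v \<noteq> 0}"
    using bounded_cball bounded_subset by blast
  ultimately show ?thesis by (simp add: test_field_def compact_closure)
qed

section \<open>Differentiation under the integral sign\<close>

lemma C1_increment_bound:
  fixes f :: "real^3 \<Rightarrow> 'b::euclidean_space"
  assumes f: "C1 f" and w: "\<And>y i. y \<in> ball x d \<Longrightarrow> norm (pd i f y) \<le> w" and y: "y \<in> ball x d"
  shows "norm (f y - f x) \<le> 3 * w * norm (y - x)"
proof -
  have "norm (f y - f x) \<le> (3 * w) * norm (y - x)"
  proof (rule differentiable_bound[where S="ball x d"])
    fix z assume z: "z \<in> ball x d"
    show "(f has_derivative (\<lambda>h. \<Sum>i\<in>UNIV. h $ i *\<^sub>R pd i f z)) (at z within ball x d)"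
      using has_derivative_pd[OF C1_differentiable[OF f]] has_derivative_at_withinI by blast
    show "onorm (\<lambda>h. \<Sum>i\<in>UNIV. h $ i *\<^sub>R pd i f z) \<le> 3 * w"
    proof (rule onorm_bound)
      show "0 \<le> 3 * w" using order_trans[OF norm_ge_zero w[OF z]] by simp
      fix h :: "real^3"
      have "norm (\<Sum>i\<in>UNIV. h $ i *\<^sub>R pd i f z) \<le> (\<Sum>i\<in>(UNIV::3 set). norm h * w)"
        by (rule sum_norm_le) (auto intro!: mult_mono w z component_le_norm_cart)
      then show "norm (\<Sum>i\<in>UNIV. h $ i *\<^sub>R pd i f z) \<le> 3 * w * norm h" by (simp add: mult_ac)
    qed
  qed (use y in \<open>auto simp: dist_norm intro: le_less_trans[OF norm_ge_zero]\<close>)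
  then show ?thesis .
qed

text \<open>Difference quotients of the integrand are dominated through the mean value inequality by the
  bound \<open>w\<close> on its partial derivatives, so dominated convergence gives the total derivative of the integral
  directly.\<close>

lemma
  fixes k :: "real^3 \<Rightarrow> 'z \<Rightarrow> 'b::euclidean_space"
  assumes k: "\<And>z. z \<in> space M \<Longrightarrow> C1 (\<lambda>x. k x z)"
    and int: "\<And>x. integrable M (k x)"
    and meas: "\<And>x i. (\<lambda>z. pd i (\<lambda>x. k x z) x) \<in> borel_measurable M"
    and dom: "\<And>x. \<exists>w. integrable M w \<and>
      (AE z in M. \<forall>y\<in>ball x 1. \<forall>i. norm (pd i (\<lambda>x. k x z) y) \<le> w z)"
  shows C1_parametric_integral: "C1 (\<lambda>x. \<integral>z. k x z \<partial>M)"
    and pd_parametric_integral: "pd i (\<lambda>x. \<integral>z. k x z \<partial>M) x = (\<integral>z. pd i (\<lambda>x. k x z) x \<partial>M)"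
proof -
  define F where "F x = (\<integral>z. k x z \<partial>M)" for x
  define G where "G i x = (\<integral>z. pd i (\<lambda>x. k x z) x \<partial>M)" for i x
  have intpd: "integrable M (\<lambda>z. pd i (\<lambda>x. k x z) x)" for i x
  proof -
    from dom[of x] obtain w where w': "integrable M w \<and>
      (AE z in M. \<forall>y\<in>ball x 1. \<forall>i. norm (pd i (\<lambda>x. k x z) y) \<le> w z)" ..
    have "AE z in M. norm (pd i (\<lambda>x. k x z) x) \<le> norm (w z)"
      using conjunct2[OF w']
    proof eventually_elim
      case (elim z)
      then have "norm (pd i (\<lambda>x. k x z) x) \<le> w z" by simp
      then show ?case by (simp add: order_trans[OF _ abs_ge_self])
    qed
    then show ?thesis
      by (rule Bochner_Integration.integrable_bound[OF conjunct1[OF w'] meas])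
  qed
  have D: "(F has_derivative (\<lambda>h. \<Sum>i\<in>UNIV. h $ i *\<^sub>R G i x)) (at x)" for x
  proof -
    from dom[of x] obtain w where w': "integrable M w \<and>
      (AE z in M. \<forall>y\<in>ball x 1. \<forall>i. norm (pd i (\<lambda>x. k x z) y) \<le> w z)" ..
    note w = conjunct1[OF w'] conjunct2[OF w']
    define q where "q y z = (1 / norm (y - x)) *\<^sub>R (k y z - (k x z + (\<Sum>i\<in>UNIV. (y - x) $ i *\<^sub>R pd i (\<lambda>x. k x z) x)))" for y z
    have q_int: "(\<integral>z. q y z \<partial>M) = (1 / norm (y - x)) *\<^sub>R (F y - (F x + (\<Sum>i\<in>UNIV. (y - x) $ i *\<^sub>R G i x)))" for y
      unfolding q_def F_def G_def using int intpd by simp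
    have q_meas: "q y \<in> borel_measurable M" for y
      unfolding q_def using borel_measurable_integrable[OF int] meas by measurable
    have q_bound: "norm (q y z) \<le> 6 * w z" if "y \<in> ball x 1" "z \<in> space M"
      and wz: "\<forall>y\<in>ball x 1. \<forall>i. norm (pd i (\<lambda>x. k x z) y) \<le> w z" for y z
    proof (cases "y = x")
      case True
      have "0 \<le> w z" by (rule order_trans[OF norm_ge_zero wz[rule_format, of x]]) simp
      then show ?thesis using True by (simp add: q_def)
    next
      case False
      have "norm (k y z - k x z) \<le> 3 * w z * norm (y - x)"
        by (rule C1_increment_bound[OF k[OF that(2)] wz[rule_format] that(1)])
      moreover have "norm (\<Sum>i\<in>UNIV. (y - x) $ i *\<^sub>R pd i (\<lambda>x. k x z) x) \<le> (\<Sum>i\<in>(UNIV::3 set). norm (y - x) * w z)"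
      proof (rule sum_norm_le)
        fix i show "norm ((y - x) $ i *\<^sub>R pd i (\<lambda>x. k x z) x) \<le> norm (y - x) * w z"
          unfolding norm_scaleR
          by (intro mult_mono wz[rule_format]) (auto simp: component_le_norm_cart simp del: vector_minus_component)
      qed
      ultimately have "norm (k y z - (k x z + (\<Sum>i\<in>UNIV. (y - x) $ i *\<^sub>R pd i (\<lambda>x. k x z) x))) \<le> 6 * w z * norm (y - x)"
        using norm_triangle_ineq4[of "k y z - k x z" "\<Sum>i\<in>UNIV. (y - x) $ i *\<^sub>R pd i (\<lambda>x. k x z) x"]
        by (simp add: algebra_simps)
      moreover have "norm ((1 / norm (y - x)) *\<^sub>R X) \<le> 6 * w z" if "norm X \<le> 6 * w z * norm (y - x)" for X :: 'b
        using that False by (simp add: divide_le_eq)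
      ultimately show ?thesis unfolding q_def by blast
    qed
    have "((\<lambda>y. \<integral>z. q y z \<partial>M) \<longlongrightarrow> 0) (at x)"
      unfolding tendsto_at_iff_sequentially
    proof (intro allI impI)
      fix Y :: "nat \<Rightarrow> real^3" assume Y: "\<forall>i. Y i \<in> UNIV - {x}" "Y \<longlonglongrightarrow> x"
      obtain N where N: "\<And>n. n \<ge> N \<Longrightarrow> Y n \<in> ball x 1"
        using Y(2) tendstoD[OF Y(2), of 1] by (auto simp: eventually_sequentially dist_commute)
      have "(\<lambda>n. \<integral>z. q (Y (n + N)) z \<partial>M) \<longlonglongrightarrow> (\<integral>z. 0 \<partial>M)"
      proof (rule integral_dominated_convergence[where w="\<lambda>z. 6 * w z"])
        show "AE z in M. (\<lambda>n. q (Y (n + N)) z) \<longlonglongrightarrow> 0"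
        proof (rule AE_I2)
          fix z assume "z \<in> space M"
          then have "((\<lambda>y. q y z) \<longlongrightarrow> 0) (at x)"
            unfolding q_def using has_derivative_pd[OF C1_differentiable[OF k]] 
            by (simp add: has_derivative_def tendsto_norm_zero_iff[of "\<lambda>y. _ y *\<^sub>R _ y"] netlimit_at divide_inverse diff_diff_eq)
          moreover have "filterlim (\<lambda>n. Y (n + N)) (at x) sequentially"
            using Y LIMSEQ_ignore_initial_segment[OF Y(2), of N] by (auto simp: filterlim_at)
          ultimately show "(\<lambda>n. q (Y (n + N)) z) \<longlonglongrightarrow> 0"
            by (rule filterlim_compose)
        qed
        show "AE z in M. norm (q (Y (n + N)) z) \<le> 6 * w z" for n
          using w(2) AE_space by eventually_elim (rule q_bound, rule N, simp_all)
      qed (use q_meas w(1) in simp_all)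
      then have "(\<lambda>n. \<integral>z. q (Y (n + N)) z \<partial>M) \<longlonglongrightarrow> 0" by simp
      then have "(\<lambda>n. \<integral>z. q (Y n) z \<partial>M) \<longlonglongrightarrow> 0"
        by (rule LIMSEQ_offset[where k=N])
      then show "((\<lambda>y. \<integral>z. q y z \<partial>M) \<circ> Y) \<longlonglongrightarrow> 0" by (simp add: o_def)
    qed
    then show ?thesis unfolding q_int
      by (simp add: has_derivative_def netlimit_at divide_inverse diff_diff_eq bounded_linear_sum
         bounded_linear_scaleR_const bounded_linear_vec_nth)
  qed
  have pdF: "pd i F x = G i x" for i x
    using pd_eqI[OF D, of i x] by (simp add: axis_def if_distrib[of "\<lambda>r. r *\<^sub>R _"] cong: if_cong)
  have "continuous_on UNIV (G i)" for i
    unfolding continuous_on_sequentially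
  proof (intro allI impI ballI)
    fix Y :: "nat \<Rightarrow> real^3" and x assume Y: "(\<forall>n. Y n \<in> UNIV) \<and> Y \<longlonglongrightarrow> x"
    from dom[of x] obtain w where w': "integrable M w \<and>
      (AE z in M. \<forall>y\<in>ball x 1. \<forall>i. norm (pd i (\<lambda>x. k x z) y) \<le> w z)" ..
    note w = conjunct1[OF w'] conjunct2[OF w']
    obtain N where N: "\<And>n. n \<ge> N \<Longrightarrow> Y n \<in> ball x 1"
      using Y tendstoD[of Y x sequentially 1] by (auto simp: eventually_sequentially dist_commute)
    have "(\<lambda>n. G i (Y (n + N))) \<longlonglongrightarrow> G i x"
      unfolding G_def
    proof (rule integral_dominated_convergence[where w=w])
      show "AE z in M. (\<lambda>n. pd i (\<lambda>x. k x z) (Y (n + N))) \<longlonglongrightarrow> pd i (\<lambda>x. k x z) x"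
      proof (rule AE_I2)
        fix z assume "z \<in> space M"
        then have "isCont (pd i (\<lambda>x. k x z)) x"
          using C1_pd_cont[OF k] by (simp add: continuous_on_eq_continuous_at)
        then show "(\<lambda>n. pd i (\<lambda>x. k x z) (Y (n + N))) \<longlonglongrightarrow> pd i (\<lambda>x. k x z) x"
          using Y LIMSEQ_ignore_initial_segment by (auto intro!: isCont_tendsto_compose[where g="pd i _"])
      qed
      show "AE z in M. norm (pd i (\<lambda>x. k x z) (Y (n + N))) \<le> w z" for n
        using w(2) by eventually_elim (use N[of "n + N"] in simp)
    qed (use meas w(1) in simp_all)
    then have "(\<lambda>n. G i (Y n)) \<longlonglongrightarrow> G i x" by (rule LIMSEQ_offset[where k=N])
    then show "(G i \<circ> Y) \<longlonglongrightarrow> G i x" by (simp add: o_def)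
  qed
  then show "C1 (\<lambda>x. \<integral>z. k x z \<partial>M)"
    using D pdF unfolding C1_def F_def[symmetric] differentiable_def
    by (metis (no_types, lifting) ext)
  show "pd i (\<lambda>x. \<integral>z. k x z \<partial>M) x = (\<integral>z. pd i (\<lambda>x. k x z) x \<partial>M)"
    using pdF unfolding F_def G_def .
qed

section \<open>Mollification of the vector potential\<close>

lemma
  assumes f: "C1 f"
  shows C1_affine: "C1 (\<lambda>y. f (a + b *\<^sub>R y))"
    and pd_affine: "pd i (\<lambda>y. f (a + b *\<^sub>R y)) y = b *\<^sub>R pd i f (a + b *\<^sub>R y)"
proof -
  have D: "((\<lambda>y. f (a + b *\<^sub>R y)) has_derivative
      (\<lambda>h. \<Sum>i\<in>UNIV. (b *\<^sub>R h) $ i *\<^sub>R pd i f (a + b *\<^sub>R y))) (at y)" for y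
    by (rule has_derivative_compose[OF _ has_derivative_pd[OF C1_differentiable[OF f]], where f="\<lambda>y. a + b *\<^sub>R y"])
       (auto intro!: derivative_eq_intros)
  show *: "pd i (\<lambda>y. f (a + b *\<^sub>R y)) y = b *\<^sub>R pd i f (a + b *\<^sub>R y)" for i y
    using pd_eqI[OF D, of i y] by (simp add: axis_def if_distrib[of "\<lambda>c. c *\<^sub>R _"] if_distrib[of "\<lambda>c. _ * c"] cong: if_cong)
  show "C1 (\<lambda>y. f (a + b *\<^sub>R y))"
    unfolding C1_def using D
    by (auto simp: differentiable_def * cong: continuous_on_cong
      intro!: continuous_intros continuous_on_compose2[OF C1_pd_cont[OF f]])
qed

lemma C1_shift: "C1 f \<Longrightarrow> C1 (\<lambda>x. f (x - y))"
  using C1_affine[of f "- y" 1] by simp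

lemma pd_shift: "C1 f \<Longrightarrow> pd i (\<lambda>x. f (x - y)) x = pd i f (x - y)"
  using pd_affine[of f i "- y" 1 x] by simp

lemma C1_shift_add: "C1 f \<Longrightarrow> C1 (\<lambda>x. f (x + y))"
  using C1_affine[of f "y" 1] by (simp add: add.commute)

lemma pd_shift_add: "C1 f \<Longrightarrow> pd i (\<lambda>x. f (x + y)) x = pd i f (x + y)"
  using pd_affine[of f i "y" 1 x] by (simp add: add.commute)

lemma C1_reflect: "C1 f \<Longrightarrow> C1 (\<lambda>y. f (x - y))"
  using C1_affine[of f x "-1"] by simp

lemma pd_reflect: "C1 f \<Longrightarrow> pd i (\<lambda>y. f (x - y)) y = - pd i f (x - y)"
  using pd_affine[of f i x "-1" y] by simp

lemma integral_reflect:
  fixes f :: "'a::euclidean_space \<Rightarrow> 'b::{banach, second_countable_topology}"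
  assumes [measurable]: "f \<in> borel_measurable borel"
  shows "integral\<^sup>L lborel (\<lambda>y. f (x - y)) = integral\<^sup>L lborel f"
proof -
  have "distr lborel borel (\<lambda>y. x + (-1) *\<^sub>R y) = (lborel :: 'a measure)"
    using lborel_affine[of "-1" x] by (simp add: density_1)
  then have "integral\<^sup>L lborel f = integral\<^sup>L (distr lborel borel (\<lambda>y. x + (-1) *\<^sub>R y)) f" by simp
  also have "\<dots> = integral\<^sup>L lborel (\<lambda>y. f (x + (-1) *\<^sub>R y))" by (rule integral_distr) auto
  finally show ?thesis by simp
qed

lemma continuous_borel_lebesgue:
  "continuous_on UNIV f \<Longrightarrow> f \<in> borel_measurable lebesgue"
  for f :: "'a::euclidean_space \<Rightarrow> 'b::{real_normed_vector, second_countable_topology}"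
  by (intro measurable_completion) (simp add: borel_measurable_continuous_onI)

lemma locally_L1_measurable:
  assumes "locally_L1 f"
  shows "f \<in> borel_measurable lebesgue"
proof (rule borel_measurable_LIMSEQ_metric)
  show "(\<lambda>x. indicator (cball 0 (real n)) x *\<^sub>R f x) \<in> borel_measurable lebesgue" for n
    using assms[unfolded locally_L1_def set_integrable_def, rule_format, of "cball 0 (real n)"]
    by (intro borel_measurable_integrable) auto
next
  fix x :: "real^3"
  obtain N where N: "norm x \<le> real N" using real_arch_simple by blast
  have "eventually (\<lambda>n. indicator (cball 0 (real n)) x *\<^sub>R f x = f x) sequentially"
    using eventually_ge_at_top[of N] by eventually_elim (use N in \<open>auto simp: indicator_def\<close>)
  then show "(\<lambda>n. indicator (cball 0 (real n)) x *\<^sub>R f x) \<longlonglongrightarrow> f x"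
    by (rule tendsto_eventually)
qed

lemma locally_L1_set_integrable:
  assumes f: "locally_L1 f" and B: "bounded B" "B \<in> sets lebesgue"
  shows "set_integrable lebesgue B f" "set_integrable lebesgue B (\<lambda>y. norm (f y - c))"
proof -
  obtain R where R: "B \<subseteq> cball 0 R" using B(1) by (auto simp: bounded_iff subset_eq)
  have 1: "set_integrable lebesgue (cball 0 R) f" using f by (simp add: locally_L1_def)
  show 2: "set_integrable lebesgue B f" by (rule set_integrable_subset[OF 1 B(2) R])
  have "set_integrable lebesgue (cball 0 R) (\<lambda>y. c)"
    unfolding set_integrable_def
    by (intro integrable_scaleR_left integrable_real_indicator)
       (use emeasure_lborel_cball_finite in \<open>auto simp: less_top\<close>)
  then have "set_integrable lebesgue B (\<lambda>y. c)" by (rule set_integrable_subset[OF _ B(2) R])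
  from set_integral_norm_bound[OF 2] set_integrable_norm[OF set_integral_diff(1)[OF 2 this]]
  show "set_integrable lebesgue B (\<lambda>y. norm (f y - c))" by simp
qed

text \<open>As the integral of the kernel is split off, any constant \<open>c\<close> may be subtracted from the function. This is how
  oscillation, rather than size, enters all estimates of mollifications.\<close>

lemma
  fixes k :: "real^3 \<Rightarrow> real" and f :: "real^3 \<Rightarrow> real^3"
  assumes f: "locally_L1 f" and k: "continuous_on UNIV k" "\<And>z. \<bar>k z\<bar> \<le> A" "\<And>z. r \<le> norm z \<Longrightarrow> k z = 0"
  shows kernel_integrable: "integrable lebesgue (\<lambda>y. k (x - y) *\<^sub>R f y)"
    and kernel_integral_bound: "ball x r \<subseteq> ball x0 R \<Longrightarrow>
      norm ((\<integral>y. k (x - y) *\<^sub>R f y \<partial>lebesgue) - integral\<^sup>L lborel k *\<^sub>R c) \<le>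
        A * (LINT y:ball x0 R|lebesgue. norm (f y - c))"
proof -
  note [measurable] = locally_L1_measurable[OF f]
  have [measurable]: "(\<lambda>y. k (x - y)) \<in> borel_measurable lebesgue"
    by (intro continuous_borel_lebesgue continuous_on_compose2[OF k(1)] continuous_intros) auto
  have kx: "k (x - y) = 0" if "y \<notin> ball x r" for y using that by (intro k(3)) (auto simp: dist_norm)
  show 1: "integrable lebesgue (\<lambda>y. k (x - y) *\<^sub>R f y)"
  proof (rule Bochner_Integration.integrable_bound)
    show "integrable lebesgue (\<lambda>y. A * (indicator (ball x r) y *\<^sub>R norm (f y - 0)))"
      using locally_L1_set_integrable(2)[OF f, of "ball x r" 0] by (auto simp: set_integrable_def)
    show "AE y in lebesgue. norm (k (x - y) *\<^sub>R f y) \<le> norm (A * (indicator (ball x r) y *\<^sub>R norm (f y - 0)))"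
    proof (rule AE_I2)
      fix y
      show "norm (k (x - y) *\<^sub>R f y) \<le> norm (A * (indicator (ball x r) y *\<^sub>R norm (f y - 0)))"
        using kx[of y] k(2)[of "x - y"]
        by (cases "y \<in> ball x r") (auto simp: abs_mult intro!: mult_right_mono)
    qed
  qed measurable
  assume sub: "ball x r \<subseteq> ball x0 R"
  have kint: "integrable lborel (\<lambda>y. k (x - y))"
  proof (rule csupp_integrable)
    show "continuous_on UNIV (\<lambda>y. k (x - y))"
      by (intro continuous_on_compose2[OF k(1)] continuous_intros) auto
    have "k (x - y) = 0" if "norm x + r \<le> norm y" for y
      using that norm_triangle_ineq2[of y x] by (intro k(3)) (simp add: norm_minus_commute)
    then show "csupp (\<lambda>y. k (x - y))" by (auto simp: csupp_def)
  qed
  have kint': "integrable lebesgue (\<lambda>y. k (x - y))" "(\<integral>y. k (x - y) \<partial>lebesgue) = integral\<^sup>L lborel k"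
    using kint integral_reflect[of k x] borel_measurable_continuous_onI[OF k(1)]
    by (simp_all add: integrable_completion integral_completion borel_measurable_integrable)
  have 2: "set_integrable lebesgue (ball x0 R) (\<lambda>y. norm (f y - c))"
    by (rule locally_L1_set_integrable(2)[OF f]) auto
  have "(\<integral>y. k (x - y) *\<^sub>R f y \<partial>lebesgue) - integral\<^sup>L lborel k *\<^sub>R c = (\<integral>y. k (x - y) *\<^sub>R (f y - c) \<partial>lebesgue)"
    using 1 kint' by (simp add: scaleR_diff_right)
  also have "norm \<dots> \<le> (\<integral>y. norm (k (x - y) *\<^sub>R (f y - c)) \<partial>lebesgue)"
    by (rule integral_norm_bound)
  also have "\<dots> \<le> (\<integral>y. A * (indicator (ball x0 R) y *\<^sub>R norm (f y - c)) \<partial>lebesgue)"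
  proof (rule integral_mono)
    show "integrable lebesgue (\<lambda>y. norm (k (x - y) *\<^sub>R (f y - c)))"
      using 1 kint'(1) by (intro integrable_norm) (simp add: scaleR_diff_right)
    show "integrable lebesgue (\<lambda>y. A * (indicator (ball x0 R) y *\<^sub>R norm (f y - c)))"
      using 2 by (simp add: set_integrable_def)
    fix y
    show "norm (k (x - y) *\<^sub>R (f y - c)) \<le> A * (indicator (ball x0 R) y *\<^sub>R norm (f y - c))"
      using kx[of y] k(2)[of "x - y"] sub order_trans[OF abs_ge_zero k(2)[of 0]]
      by (cases "y \<in> ball x r") (auto simp: subset_eq intro!: mult_right_mono mult_nonneg_nonneg)
  qed
  also have "\<dots> = A * (LINT y:ball x0 R|lebesgue. norm (f y - c))"
    by (simp add: set_lebesgue_integral_def)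
  finally show "norm ((\<integral>y. k (x - y) *\<^sub>R f y \<partial>lebesgue) - integral\<^sup>L lborel k *\<^sub>R c) \<le>
        A * (LINT y:ball x0 R|lebesgue. norm (f y - c))" .
qed

definition mollify :: "real \<Rightarrow> (real^3 \<Rightarrow> real^3) \<Rightarrow> real^3 \<Rightarrow> real^3" where
  "mollify r f x = (\<integral>y. rho r (x - y) *\<^sub>R f y \<partial>lebesgue)"

lemma pd_rho_eq_0:
  assumes "0 < r" "r \<le> norm y" shows "pd i (rho r) y = 0"
proof (rule ccontr)
  assume nz: "pd i (rho r) y \<noteq> 0"
  define S where "S = {z. pd i (rho r) z \<noteq> 0}"
  have "open S" unfolding S_def by (rule open_Collect_neq[OF C1_pd_cont[OF C1_rho] continuous_on_const])
  moreover have "y \<in> S" using nz by (simp add: S_def)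
  ultimately obtain e where e: "e > 0" "ball y e \<subseteq> S"
    unfolding open_contains_ball by blast
  (* On the boundary sphere the derivative need not be computed: a point slightly further out, where the mollifier vanishes identically, contradicts continuity. *)
  define z where "z = (1 + e / (2 * norm y)) *\<^sub>R y"
  have ny: "norm y > 0" using assms by linarith
  have "dist y z = e / 2" using ny e by (simp add: z_def dist_norm algebra_simps)
  then have "z \<in> ball y e" using e by simp
  moreover have "norm z = norm y + e / 2" using ny e by (simp add: z_def field_simps)
  then have nz': "norm z > r" using assms e by simp
  have "(rho r has_derivative (\<lambda>h. 0)) (at z)"
  proof (rule has_derivative_transform_within_open[of "\<lambda>x. 0" _ _ _ "- cball 0 r"])
    show "z \<in> - cball 0 r" using nz' by auto
    show "\<And>x. x \<in> - cball 0 r \<Longrightarrow> 0 = rho r x" using rho_eq_0 assms by auto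
  qed auto
  then have "pd i (rho r) z = 0" by (simp add: pd_eqI)
  ultimately show False using e by (auto simp: S_def)
qed

lemma csupp_rho: "0 < r \<Longrightarrow> csupp (rho r)"
  using rho_eq_0 by (auto simp: csupp_def)

lemma
  assumes f: "locally_L1 f" and r: "0 < r"
  shows C1_mollify: "C1 (mollify r f)"
    and pd_mollify: "pd i (mollify r f) x = (\<integral>y. pd i (rho r) (x - y) *\<^sub>R f y \<partial>lebesgue)"
proof -
  obtain K where K: "K > 0" "\<And>y. \<bar>rho r y\<bar> \<le> K / r ^ 3" "\<And>y i. \<bar>pd i (rho r) y\<bar> \<le> K / r ^ 4"
    using rho_pd_bounds r by blast
  have k: "C1 (\<lambda>x. rho r (x - y) *\<^sub>R f y)" for y
    by (rule C1_scaleR[OF C1_shift[OF C1_rho] C1_const])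
  have pdk: "pd i (\<lambda>x. rho r (x - y) *\<^sub>R f y) x = pd i (rho r) (x - y) *\<^sub>R f y" for y x i
    by (subst pd_scaleR) (auto simp: pd_shift[OF C1_rho] C1_differentiable[OF C1_shift[OF C1_rho]])
  have int: "integrable lebesgue (\<lambda>y. rho r (x - y) *\<^sub>R f y)" for x
    by (rule kernel_integrable[OF f C1_cont[OF C1_rho] K(2) rho_eq_0[OF r]])
  have int': "integrable lebesgue (\<lambda>y. pd i (rho r) (x - y) *\<^sub>R f y)" for x i
    by (rule kernel_integrable[OF f C1_pd_cont[OF C1_rho] K(3) pd_rho_eq_0[OF r]])
  have dom: "\<exists>w. integrable lebesgue w \<and>
      (AE z in lebesgue. \<forall>y\<in>ball x 1. \<forall>i. norm (pd i (\<lambda>x. rho r (x - z) *\<^sub>R f z) y) \<le> w z)" for x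
  proof (intro exI[of _ "\<lambda>z. K / r ^ 4 * (indicator (ball x (r + 1)) z *\<^sub>R norm (f z - 0))"] conjI AE_I2 ballI allI)
    show "integrable lebesgue (\<lambda>z. K / r ^ 4 * (indicator (ball x (r + 1)) z *\<^sub>R norm (f z - 0)))"
      using locally_L1_set_integrable(2)[OF f, of "ball x (r + 1)" 0] by (auto simp: set_integrable_def)
    fix z y i assume "y \<in> ball x 1"
    show "norm (pd i (\<lambda>x. rho r (x - z) *\<^sub>R f z) y) \<le> K / r ^ 4 * (indicator (ball x (r + 1)) z *\<^sub>R norm (f z - 0))"
    proof (cases "z \<in> ball x (r + 1)")
      case True
      then show ?thesis using mult_right_mono[OF K(3)[of i "y - z"] norm_ge_zero[of "f z"]] by (simp add: pdk)
    next
      case False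
      then have "r \<le> norm (y - z)"
        using \<open>y \<in> ball x 1\<close> dist_triangle[of x z y] by (simp add: dist_norm)
      then show ?thesis using K(1) r by (simp add: pdk pd_rho_eq_0)
    qed
  qed
  have meas: "(\<lambda>y. pd i (\<lambda>x. rho r (x - y) *\<^sub>R f y) x) \<in> borel_measurable lebesgue" for x i
    unfolding pdk using int' by (rule borel_measurable_integrable)
  show "C1 (mollify r f)" "pd i (mollify r f) x = (\<integral>y. pd i (rho r) (x - y) *\<^sub>R f y \<partial>lebesgue)"
    using C1_parametric_integral[where k="\<lambda>x y. rho r (x - y) *\<^sub>R f y", OF k int meas dom]
          pd_parametric_integral[where k="\<lambda>x y. rho r (x - y) *\<^sub>R f y", OF k int meas dom, of i x]
    unfolding mollify_def[abs_def] pdk by auto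
qed

lemma mollify_eq_lborel:
  assumes u: "continuous_on UNIV u"
  shows "mollify r u x = (\<integral>y. rho r (x - y) *\<^sub>R u y \<partial>lborel)"
  unfolding mollify_def
  by (rule integral_completion)
     (auto intro!: borel_measurable_continuous_onI continuous_intros u continuous_on_compose2[OF C1_cont[OF C1_rho]])

text \<open>The weak formulation tested with \<open>rho r (x - y) v\<close> as a function of \<open>y\<close>: the reflection in \<open>y\<close>
  changes the sign of the derivatives of the kernel, and the cross product with \<open>v\<close> changes it back.\<close>

lemma curl_mollify:
  assumes f: "locally_L1 f" and w: "is_weak_curl u f" and u: "continuous_on UNIV u" and r: "0 < r"
  shows "curl (mollify r f) x = mollify r u x"
proof -
  obtain K where K: "K > 0" "\<And>y. \<bar>rho r y\<bar> \<le> K / r ^ 3" "\<And>y i. \<bar>pd i (rho r) y\<bar> \<le> K / r ^ 4"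
    using rho_pd_bounds r by blast
  have int': "integrable lebesgue (\<lambda>y. pd i (rho r) (x - y) *\<^sub>R f y)" for i
    by (rule kernel_integrable[OF f C1_pd_cont[OF C1_rho] K(3) pd_rho_eq_0[OF r]])
  have intu: "integrable lborel (\<lambda>y. rho r (x - y) *\<^sub>R u y)"
  proof (rule csupp_integrable)
    show "continuous_on UNIV (\<lambda>y. rho r (x - y) *\<^sub>R u y)"
      by (intro continuous_intros continuous_on_compose2[OF C1_cont[OF C1_rho]] u) auto
    have "rho r (x - y) = 0" if "norm x + r \<le> norm y" for y
      using that norm_triangle_ineq2[of y x] r by (intro rho_eq_0) (auto simp: norm_minus_commute)
    then show "csupp (\<lambda>y. rho r (x - y) *\<^sub>R u y)" by (auto simp: csupp_def)
  qed
  have "curl (mollify r f) x \<bullet> v = (\<integral>y. rho r (x - y) *\<^sub>R u y \<partial>lborel) \<bullet> v" for v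
  proof -
    have "curl (\<lambda>y. rho r (x - y) *\<^sub>R v) y = (\<Sum>i\<in>UNIV. cross3 (axis i 1) (- pd i (rho r) (x - y) *\<^sub>R v))" for y
      unfolding curl_eq
      by (subst pd_scaleR) (auto simp: pd_reflect[OF C1_rho] C1_differentiable[OF C1_reflect[OF C1_rho]])
    then have c: "f y \<bullet> curl (\<lambda>y. rho r (x - y) *\<^sub>R v) y = (\<Sum>i\<in>UNIV. cross3 (axis i 1) (pd i (rho r) (x - y) *\<^sub>R f y) \<bullet> v)" for y
      by (simp only:) (simp add: sum_3 cross_components inner_vec_def axis_def algebra_simps)
    have "curl (mollify r f) x \<bullet> v = (\<Sum>i\<in>UNIV. cross3 (axis i 1) (\<integral>y. pd i (rho r) (x - y) *\<^sub>R f y \<partial>lebesgue) \<bullet> v)"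
      unfolding curl_eq by (simp add: pd_mollify[OF f r] inner_sum_left)
    also have "\<dots> = (\<Sum>i\<in>UNIV. (\<integral>y. cross3 (axis i 1) (pd i (rho r) (x - y) *\<^sub>R f y) \<bullet> v \<partial>lebesgue))"
    proof (rule sum.cong[OF refl])
      fix i :: 3
      have bl: "bounded_linear (\<lambda>a. cross3 (axis i 1) a \<bullet> v)"
        by (rule bounded_linear_compose[OF bounded_linear_inner_left
              bounded_bilinear.bounded_linear_right[OF bounded_bilinear_cross3]])
      show "cross3 (axis i 1) (\<integral>y. pd i (rho r) (x - y) *\<^sub>R f y \<partial>lebesgue) \<bullet> v
          = (\<integral>y. cross3 (axis i 1) (pd i (rho r) (x - y) *\<^sub>R f y) \<bullet> v \<partial>lebesgue)"
        by (rule integral_bounded_linear[OF bl int', symmetric])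
    qed
    also have "\<dots> = (\<integral>y. f y \<bullet> curl (\<lambda>y. rho r (x - y) *\<^sub>R v) y \<partial>lebesgue)"
      unfolding c
      by (rule Bochner_Integration.integral_sum[symmetric],
          rule integrable_bounded_linear[OF _ int'],
          rule bounded_linear_compose[OF bounded_linear_inner_left
              bounded_bilinear.bounded_linear_right[OF bounded_bilinear_cross3]])
    also have "\<dots> = (\<integral>y. u y \<bullet> (rho r (x - y) *\<^sub>R v) \<partial>lebesgue)"
      using w[unfolded is_weak_curl_def, rule_format, OF test_field_rho[OF r, of x v]] by (rule sym)
    also have "\<dots> = (\<integral>y. u y \<bullet> (rho r (x - y) *\<^sub>R v) \<partial>lborel)"
      by (rule integral_completion)
         (auto intro!: borel_measurable_continuous_onI continuous_intros u continuous_on_compose2[OF C1_cont[OF C1_rho]])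
    also have "\<dots> = (\<integral>y. (rho r (x - y) *\<^sub>R u y) \<bullet> v \<partial>lborel)" by simp
    also have "\<dots> = (\<integral>y. rho r (x - y) *\<^sub>R u y \<partial>lborel) \<bullet> v"
      by (rule integral_inner_left[OF intu])
    finally show ?thesis .
  qed
  then show ?thesis unfolding mollify_eq_lborel[OF u] by (rule vector_eq_rdot[THEN iffD1, rule_format])
qed

section \<open>Quantitative consequences of the oscillation bound\<close>

text \<open>Instead of a power mean inequality, the elementary bound
  \<open>a \<le> l + l powr (1 - s) * a powr s\<close> is integrated, with \<open>l\<close> the given bound on the \<open>s\<close>-th mean; both
  terms then contribute \<open>l\<close>.\<close>

lemma oscillation_bound_L1:
  assumes f: "locally_L1 \<psi>" and o: "oscillation_bound \<psi> s C \<alpha>" and s: "s \<ge> 1" and C: "C > 0"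
  shows "\<exists>K>0. \<forall>R>1. \<forall>x. (LINT y:ball x R|lebesgue. norm (\<psi> y - average (ball x R) \<psi>)) \<le> K * R powr (3 + \<alpha>)"
proof -
  define V where "V = measure lebesgue (ball (0::real^3) 1)"
  have V: "V > 0" unfolding V_def using content_ball_pos[of 1 "0::real^3"] by simp
  have "(LINT y:ball x R|lebesgue. norm (\<psi> y - average (ball x R) \<psi>)) \<le> (2 * C * V) * R powr (3 + \<alpha>)"
    if R: "R > 1" for R x
  proof -
    define B where "B = ball x R"
    define a where "a y = norm (\<psi> y - average B \<psi>)" for y
    define l where "l = C * R powr \<alpha>"
    have l: "l > 0" using C R by (simp add: l_def)
    have mB: "measure lebesgue B = R ^ 3 * V"
      using content_ball_conv_unit_ball[of R x] R by (simp add: B_def V_def)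
    have mB0: "measure lebesgue B > 0" using mB V R by simp
    have i2: "set_integrable lebesgue B (\<lambda>y. a y powr s)" and A: "average B (\<lambda>y. a y powr s) powr (1 / s) \<le> l"
      using o R unfolding oscillation_bound_def a_def B_def l_def by auto
    have i1: "set_integrable lebesgue B a"
      unfolding a_def B_def by (rule locally_L1_set_integrable(2)[OF f]) auto
    have iB: "set_integrable lebesgue B (\<lambda>y. l)"
      unfolding set_integrable_def B_def
      by (intro integrable_scaleR_left integrable_real_indicator)
         (use emeasure_lborel_ball_finite in \<open>auto simp: less_top\<close>)
    have A0: "average B (\<lambda>y. a y powr s) \<ge> 0"
      unfolding average_def set_lebesgue_integral_def by (intro scaleR_nonneg_nonneg integral_nonneg) auto
    have "average B (\<lambda>y. a y powr s) = (average B (\<lambda>y. a y powr s) powr (1 / s)) powr s"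
      using A0 s by (simp add: powr_powr)
    also have "\<dots> \<le> l powr s" using A s by (intro powr_mono2) auto
    finally have A': "(LINT y:B|lebesgue. a y powr s) \<le> measure lebesgue B * l powr s"
      using mB0 by (simp add: average_def field_simps)
    have pw: "a y \<le> l + l powr (1 - s) * a y powr s" for y
    proof (cases "a y \<le> l")
      case False
      then have "a y = a y powr s * a y powr (1 - s)" using l by (simp add: powr_add[symmetric])
      also have "\<dots> \<le> a y powr s * l powr (1 - s)"
        using False l s by (intro mult_left_mono powr_mono2') auto
      finally show ?thesis using l by (simp add: mult.commute)
    qed (simp add: add_increasing2)
    have "(LINT y:B|lebesgue. a y) \<le> (LINT y:B|lebesgue. l + l powr (1 - s) * a y powr s)"
      using i1 i2 iB pw by (intro set_integral_mono) auto
    also have "\<dots> = (LINT y:B|lebesgue. l) + l powr (1 - s) * (LINT y:B|lebesgue. a y powr s)"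
      using i2 iB by (subst set_integral_add) auto
    also have "(LINT y:B|lebesgue. l) = measure lebesgue B * l"
      unfolding set_lebesgue_integral_def B_def by (simp add: mult.commute)
    also have "measure lebesgue B * l + l powr (1 - s) * (LINT y:B|lebesgue. a y powr s)
        \<le> measure lebesgue B * l + l powr (1 - s) * (measure lebesgue B * l powr s)"
      by (intro add_left_mono mult_left_mono A') auto
    also have "l powr (1 - s) * (measure lebesgue B * l powr s) = measure lebesgue B * l"
      using l by (simp add: powr_add[symmetric] mult.left_commute)
    also have "measure lebesgue B * l + measure lebesgue B * l = (2 * C * V) * R powr (3 + \<alpha>)"
      using R by (simp add: mB l_def powr_add powr_numeral)
    finally show ?thesis by (simp add: a_def B_def)
  qed
  moreover have "2 * C * V > 0" using C V by simp
  ultimately show ?thesis by blast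
qed

text \<open>The derivatives of the kernel have integral zero and the kernel itself has integral one, so
  subtracting the mean over a ball containing the support leaves the oscillation over that ball.
  The factor \<open>(R / r) ^ 3\<close> is the price of a ball larger than the support.\<close>

lemma mollify_oscillation:
  assumes f: "locally_L1 \<psi>" and o: "oscillation_bound \<psi> s C \<alpha>" and s: "s \<ge> 1" and C: "C > 0"
  shows "\<exists>K>0. (\<forall>r>1. \<forall>x i. norm (pd i (mollify r \<psi>) x) \<le> K * r powr (\<alpha> - 1)) \<and>
     (\<forall>r>0. \<forall>R>1. \<forall>x x0. ball x r \<subseteq> ball x0 R \<longrightarrow>
        norm (mollify r \<psi> x - average (ball x0 R) \<psi>) \<le> K * (R / r) ^ 3 * R powr \<alpha>)"
proof -
  obtain A where A: "A > 0" "\<And>R x. R > 1 \<Longrightarrow> (LINT y:ball x R|lebesgue. norm (\<psi> y - average (ball x R) \<psi>)) \<le> A * R powr (3 + \<alpha>)"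
    using oscillation_bound_L1[OF assms] by blast
  obtain K where K: "K > 0" "\<And>r y. r > 0 \<Longrightarrow> \<bar>rho r y\<bar> \<le> K / r ^ 3" "\<And>r y i. r > 0 \<Longrightarrow> \<bar>pd i (rho r) y\<bar> \<le> K / r ^ 4"
    using rho_pd_bounds by blast
  have "norm (pd i (mollify r \<psi>) x) \<le> (K * A) * r powr (\<alpha> - 1)" if r: "r > 1" for r x i
  proof -
    have r0: "r > 0" using r by simp
    have "norm ((\<integral>y. pd i (rho r) (x - y) *\<^sub>R \<psi> y \<partial>lebesgue) - integral\<^sup>L lborel (pd i (rho r)) *\<^sub>R average (ball x r) \<psi>)
       \<le> K / r ^ 4 * (LINT y:ball x r|lebesgue. norm (\<psi> y - average (ball x r) \<psi>))"
      by (rule kernel_integral_bound[OF f C1_pd_cont[OF C1_rho] K(3) pd_rho_eq_0]) (use r0 in auto)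
    also have "\<dots> \<le> K / r ^ 4 * (A * r powr (3 + \<alpha>))"
      using r K(1) by (intro mult_left_mono A) auto
    also have "r powr (3 + \<alpha>) = r ^ 4 * r powr (\<alpha> - 1)"
      using powr_add[of r 4 "\<alpha> - 1"] r0 by simp
    finally show ?thesis
      using r0 by (simp add: pd_mollify[OF f r0] integral_pd_eq_0[OF C1_rho csupp_rho[OF r0]])
  qed
  moreover have "norm (mollify r \<psi> x - average (ball x0 R) \<psi>) \<le> (K * A) * (R / r) ^ 3 * R powr \<alpha>"
    if r: "r > 0" and R: "R > 1" and sub: "ball x r \<subseteq> ball x0 R" for r R x x0
  proof -
    have "norm ((\<integral>y. rho r (x - y) *\<^sub>R \<psi> y \<partial>lebesgue) - integral\<^sup>L lborel (rho r) *\<^sub>R average (ball x0 R) \<psi>)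
       \<le> K / r ^ 3 * (LINT y:ball x0 R|lebesgue. norm (\<psi> y - average (ball x0 R) \<psi>))"
      by (rule kernel_integral_bound[OF f C1_cont[OF C1_rho] K(2) rho_eq_0 sub]) (use r in auto)
    also have "\<dots> \<le> K / r ^ 3 * (A * R powr (3 + \<alpha>))"
      using r R K(1) by (intro mult_left_mono A) auto
    also have "R powr (3 + \<alpha>) = R ^ 3 * R powr \<alpha>"
      using powr_add[of R 3 \<alpha>] R by simp
    finally show ?thesis
      using r by (simp add: mollify_def rho_integral power_divide)
  qed
  ultimately show ?thesis using K(1) A(1) by (intro exI[of _ "K * A"]) auto
qed

text \<open>Comparing the scales \<open>r\<close> and \<open>2 ^ n * r\<close> directly would cost a factor \<open>(2 ^ n) ^ 3\<close>. Comparing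
  consecutive dyadic scales costs only a constant each time, and the geometric sum is dominated by
  its last term because \<open>\<alpha> > 0\<close>.\<close>

lemma mollify_growth:
  assumes f: "locally_L1 \<psi>" and o: "oscillation_bound \<psi> s C \<alpha>" and s: "s \<ge> 1" and C: "C > 0" and \<alpha>: "\<alpha> > 0"
  shows "\<exists>K>0. \<forall>r>1. \<forall>n x. norm x \<le> 2 ^ n * r \<longrightarrow>
     norm (mollify r \<psi> x - average (ball 0 (2 * 2 ^ n * r)) \<psi>) \<le> K * (2 ^ n * r) powr \<alpha>"
proof -
  obtain K where K0: "K > 0" and K': "\<forall>r>0. \<forall>R>1. \<forall>x x0. ball x r \<subseteq> ball x0 R \<longrightarrow>
        norm (mollify r \<psi> x - average (ball x0 R) \<psi>) \<le> K * (R / r) ^ 3 * R powr \<alpha>"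
    using mollify_oscillation[OF f o s C] by (elim exE conjE) (rule that)
  note K = K0 K'[rule_format]
  define q where "q = 1 - 2 powr (- \<alpha>)"
  have q: "q > 0" using \<alpha> by (simp add: q_def powr_less_one)
  define L where "L = 9 * K / q"
  have L: "L > 0" using K(1) q by (simp add: L_def)
  have chain: "norm (mollify r \<psi> x - mollify (2 ^ n * r) \<psi> x) \<le> L * (2 ^ n * r) powr \<alpha>" if r: "r > 1" for r x n
  proof (induction n)
    case (Suc n)
    define t where "t = 2 ^ n * r"
    have "1 * r \<le> 2 ^ n * r" using r by (intro mult_right_mono) auto
    then have t: "t > 1" unfolding t_def using r by linarith
    have 1: "norm (mollify t \<psi> x - average (ball x (2 * t)) \<psi>) \<le> K * (2 * t / t) ^ 3 * (2 * t) powr \<alpha>"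
      by (rule K(2)) (use t in auto)
    have 2: "norm (mollify (2 * t) \<psi> x - average (ball x (2 * t)) \<psi>) \<le> K * (2 * t / (2 * t)) ^ 3 * (2 * t) powr \<alpha>"
      by (rule K(2)) (use t in auto)
    have "norm (mollify r \<psi> x - mollify (2 * t) \<psi> x) \<le> norm (mollify r \<psi> x - mollify t \<psi> x)
        + norm (mollify t \<psi> x - average (ball x (2 * t)) \<psi>) + norm (mollify (2 * t) \<psi> x - average (ball x (2 * t)) \<psi>)"
      using norm_triangle_ineq[of "mollify r \<psi> x - mollify t \<psi> x" "mollify t \<psi> x - average (ball x (2 * t)) \<psi>"]
        norm_triangle_ineq4[of "mollify r \<psi> x - average (ball x (2 * t)) \<psi>" "mollify (2 * t) \<psi> x - average (ball x (2 * t)) \<psi>"]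
      by simp
    also have "\<dots> \<le> L * t powr \<alpha> + 9 * K * (2 * t) powr \<alpha>"
    proof -
      have "2 * t / t = 2" "2 * t / (2 * t) = 1" using t by simp_all
      with 1 2 Suc[folded t_def] show ?thesis by simp
    qed
    also have "t powr \<alpha> = (1 - q) * (2 * t) powr \<alpha>"
      using t by (simp add: q_def powr_mult powr_minus)
    also have "L * ((1 - q) * (2 * t) powr \<alpha>) + 9 * K * (2 * t) powr \<alpha> = L * (2 * t) powr \<alpha>"
      using q by (simp add: L_def field_simps)
    finally show ?case by (simp add: t_def mult.assoc)
  qed (use L in simp)
  have "norm (mollify r \<psi> x - average (ball 0 (2 * 2 ^ n * r)) \<psi>) \<le> (L + 16 * K * 2 powr \<alpha>) * (2 ^ n * r) powr \<alpha>"
    if r: "r > 1" and x: "norm x \<le> 2 ^ n * r" for r n x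
  proof -
    define t where "t = 2 ^ n * r"
    have "1 * r \<le> 2 ^ n * r" using r by (intro mult_right_mono) auto
    then have t: "t > 1" unfolding t_def using r by linarith
    have "ball x t \<subseteq> ball 0 (2 * t)"
    proof
      fix y assume "y \<in> ball x t"
      then show "y \<in> ball 0 (2 * t)" using x norm_triangle_sub[of y x] by (simp add: t_def dist_norm norm_minus_commute)
    qed
    then have "norm (mollify t \<psi> x - average (ball 0 (2 * t)) \<psi>) \<le> K * (2 * t / t) ^ 3 * (2 * t) powr \<alpha>"
      by (intro K(2)) (use t in auto)
    also have "\<dots> = 8 * K * 2 powr \<alpha> * t powr \<alpha>" using t by (simp add: powr_mult)
    also have "\<dots> \<le> 16 * K * 2 powr \<alpha> * t powr \<alpha>" using K(1) by simp
    finally show ?thesis using chain[OF r, of x n]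
      norm_triangle_ineq[of "mollify r \<psi> x - mollify t \<psi> x" "mollify t \<psi> x - average (ball 0 (2 * t)) \<psi>"]
      by (simp add: t_def distrib_right mult.assoc)
  qed
  moreover have "L + 16 * K * 2 powr \<alpha> > 0" using L K(1) by (simp add: add_pos_nonneg)
  ultimately show ?thesis by blast
qed

section \<open>A local potential for the mollification error\<close>

text \<open>The joint law of a vector \<open>y\<close> distributed according to the mollifier and an independent
  uniform time \<open>t\<close> in the unit interval. Using one measure on pairs treats the average over all segments
  from \<open>x\<close> to \<open>x + y\<close> as a single integral.\<close>

definition mu :: "real \<Rightarrow> ((real^3) \<times> real) measure" where
  "mu r = density lborel (\<lambda>z. ennreal (rho r (fst z) * indicator {0..1} (snd z)))"

lemma rho_measurable [measurable]: "rho r \<in> borel_measurable borel"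
  by (rule borel_measurable_continuous_onI[OF C1_cont[OF C1_rho]])

lemma rho_integrable: "0 < r \<Longrightarrow> integrable lborel (rho r)"
  by (rule csupp_integrable[OF C1_cont[OF C1_rho] csupp_rho])

lemma sets_mu [simp, measurable_cong]: "sets (mu r) = sets (borel \<Otimes>\<^sub>M borel)"
  and space_mu [simp]: "space (mu r) = UNIV"
  by (simp add: mu_def flip: borel_prod) (simp add: mu_def)

lemma mu_density_measurable:
  "(\<lambda>z. rho r (fst z) * indicator {0..1} (snd z :: real)) \<in> borel_measurable borel"
  "(\<lambda>z. ennreal (rho r (fst z) * indicator {0..1} (snd z :: real))) \<in> borel_measurable borel"
  unfolding borel_prod[symmetric] by measurable

abbreviation mean :: "real \<Rightarrow> (real^3 \<Rightarrow> ennreal) \<Rightarrow> real^3 \<Rightarrow> ennreal" where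
  "mean r h x \<equiv> \<integral>\<^sup>+z. h (x + snd z *\<^sub>R fst z) \<partial>mu r"

lemma emeasure_mu_space:
  assumes r: "0 < r" shows "emeasure (mu r) UNIV = 1"
proof -
  have "emeasure (mu r) UNIV = (\<integral>\<^sup>+z. ennreal (rho r (fst z) * indicator {0..1} (snd z :: real)) \<partial>(lborel \<Otimes>\<^sub>M lborel))"
    using mu_density_measurable by (simp add: mu_def emeasure_density lborel_prod)
  also have "\<dots> = (\<integral>\<^sup>+y. (\<integral>\<^sup>+t. ennreal (rho r y * indicator {0..1} (t::real)) \<partial>lborel) \<partial>lborel)"
    by (subst lborel.nn_integral_fst[symmetric]) auto
  also have "\<dots> = (\<integral>\<^sup>+y. ennreal (rho r y) \<partial>lborel)"
  proof (rule nn_integral_cong)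
    fix y
    have "(\<integral>\<^sup>+t. ennreal (rho r y * indicator {0..1} (t::real)) \<partial>lborel) = (\<integral>\<^sup>+t. ennreal (rho r y) * indicator {0..1} (t::real) \<partial>lborel)"
      by (intro nn_integral_cong) (auto split: split_indicator)
    also have "\<dots> = ennreal (rho r y)" by (subst nn_integral_cmult_indicator) auto
    finally show "(\<integral>\<^sup>+t. ennreal (rho r y * indicator {0..1} (t::real)) \<partial>lborel) = ennreal (rho r y)" .
  qed
  also have "\<dots> = ennreal (integral\<^sup>L lborel (rho r))"
    by (rule nn_integral_eq_integral[OF rho_integrable[OF r]]) (simp add: rho_nonneg r)
  finally show ?thesis by (simp add: rho_integral r)
qed

lemma AE_mu:
  assumes r: "0 < r" shows "AE z in mu r. norm (fst z) \<le> r \<and> snd z \<in> {0..1}"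
proof -
  have "AE z in (lborel :: ((real^3) \<times> real) measure). 0 < ennreal (rho r (fst z) * indicator {0..1} (snd z)) \<longrightarrow> norm (fst z) \<le> r \<and> snd z \<in> {0..1}"
  proof (rule AE_I2, rule impI)
    fix z :: "(real^3) \<times> real"
    assume "0 < ennreal (rho r (fst z) * indicator {0..1} (snd z))"
    then have "rho r (fst z) \<noteq> 0" "snd z \<in> {0..1}" by (auto split: split_indicator_asm)
    then show "norm (fst z) \<le> r \<and> snd z \<in> {0..1}"
      using rho_eq_0[OF r, of "fst z"] by (auto intro: leI order.strict_implies_order)
  qed
  then show ?thesis unfolding mu_def using mu_density_measurable by (subst AE_density) auto
qed

lemma norm_shift_le:
  assumes "norm (fst z) \<le> r \<and> snd z \<in> {0..1}"
  shows "norm (snd z *\<^sub>R fst z) \<le> r"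
proof -
  have "norm (snd z *\<^sub>R fst z) \<le> 1 * r" unfolding norm_scaleR using assms by (intro mult_mono) auto
  then show ?thesis by simp
qed

lemma
  fixes F :: "(real^3) \<times> real \<Rightarrow> 'b::euclidean_space"
  assumes F: "continuous_on UNIV F" and r: "0 < r"
  shows mu_integrable: "integrable (mu r) F"
    and mu_integral: "integral\<^sup>L (mu r) F =
      (\<integral>y. rho r y *\<^sub>R (\<integral>t. indicator {0..1} t *\<^sub>R F (y, t) \<partial>lborel) \<partial>lborel)"
proof -
  have [measurable]: "F \<in> borel_measurable borel" by (rule borel_measurable_continuous_onI[OF F])
  have "integrable lborel (\<lambda>z. indicator (cball 0 r \<times> {0..1}) z *\<^sub>R (rho r (fst z) *\<^sub>R F z))"
    by (intro borel_integrable_compact compact_Times continuous_intros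
         continuous_on_compose2[OF C1_cont[OF C1_rho]] continuous_on_subset[OF F]) auto
  also have "(\<lambda>z. indicator (cball 0 r \<times> {0..1}) z *\<^sub>R (rho r (fst z) *\<^sub>R F z)) =
      (\<lambda>z. (rho r (fst z) * indicator {0..1} (snd z)) *\<^sub>R F z)"
  proof
    fix z :: "(real^3) \<times> real"
    show "indicator (cball 0 r \<times> {0..1}) z *\<^sub>R (rho r (fst z) *\<^sub>R F z) = (rho r (fst z) * indicator {0..1} (snd z)) *\<^sub>R F z"
      using rho_eq_0[OF r, of "fst z"]
      by (cases "norm (fst z) \<le> r"; cases z) (auto simp: indicator_def)
  qed
  finally have int: "integrable lborel (\<lambda>z. (rho r (fst z) * indicator {0..1} (snd z)) *\<^sub>R F z)" .
  have nn: "AE z in lborel. 0 \<le> rho r (fst z) * indicator {0..1} (snd z)"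
    using rho_nonneg[OF r] by simp
  show "integrable (mu r) F" unfolding mu_def
    by (subst integrable_density) (use int nn mu_density_measurable(1) in auto)
  have "integral\<^sup>L (mu r) F = (\<integral>z. (rho r (fst z) * indicator {0..1} (snd z)) *\<^sub>R F z \<partial>lborel)"
    unfolding mu_def by (rule integral_density) (use nn mu_density_measurable(1) in auto)
  also have "\<dots> = (\<integral>z. (case z of (y, t) \<Rightarrow> (rho r y * indicator {0..1} t) *\<^sub>R F (y, t)) \<partial>(lborel \<Otimes>\<^sub>M lborel))"
    by (simp add: lborel_prod case_prod_beta)
  also have "\<dots> = (\<integral>y. (\<integral>t. (rho r y * indicator {0..1} t) *\<^sub>R F (y, t) \<partial>lborel) \<partial>lborel)"
    by (rule lborel_pair.integral_fst[symmetric]) (use int in \<open>simp add: lborel_prod case_prod_beta'\<close>)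
  also have "\<dots> = (\<integral>y. rho r y *\<^sub>R (\<integral>t. indicator {0..1} t *\<^sub>R F (y, t) \<partial>lborel) \<partial>lborel)"
    by (simp flip: scaleR_scaleR)
  finally show "integral\<^sup>L (mu r) F =
      (\<integral>y. rho r y *\<^sub>R (\<integral>t. indicator {0..1} t *\<^sub>R F (y, t) \<partial>lborel) \<partial>lborel)" .
qed

lemma mollify_eq_average:
  assumes u: "continuous_on UNIV u"
  shows "mollify r u x = (\<integral>y. rho r y *\<^sub>R u (x + y) \<partial>lborel)"
proof -
  have "(\<lambda>y. rho r (y - x) *\<^sub>R u y) \<in> borel_measurable borel"
    by (intro borel_measurable_continuous_onI continuous_intros u continuous_on_compose2[OF C1_cont[OF C1_rho]]) auto
  from integral_translate[OF this, of x] show ?thesis unfolding mollify_eq_lborel[OF u]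
    using rho_minus[of r "_ - x"] by (simp add: add.commute minus_diff_commute)
qed

text \<open>The fundamental theorem of calculus on the segment from \<open>x\<close> to \<open>x + y\<close>, averaged over \<open>y\<close>.\<close>

lemma mu_line_integral:
  fixes u :: "real^3 \<Rightarrow> real^3"
  assumes u: "C1 u" and r: "0 < r"
  shows "(\<integral>z. (\<Sum>i\<in>UNIV. fst z $ i *\<^sub>R pd i u (x + snd z *\<^sub>R fst z)) \<partial>mu r)
     = mollify r u x - u x"
proof -
  have "(\<integral>z. (\<Sum>i\<in>UNIV. fst z $ i *\<^sub>R pd i u (x + snd z *\<^sub>R fst z)) \<partial>mu r)
     = (\<integral>y. rho r y *\<^sub>R (u (x + y) - u x) \<partial>lborel)"
    by (subst mu_integral[OF _ r])
       (auto simp: C1_line_integral[OF u] intro!: continuous_intros continuous_on_compose2[OF C1_pd_cont[OF u]])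
  also have "\<dots> = (\<integral>y. rho r y *\<^sub>R u (x + y) \<partial>lborel) - (\<integral>y. rho r y *\<^sub>R u x \<partial>lborel)"
  proof -
    have "integrable lborel (\<lambda>y. rho r y *\<^sub>R u (x + y))"
      by (intro csupp_integrable continuous_intros continuous_on_compose2[OF C1_cont[OF u]] C1_cont[OF C1_rho]
        csupp_bilinear_left[OF bounded_bilinear_scaleR] csupp_rho r) auto
    then show ?thesis using rho_integrable[OF r] by (simp add: scaleR_diff_right)
  qed
  finally show ?thesis
    using rho_integrable[OF r] by (simp add: rho_integral r mollify_eq_average C1_cont u)
qed

definition error_potential :: "real \<Rightarrow> (real^3 \<Rightarrow> real^3) \<Rightarrow> real^3 \<Rightarrow> real^3" where
  "error_potential r u x = (\<integral>z. cross3 (fst z) (u (x + snd z *\<^sub>R fst z)) \<partial>mu r)"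

lemma
  assumes u: "C1 u" and r: "0 < r"
  shows C1_error_potential: "C1 (error_potential r u)"
    and pd_error_potential: "pd i (error_potential r u) x = (\<integral>z. cross3 (fst z) (pd i u (x + snd z *\<^sub>R fst z)) \<partial>mu r)"
proof -
  interpret finite_measure "mu r" by (rule finite_measureI) (simp add: emeasure_mu_space r)
  have k: "C1 (\<lambda>x. cross3 (fst z) (u (x + snd z *\<^sub>R fst z)))" for z :: "(real^3) \<times> real"
    by (rule C1_cross[OF C1_const C1_shift_add[OF u]])
  have pdk: "pd i (\<lambda>x. cross3 (fst z) (u (x + snd z *\<^sub>R fst z))) x = cross3 (fst z) (pd i u (x + snd z *\<^sub>R fst z))"
    for z :: "(real^3) \<times> real" and i x
    by (subst pd_cross) (auto simp: pd_shift_add[OF u] C1_differentiable[OF C1_shift_add[OF u]])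
  note cont = continuous_on_compose2[OF C1_cont[OF u]] continuous_on_compose2[OF C1_pd_cont[OF u]]
  have int: "integrable (mu r) (\<lambda>z. cross3 (fst z) (u (x + snd z *\<^sub>R fst z)))" for x
    by (intro mu_integrable[OF _ r] continuous_on_cross continuous_intros cont) auto
  have int': "integrable (mu r) (\<lambda>z. cross3 (fst z) (pd i u (x + snd z *\<^sub>R fst z)))" for x i
    by (intro mu_integrable[OF _ r] continuous_on_cross continuous_intros cont) auto
  have dom: "\<exists>w. integrable (mu r) w \<and>
      (AE z in mu r. \<forall>y\<in>ball x 1. \<forall>i. norm (pd i (\<lambda>x. cross3 (fst z) (u (x + snd z *\<^sub>R fst z))) y) \<le> w z)" for x
  proof -
    have "\<exists>B. \<forall>y\<in>cball x (1 + r). norm (pd i u y) \<le> B" for i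
      using compact_imp_bounded[OF compact_continuous_image[OF continuous_on_subset[OF C1_pd_cont[OF u, of i]] compact_cball]]
      by (auto simp: bounded_iff)
    then obtain B where B: "\<And>i y. y \<in> cball x (1 + r) \<Longrightarrow> norm (pd i u y) \<le> B i" by metis
    have B0: "0 \<le> B i" for i using order_trans[OF norm_ge_zero B[of x i]] r by simp
    define w :: "(real^3) \<times> real \<Rightarrow> real" where "w z = r * (\<Sum>i\<in>UNIV. B i)" for z
    have "AE z in mu r. \<forall>y\<in>ball x 1. \<forall>i. norm (pd i (\<lambda>x. cross3 (fst z) (u (x + snd z *\<^sub>R fst z))) y) \<le> w z"
      using AE_mu[OF r]
    proof eventually_elim
      case (elim z)
      show ?case
      proof (intro ballI allI)
        fix y i assume y: "y \<in> ball x 1"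
        have "dist x (y + snd z *\<^sub>R fst z) \<le> dist x y + norm (snd z *\<^sub>R fst z)"
          using dist_triangle[of x "y + snd z *\<^sub>R fst z" y] by (simp add: dist_norm)
        then have "y + snd z *\<^sub>R fst z \<in> cball x (1 + r)" using y norm_shift_le[OF elim] by simp
        from B[OF this, of i] have "norm (fst z) * norm (pd i u (y + snd z *\<^sub>R fst z)) \<le> r * B i"
          using elim r by (intro mult_mono) auto
        also have "r * B i \<le> w z" unfolding w_def
          using r B0 by (intro mult_left_mono member_le_sum) auto
        finally show "norm (pd i (\<lambda>x. cross3 (fst z) (u (x + snd z *\<^sub>R fst z))) y) \<le> w z"
          unfolding pdk by (rule order_trans[OF norm_cross3_le])
      qed
    qed
    moreover have "integrable (mu r) w" by (simp add: w_def[abs_def])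
    ultimately show ?thesis by blast
  qed
  have meas: "(\<lambda>z. pd i (\<lambda>x. cross3 (fst z) (u (x + snd z *\<^sub>R fst z))) x) \<in> borel_measurable (mu r)" for x i
    unfolding pdk using int' by (rule borel_measurable_integrable)
  show "C1 (error_potential r u)" "pd i (error_potential r u) x = (\<integral>z. cross3 (fst z) (pd i u (x + snd z *\<^sub>R fst z)) \<partial>mu r)"
    using C1_parametric_integral[where k="\<lambda>x z. cross3 (fst z) (u (x + snd z *\<^sub>R fst z))", OF k int meas dom]
          pd_parametric_integral[where k="\<lambda>x z. cross3 (fst z) (u (x + snd z *\<^sub>R fst z))", OF k int meas dom, of i x]
    unfolding error_potential_def[abs_def] pdk by auto
qed

text \<open>For a constant vector \<open>y\<close>, \<open>curl (y \<times> u) = y div u - (y \<bullet> \<nabla>) u\<close>. With \<open>div u = 0\<close> the curl of the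
  averaged field is minus the averaged increment of \<open>u\<close> along the segments.\<close>

lemma curl_error_potential:
  assumes u: "C1 u" and r: "0 < r" and div: "\<And>x. divergence u x = 0"
  shows "curl (error_potential r u) x = u x - mollify r u x"
proof -
  have int': "integrable (mu r) (\<lambda>z. cross3 (fst z) (pd i u (x + snd z *\<^sub>R fst z)))" for i
    by (intro mu_integrable[OF _ r] continuous_on_cross continuous_intros continuous_on_compose2[OF C1_pd_cont[OF u]]) auto
  have bl: "bounded_linear (\<lambda>a. cross3 (axis i 1) a)" for i :: 3
    by (rule bounded_bilinear.bounded_linear_right[OF bounded_bilinear_cross3])
  have "curl (error_potential r u) x = (\<Sum>i\<in>UNIV. (\<integral>z. cross3 (axis i 1) (cross3 (fst z) (pd i u (x + snd z *\<^sub>R fst z))) \<partial>mu r))"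
    unfolding curl_eq pd_error_potential[OF u r]
    by (intro sum.cong refl integral_bounded_linear[OF bl int', symmetric])
  also have "\<dots> = (\<integral>z. (\<Sum>i\<in>UNIV. cross3 (axis i 1) (cross3 (fst z) (pd i u (x + snd z *\<^sub>R fst z)))) \<partial>mu r)"
    by (rule Bochner_Integration.integral_sum[symmetric]) (rule integrable_bounded_linear[OF bl int'])
  also have "\<dots> = (\<integral>z. - (\<Sum>i\<in>UNIV. fst z $ i *\<^sub>R pd i u (x + snd z *\<^sub>R fst z)) \<partial>mu r)"
  proof (rule Bochner_Integration.integral_cong[OF refl])
    fix z :: "(real^3) \<times> real"
    define y where "y = fst z"
    define w where "w i = pd i u (x + snd z *\<^sub>R fst z)" for i
    (* The divergence constraint eliminates one component, after which the identity is polynomial. *)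
    have "w 1 $ 1 + w 2 $ 2 + w 3 $ 3 = 0"
      using div[of "x + snd z *\<^sub>R fst z"] by (simp add: divergence_def w_def sum_3)
    then have w3: "w 3 $ 3 = - w 1 $ 1 - w 2 $ 2" by linarith
    have "(\<Sum>i\<in>UNIV. cross3 (axis i 1) (cross3 y (w i))) = - (\<Sum>i\<in>UNIV. y $ i *\<^sub>R w i)"
      by (simp add: vec_eq_iff forall_3 sum_3 cross_components axis_def w3 algebra_simps)
    then show "(\<Sum>i\<in>UNIV. cross3 (axis i 1) (cross3 (fst z) (pd i u (x + snd z *\<^sub>R fst z)))) =
      - (\<Sum>i\<in>UNIV. fst z $ i *\<^sub>R pd i u (x + snd z *\<^sub>R fst z))" by (simp only: y_def w_def)
  qed
  also have "\<dots> = u x - mollify r u x"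
    by (simp add: mu_line_integral[OF u r])
  finally show ?thesis .
qed

section \<open>Averaging contracts Lebesgue norms\<close>

lemma mu_average_power2:
  fixes h :: "real^3 \<Rightarrow> ennreal"
  assumes h [measurable]: "h \<in> borel_measurable borel" and r: "0 < r"
  shows "(mean r h x)\<^sup>2 \<le> (mean r (\<lambda>x. (h x)\<^sup>2) x)"
  using Cauchy_Schwarz_nn_integral[of "\<lambda>z. h (x + snd z *\<^sub>R fst z)" "mu r" "\<lambda>_. 1"]
  by (simp add: emeasure_mu_space r)

lemma mu_average_nn_integral:
  fixes h :: "real^3 \<Rightarrow> ennreal"
  assumes h [measurable]: "h \<in> borel_measurable borel" and r: "0 < r"
  shows "(\<integral>\<^sup>+x. (mean r h x) \<partial>lborel) = (\<integral>\<^sup>+x. h x \<partial>lborel)"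
proof -
  interpret m: finite_measure "mu r" by (rule finite_measureI) (simp add: emeasure_mu_space r)
  interpret P: pair_sigma_finite lborel "mu r" ..
  have "(\<integral>\<^sup>+x. (mean r h x) \<partial>lborel) = (\<integral>\<^sup>+z. (\<integral>\<^sup>+x. h (x + snd z *\<^sub>R fst z) \<partial>lborel) \<partial>mu r)"
    by (rule P.Fubini'[symmetric]) measurable
  also have "\<dots> = (\<integral>\<^sup>+z. (\<integral>\<^sup>+x. h x \<partial>lborel) \<partial>mu r)"
    by (simp add: nn_integral_translate)
  finally show ?thesis by (simp add: emeasure_mu_space r)
qed

text \<open>Almost every shift has length at most \<open>r\<close>, so the average over shifts of a point of the ball of radius
  \<open>R\<close> only sees values in the ball of radius \<open>R + r\<close>.\<close>

lemma mu_average_local: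
  fixes h :: "real^3 \<Rightarrow> ennreal"
  assumes h [measurable]: "h \<in> borel_measurable borel" and r: "0 < r"
  shows "(\<integral>\<^sup>+x\<in>ball 0 R. (mean r h x) \<partial>lborel) \<le> (\<integral>\<^sup>+x\<in>ball 0 (R + r). h x \<partial>lborel)"
proof -
  define k where "k x = h x * indicator (ball 0 (R + r)) x" for x
  have [measurable]: "ball (0::real^3) (R + r) \<in> sets borel" by simp
  have [measurable]: "k \<in> borel_measurable borel" unfolding k_def by measurable
  have "(\<integral>\<^sup>+x\<in>ball 0 R. (mean r h x) \<partial>lborel)
     \<le> (\<integral>\<^sup>+x. (mean r k x) \<partial>lborel)"
  proof (rule nn_integral_mono)
    fix x :: "real^3"
    show "(mean r h x) * indicator (ball 0 R) x \<le> (mean r k x)"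
    proof (cases "x \<in> ball 0 R")
      case True
      have "(mean r h x) = (mean r k x)"
      proof (rule nn_integral_cong_AE)
        show "AE z in mu r. h (x + snd z *\<^sub>R fst z) = k (x + snd z *\<^sub>R fst z)"
          using AE_mu[OF r]
        proof eventually_elim
          case (elim z)
          have "x + snd z *\<^sub>R fst z \<in> ball 0 (R + r)"
            using norm_shift_le[OF elim] True norm_triangle_ineq[of x "snd z *\<^sub>R fst z"] by simp
          then show ?case by (simp add: k_def)
        qed
      qed
      then show ?thesis using True by simp
    qed simp
  qed
  also have "\<dots> = (\<integral>\<^sup>+x. k x \<partial>lborel)" by (rule mu_average_nn_integral) (use r in auto)
  finally show ?thesis by (simp add: k_def)
qed

lemma mu_average_L2_local:
  fixes h :: "real^3 \<Rightarrow> ennreal"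
  assumes h [measurable]: "h \<in> borel_measurable borel" and r: "0 < r"
  shows "(\<integral>\<^sup>+x\<in>ball 0 R. (mean r h x)\<^sup>2 \<partial>lborel) \<le> (\<integral>\<^sup>+x\<in>ball 0 (R + r). (h x)\<^sup>2 \<partial>lborel)"
  by (rule order_trans[OF nn_integral_mono mu_average_local[where h="\<lambda>x. (h x)\<^sup>2", OF _ r]])
     (auto intro!: mult_right_mono mu_average_power2 r)

lemma mu_average_L4_local:
  fixes h :: "real^3 \<Rightarrow> ennreal"
  assumes h [measurable]: "h \<in> borel_measurable borel" and r: "0 < r"
  shows "(\<integral>\<^sup>+x\<in>ball 0 R. (mean r h x) ^ 4 \<partial>lborel) \<le> (\<integral>\<^sup>+x\<in>ball 0 (R + r). h x ^ 4 \<partial>lborel)"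
proof -
  have "(mean r h x) ^ 4 \<le> (mean r (\<lambda>x. (h x)\<^sup>2) x)\<^sup>2" for x
    using power_mono[OF mu_average_power2[OF h r, of x] zero_le, of 2] by (simp flip: power_mult)
  then have "(\<integral>\<^sup>+x\<in>ball 0 R. (mean r h x) ^ 4 \<partial>lborel)
     \<le> (\<integral>\<^sup>+x\<in>ball 0 R. (mean r (\<lambda>x. (h x)\<^sup>2) x)\<^sup>2 \<partial>lborel)"
    by (intro nn_integral_mono mult_right_mono) auto
  also have "\<dots> \<le> (\<integral>\<^sup>+x\<in>ball 0 (R + r). ((h x)\<^sup>2)\<^sup>2 \<partial>lborel)"
    by (rule mu_average_L2_local) (use r in auto)
  finally show ?thesis by (simp flip: power_mult)
qed

lemma mu_average_L2:
  fixes h :: "real^3 \<Rightarrow> ennreal"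
  assumes h [measurable]: "h \<in> borel_measurable borel" and r: "0 < r"
  shows "(\<integral>\<^sup>+x. (mean r h x)\<^sup>2 \<partial>lborel) \<le> (\<integral>\<^sup>+x. (h x)\<^sup>2 \<partial>lborel)"
  using order_trans[OF nn_integral_mono[OF mu_average_power2[OF h r]] eq_refl[OF mu_average_nn_integral[where h="\<lambda>x. (h x)\<^sup>2", OF _ r]]]
  by simp

lemma mu_integral_norm_le:
  fixes F :: "(real^3) \<times> real \<Rightarrow> 'b::euclidean_space" and h :: "real^3 \<Rightarrow> real"
  assumes F: "continuous_on UNIV F" and r: "0 < r"
    and h: "continuous_on UNIV h" and le: "\<And>z. norm (F z) \<le> norm (fst z) * h (x + snd z *\<^sub>R fst z)"
    and h0: "\<And>x. 0 \<le> h x"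
  shows "ennreal (norm (integral\<^sup>L (mu r) F)) \<le> ennreal r * (mean r (\<lambda>x. ennreal (h x)) x)"
proof -
  have [measurable]: "h \<in> borel_measurable borel" by (rule borel_measurable_continuous_onI[OF h])
  have "ennreal (norm (integral\<^sup>L (mu r) F)) \<le> (\<integral>\<^sup>+z. norm (F z) \<partial>mu r)"
    by (rule integral_norm_bound_ennreal[OF mu_integrable[OF F r]])
  also have "\<dots> \<le> (\<integral>\<^sup>+z. ennreal r * ennreal (h (x + snd z *\<^sub>R fst z)) \<partial>mu r)"
  proof (rule nn_integral_mono_AE)
    show "AE z in mu r. ennreal (norm (F z)) \<le> ennreal r * ennreal (h (x + snd z *\<^sub>R fst z))"
      using AE_mu[OF r]
    proof eventually_elim
      case (elim z)
      have "norm (F z) \<le> r * h (x + snd z *\<^sub>R fst z)"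
        using elim h0 by (intro order_trans[OF le] mult_right_mono) auto
      then show ?case using r h0 by (simp flip: ennreal_mult add: ennreal_leI)
    qed
  qed
  also have "\<dots> = ennreal r * (mean r (\<lambda>x. ennreal (h x)) x)"
    by (rule nn_integral_cmult) measurable
  finally show ?thesis .
qed

lemma norm_error_potential_le:
  assumes u: "C1 u" and r: "0 < r"
  shows "ennreal (norm (error_potential r u x)) \<le> ennreal r * (mean r (\<lambda>x. ennreal (norm (u x))) x)"
    and "ennreal (norm (pd i (error_potential r u) x)) \<le> ennreal r * (mean r (\<lambda>x. ennreal (norm (pd i u x))) x)"
  unfolding pd_error_potential[OF u r] error_potential_def
  by (rule mu_integral_norm_le[where h="\<lambda>x. norm (u x)"] mu_integral_norm_le[where h="\<lambda>x. norm (pd i u x)"];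
      (intro continuous_on_cross continuous_intros continuous_on_compose2[OF C1_cont[OF u]]
        continuous_on_compose2[OF C1_pd_cont[OF u]] norm_cross3_le r C1_cont[OF u] C1_pd_cont[OF u])?; auto simp: norm_cross3_le)+

definition grad_norm2 :: "(real^3 \<Rightarrow> real^3) \<Rightarrow> real^3 \<Rightarrow> real" where
  "grad_norm2 u x = (\<Sum>i\<in>UNIV. (norm (pd i u x))\<^sup>2)"

lemma sum_norm_pd_le: "(\<Sum>i\<in>UNIV. norm (pd i u x))\<^sup>2 \<le> 3 * grad_norm2 u x"
  unfolding grad_norm2_def sum_3
  using sum_squares_bound[of "norm (pd 1 u x)" "norm (pd 2 u x)"] sum_squares_bound[of "norm (pd 1 u x)" "norm (pd 3 u x)"]
    sum_squares_bound[of "norm (pd 2 u x)" "norm (pd 3 u x)"]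
  by (simp add: power2_eq_square algebra_simps)

text \<open>Every shift has length at most \<open>r\<close>, so the error at \<open>x\<close> is at most \<open>r\<close> times an average of the size of
  the gradient, and averages contract the \<open>L\<^sup>2\<close> norm.\<close>

lemma mollification_error_L2:
  assumes u: "C1 u" and r: "0 < r"
  shows "(\<integral>\<^sup>+x. ennreal ((norm (u x - mollify r u x))\<^sup>2) \<partial>lborel)
     \<le> ennreal (3 * r\<^sup>2) * (\<integral>\<^sup>+x. ennreal (grad_norm2 u x) \<partial>lborel)"
proof -
  define h where "h x = (\<Sum>i\<in>UNIV. norm (pd i u x))" for x
  have hc: "continuous_on UNIV h" unfolding h_def by (intro continuous_intros C1_pd_cont u)
  have h0: "0 \<le> h x" for x by (simp add: h_def sum_nonneg)
  have [measurable]: "h \<in> borel_measurable borel" by (rule borel_measurable_continuous_onI[OF hc])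
  have [measurable]: "grad_norm2 u \<in> borel_measurable borel" unfolding grad_norm2_def[abs_def]
    by (rule borel_measurable_continuous_onI) (intro continuous_intros C1_pd_cont u)
  have e: "ennreal (norm (u x - mollify r u x)) \<le> ennreal r * (mean r (\<lambda>x. ennreal (h x)) x)" for x
  proof -
    have "ennreal (norm (\<integral>z. (\<Sum>i\<in>UNIV. fst z $ i *\<^sub>R pd i u (x + snd z *\<^sub>R fst z)) \<partial>mu r))
       \<le> ennreal r * (mean r (\<lambda>x. ennreal (h x)) x)"
    proof (rule mu_integral_norm_le[OF _ r hc _ h0])
      show "continuous_on UNIV (\<lambda>z. \<Sum>i\<in>UNIV. fst z $ i *\<^sub>R pd i u (x + snd z *\<^sub>R fst z))"
        by (intro continuous_intros continuous_on_compose2[OF C1_pd_cont[OF u]]) auto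
      fix z :: "(real^3) \<times> real"
      show "norm (\<Sum>i\<in>UNIV. fst z $ i *\<^sub>R pd i u (x + snd z *\<^sub>R fst z)) \<le> norm (fst z) * h (x + snd z *\<^sub>R fst z)"
        unfolding h_def sum_distrib_left
        by (rule sum_norm_le) (simp add: component_le_norm_cart mult_right_mono)
    qed
    then show ?thesis unfolding mu_line_integral[OF u r] by (simp add: norm_minus_commute)
  qed
  have "(\<integral>\<^sup>+x. ennreal ((norm (u x - mollify r u x))\<^sup>2) \<partial>lborel)
     \<le> (\<integral>\<^sup>+x. ennreal (r\<^sup>2) * (mean r (\<lambda>x. ennreal (h x)) x)\<^sup>2 \<partial>lborel)"
    using power_mono[OF e zero_le, of _ 2] r by (intro nn_integral_mono) (simp add: power_mult_distrib ennreal_power)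
  also have "\<dots> = ennreal (r\<^sup>2) * (\<integral>\<^sup>+x. (mean r (\<lambda>x. ennreal (h x)) x)\<^sup>2 \<partial>lborel)"
  proof (rule nn_integral_cmult)
    interpret m: finite_measure "mu r" by (rule finite_measureI) (simp add: emeasure_mu_space r)
    show "(\<lambda>x. (mean r (\<lambda>x. ennreal (h x)) x)\<^sup>2) \<in> borel_measurable lborel"
      by measurable
  qed
  also have "\<dots> \<le> ennreal (r\<^sup>2) * (\<integral>\<^sup>+x. (ennreal (h x))\<^sup>2 \<partial>lborel)"
    by (intro mult_left_mono mu_average_L2 r) auto
  also have "\<dots> \<le> ennreal (r\<^sup>2) * (\<integral>\<^sup>+x. ennreal 3 * ennreal (grad_norm2 u x) \<partial>lborel)"
    using sum_norm_pd_le[of u] h0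
    by (intro mult_left_mono nn_integral_mono)
       (auto simp: ennreal_power ennreal_mult'[symmetric] h_def simp del: ennreal_numeral intro!: ennreal_leI)
  also have "\<dots> = ennreal (3 * r\<^sup>2) * (\<integral>\<^sup>+x. ennreal (grad_norm2 u x) \<partial>lborel)"
    by (subst nn_integral_cmult) (auto simp: ennreal_mult mult_ac)
  finally show ?thesis .
qed

section \<open>Decay of the level sets\<close>

lemma
  assumes "D_solution u"
  shows D_solution_C2: "C2 u"
    and D_solution_div: "divergence u x = 0"
    and D_solution_dirichlet: "\<exists>D>0. (\<integral>\<^sup>+x. ennreal (grad_norm2 u x) \<partial>lborel) \<le> ennreal D"
    and D_solution_bounded: "\<exists>M>0. \<forall>x. norm (u x) \<le> M"
proof -
  note d = assms[unfolded D_solution_def]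
  show C2: "C2 u" using d by (simp add: smooth_C2)
  show "divergence u x = 0" using d by simp
  have g: "(\<Sum>i\<in>UNIV. \<Sum>j\<in>UNIV. (pd i u x $ j)\<^sup>2) = grad_norm2 u x" for x
    unfolding grad_norm2_def power2_norm_eq_inner by (simp add: inner_vec_def power2_eq_square)
  have "integrable lebesgue (grad_norm2 u)" using d unfolding g[abs_def] by simp
  then have "(\<integral>\<^sup>+x. ennreal (norm (grad_norm2 u x)) \<partial>lebesgue) < \<infinity>" by (simp add: integrable_iff_bounded)
  then have "(\<integral>\<^sup>+x. ennreal (grad_norm2 u x) \<partial>lborel) < \<infinity>"
    by (simp add: nn_integral_completion grad_norm2_def sum_nonneg)
  then obtain E where E: "E \<ge> 0" "(\<integral>\<^sup>+x. ennreal (grad_norm2 u x) \<partial>lborel) = ennreal E"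
    by (cases "(\<integral>\<^sup>+x. ennreal (grad_norm2 u x) \<partial>lborel)") auto
  show "\<exists>D>0. (\<integral>\<^sup>+x. ennreal (grad_norm2 u x) \<partial>lborel) \<le> ennreal D"
    by (rule exI[of _ "E + 1"]) (use E in \<open>auto intro!: ennreal_leI\<close>)
  have "eventually (\<lambda>x. dist (u x) 0 < 1) at_infinity" using d by (intro tendstoD) auto
  then obtain b where b: "\<And>x. b \<le> norm x \<Longrightarrow> norm (u x) < 1" by (auto simp: eventually_at_infinity)
  have "compact (u ` cball 0 b)"
    by (intro compact_continuous_image continuous_on_subset[OF C1_cont[OF C2_C1[OF C2]]]) auto
  then obtain B where B: "\<And>x. norm x \<le> b \<Longrightarrow> norm (u x) \<le> B"
    by (force dest!: compact_imp_bounded simp: bounded_iff)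
  have "norm (u x) \<le> max 1 B" for x using b[of x] B[of x] by (cases "norm x \<le> b") auto
  then show "\<exists>M>0. \<forall>x. norm (u x) \<le> M" by (intro exI[of _ "max 1 B"]) auto
qed

text \<open>The scale \<open>r\<close> is chosen so that the mollification is pointwise at most \<open>t / 2\<close>; the level set then
  lies in the set where the mollification error exceeds \<open>t / 2\<close>.\<close>

lemma level_set_decay:
  assumes D: "D_solution u" and s: "s \<ge> 1" and f: "locally_L1 \<psi>" and w: "is_weak_curl u \<psi>"
    and C: "C > 0" and \<alpha>: "\<alpha> < 1" and o: "oscillation_bound \<psi> s C \<alpha>"
  shows "\<exists>K>0. \<exists>t0>0. \<forall>t. 0 < t \<and> t < t0 \<longrightarrow>
    emeasure lborel {x. t < norm (u x)} \<le> ennreal (K * t powr (- (2 + 2 / (1 - \<alpha>))))"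
proof -
  have C1: "C1 u" using D_solution_C2[OF D] by (rule C2_C1)
  note uc = C1_cont[OF C1]
  obtain K0 where K0: "K0 > 0" "\<forall>r>1. \<forall>x i. norm (pd i (mollify r \<psi>) x) \<le> K0 * r powr (\<alpha> - 1)"
    using mollify_oscillation[OF f o s C] by (elim exE conjE) (rule that)
  obtain E where E: "E > 0" "(\<integral>\<^sup>+x. ennreal (grad_norm2 u x) \<partial>lborel) \<le> ennreal E"
    using D_solution_dirichlet[OF D] by blast
  define L where "L = 6 * K0"
  have L: "L > 0" using K0 by (simp add: L_def)
  define \<beta> where "\<beta> = 1 / (1 - \<alpha>)"
  have \<beta>: "\<beta> > 0" using \<alpha> by (simp add: \<beta>_def)
  have "emeasure lborel {x. t < norm (u x)} \<le> ennreal ((12 * E * L powr (2 * \<beta>)) * t powr (- (2 + 2 / (1 - \<alpha>))))"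
    if t: "0 < t" "t < L" for t
  proof -
    (* The solution of L r^(alpha - 1) = t; it exceeds 1 exactly because t is below L. *)
    define r where "r = (t / L) powr (- \<beta>)"
    have "(t / L) powr 0 < (t / L) powr (- \<beta>)" using t L \<beta> by (intro powr_less_mono') auto
    then have r: "r > 1" using t L by (simp add: r_def)
    have rpow: "r powr (\<alpha> - 1) = t / L"
    proof -
      have "- \<beta> * (\<alpha> - 1) = 1" using \<alpha> by (simp add: \<beta>_def field_simps)
      then show ?thesis using t L by (simp add: r_def powr_powr)
    qed
    define v where "v x = mollify r u x" for x
    have v: "norm (v x) \<le> t / 2" for x
    proof -
      have "norm (v x) = norm (curl (mollify r \<psi>) x)"
        unfolding v_def using curl_mollify[OF f w uc] r by simp
      also have "\<dots> \<le> (\<Sum>i\<in>(UNIV::3 set). K0 * r powr (\<alpha> - 1))"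
        by (rule order_trans[OF norm_curl_le sum_mono]) (rule K0(2)[rule_format, OF r])
      also have "\<dots> = t / 2" using rpow L by (simp add: L_def field_simps)
      finally show ?thesis .
    qed
    have "continuous_on UNIV v"
      unfolding v_def using C1_mollify[OF f, of r] r
      by (subst curl_mollify[OF f w uc, symmetric]) (auto intro!: continuous_on_curl)
    then have [measurable]: "v \<in> borel_measurable borel" by (rule borel_measurable_continuous_onI)
    have [measurable]: "u \<in> borel_measurable borel" by (rule borel_measurable_continuous_onI[OF uc])
    have "emeasure lborel {x. t < norm (u x)} \<le> emeasure lborel {x \<in> space lborel. 1 \<le> ennreal (4 / t\<^sup>2) * ennreal ((norm (u x - v x))\<^sup>2)}"
    proof (rule emeasure_mono)
      show "{x. t < norm (u x)} \<subseteq> {x \<in> space lborel. 1 \<le> ennreal (4 / t\<^sup>2) * ennreal ((norm (u x - v x))\<^sup>2)}"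
      proof (clarsimp simp flip: ennreal_mult)
        fix x assume "t < norm (u x)"
        then have "t / 2 \<le> norm (u x - v x)" using v[of x] norm_triangle_ineq2[of "u x" "v x"] by linarith
        then have "(t / 2)\<^sup>2 \<le> (norm (u x - v x))\<^sup>2" using t by (intro power_mono) auto
        then show "1 \<le> 4 * (norm (u x - v x))\<^sup>2 / t\<^sup>2" using t by (simp add: field_simps power2_eq_square)
      qed
    qed measurable
    also have "\<dots> \<le> ennreal (4 / t\<^sup>2) * (\<integral>\<^sup>+x. ennreal ((norm (u x - v x))\<^sup>2) * indicator (space lborel) x \<partial>lborel)"
      by (rule nn_integral_Markov_inequality) auto
    also have "\<dots> \<le> ennreal (4 / t\<^sup>2) * (ennreal (3 * r\<^sup>2) * ennreal E)"
      using order_trans[OF mollification_error_L2[OF C1, of r] mult_left_mono[OF E(2) zero_le]] r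
      by (intro mult_left_mono) (simp_all add: v_def)
    also have "ennreal (4 / t\<^sup>2) * (ennreal (3 * r\<^sup>2) * ennreal E) = ennreal (12 * E * (r\<^sup>2 / t\<^sup>2))"
      using E(1) by (simp flip: ennreal_mult add: mult_ac)
    also have "r\<^sup>2 / t\<^sup>2 = L powr (2 * \<beta>) * t powr (- (2 + 2 / (1 - \<alpha>)))"
    proof -
      have "r\<^sup>2 = (t / L) powr (- \<beta> + - \<beta>)" by (simp only: r_def power2_eq_square powr_add)
      also have "- \<beta> + - \<beta> = - (2 * \<beta>)" by simp
      also have "(t / L) powr (- (2 * \<beta>)) = L powr (2 * \<beta>) * t powr (- (2 * \<beta>))"
        using t L by (simp add: powr_divide powr_minus field_simps)
      finally have "r\<^sup>2 / t\<^sup>2 = L powr (2 * \<beta>) * (t powr (- (2 * \<beta>)) * t powr (- 2))"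
        using t by (simp add: powr_minus powr_numeral field_simps)
      also have "t powr (- (2 * \<beta>)) * t powr (- 2) = t powr (- (2 + 2 / (1 - \<alpha>)))"
      proof -
        have "- (2 * \<beta>) + - 2 = - (2 + 2 / (1 - \<alpha>))" by (simp add: \<beta>_def)
        then show ?thesis by (simp only: powr_add[symmetric])
      qed
      finally show ?thesis .
    qed
    finally show ?thesis by (simp add: mult.assoc)
  qed
  then show ?thesis using L E(1) by (intro exI[of _ "12 * E * L powr (2 * \<beta>)"] conjI exI[of _ L]) auto
qed

lemma emeasure_lebesgue_eq_lborel: "A \<in> sets borel \<Longrightarrow> emeasure lebesgue A = emeasure lborel A"
  by simp

text \<open>Small \<open>t\<close> are covered by the decay, since \<open>q \<le> p\<close>; beyond \<open>M\<close> the level set is empty, and in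
  between it is contained in the one at height \<open>t0 / 2\<close>.\<close>

lemma weak_Lp_of_level_set_decay:
  assumes u: "continuous_on UNIV u" and M: "\<And>x. norm (u x) \<le> M" "M > 0"
    and K: "K > 0" "t0 > 0"
      "\<And>t. 0 < t \<Longrightarrow> t < t0 \<Longrightarrow> emeasure lborel {x. t < norm (u x)} \<le> ennreal (K * t powr (- q))"
    and p: "q \<le> p" "p > 0"
  shows "weak_Lp p u"
proof -
  have [measurable]: "u \<in> borel_measurable borel" by (rule borel_measurable_continuous_onI[OF u])
  define Z where "Z = K * t0 powr (p - q) + M powr p * (K * (t0 / 2) powr (- q))"
  have "ennreal (t powr p) * emeasure lebesgue {x. norm (u x) > t} \<le> ennreal Z" if t: "t > 0" for t
  proof -
    have eq: "emeasure lebesgue {x. norm (u x) > t} = emeasure lborel {x. t < norm (u x)}"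
      by (rule emeasure_lebesgue_eq_lborel) measurable
    consider "t < t0" | "t0 \<le> t" "t < M" | "M \<le> t" by linarith
    then show ?thesis
    proof cases
      case 1
      have "ennreal (t powr p) * emeasure lborel {x. t < norm (u x)} \<le> ennreal (t powr p) * ennreal (K * t powr (- q))"
        by (intro mult_left_mono K(3) t 1) auto
      also have "\<dots> = ennreal (K * t powr (p - q))"
        using K(1) by (simp flip: ennreal_mult add: mult.left_commute powr_diff powr_minus divide_inverse)
      also have "\<dots> \<le> ennreal Z"
        unfolding Z_def using t 1 K p by (intro ennreal_leI add_increasing2 mult_left_mono powr_mono2) auto
      finally show ?thesis by (simp add: eq)
    next
      case 2
      have "emeasure lborel {x. t < norm (u x)} \<le> emeasure lborel {x. t0 / 2 < norm (u x)}"
        by (rule emeasure_mono) (use 2 K in auto)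
      also have "\<dots> \<le> ennreal (K * (t0 / 2) powr (- q))" by (rule K(3)) (use K in auto)
      finally have "ennreal (t powr p) * emeasure lborel {x. t < norm (u x)} \<le> ennreal (M powr p) * ennreal (K * (t0 / 2) powr (- q))"
        using t 2 p by (intro mult_mono ennreal_leI powr_mono2) auto
      also have "\<dots> \<le> ennreal Z"
        unfolding Z_def using K(1) by (auto simp flip: ennreal_mult intro!: ennreal_leI)
      finally show ?thesis by (simp add: eq)
    next
      case 3
      then have "{x. t < norm (u x)} = {}" using M(1) by (auto simp: not_less intro: order_trans)
      then show ?thesis by (simp add: eq)
    qed
  qed
  then have "(SUP t\<in>{0<..}. ennreal (t powr p) * emeasure lebesgue {x. norm (u x) > t}) \<le> ennreal Z"
    by (intro SUP_least) auto
  then have "(SUP t\<in>{0<..}. ennreal (t powr p) * emeasure lebesgue {x. norm (u x) > t}) < \<infinity>"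
    by (rule le_less_trans) simp
  then show ?thesis unfolding weak_Lp_def using continuous_borel_lebesgue[OF u] by simp
qed

section \<open>Strong integrability and growth of local norms\<close>

text \<open>A dyadic decomposition of the range below \<open>M\<close>: the layer at height \<open>M / 2 ^ k\<close> contributes at
  most a constant times the \<open>k\<close>-th power of \<open>2 powr (p - s)\<close>, a convergent geometric series.\<close>

lemma Lp_of_weak_Lp:
  assumes u: "continuous_on UNIV u" and M: "\<And>x. norm (u x) \<le> M" "M > 0"
    and wk: "weak_Lp p u" and p: "p < s"  "s > 0"
  shows "(\<integral>\<^sup>+x. ennreal (norm (u x) powr s) \<partial>lborel) < \<infinity>"
proof -
  have [measurable]: "u \<in> borel_measurable borel" by (rule borel_measurable_continuous_onI[OF u])
  define S where "S = (SUP t\<in>{0<..}. ennreal (t powr p) * emeasure lebesgue {x. norm (u x) > t})"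
  have "S < \<infinity>" using wk by (simp add: weak_Lp_def S_def)
  then obtain W where W: "W \<ge> 0" "S = ennreal W" by (cases S) auto
  have lev: "emeasure lborel {x. t < norm (u x)} \<le> ennreal (W * t powr (- p))" if t: "t > 0" for t
  proof -
    have eq: "emeasure lebesgue {x. norm (u x) > t} = emeasure lborel {x. t < norm (u x)}"
      by (rule emeasure_lebesgue_eq_lborel) measurable
    have "ennreal (t powr p) * emeasure lborel {x. t < norm (u x)} \<le> S"
      unfolding S_def eq[symmetric] by (rule SUP_upper) (use t in auto)
    then have "ennreal (t powr (- p)) * (ennreal (t powr p) * emeasure lborel {x. t < norm (u x)}) \<le> ennreal (t powr (- p)) * ennreal W"
      unfolding W(2) by (rule mult_left_mono) simp
    moreover have "ennreal (t powr (- p)) * (ennreal (t powr p) * X) = X" for X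
    proof -
      have "ennreal (t powr (- p)) * ennreal (t powr p) = ennreal (t powr (- p) * t powr p)" by (simp add: ennreal_mult)
      also have "t powr (- p) * t powr p = 1" using t by (simp flip: powr_add)
      finally show ?thesis by (simp flip: mult.assoc)
    qed
    ultimately show ?thesis using W(1) by (simp flip: ennreal_mult add: mult.commute)
  qed
  define a where "a k = M / 2 ^ k" for k :: nat
  have a: "a k > 0" for k using M by (simp add: a_def)
  define q where "q = 2 powr (p - s)"
  have q: "0 < q" "q < 1" using p by (simp_all add: q_def powr_less_one)
  have geo: "(a k powr s) * (W * a (Suc k) powr (- p)) = (W * M powr (s - p) * 2 powr p) * q ^ k" for k
  proof -
    define b :: real where "b = 2 powr (- real k)"
    have b: "b > 0" by (simp add: b_def)
    have "2 powr real k = (2::real) ^ k" by (rule powr_realpow) simp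
    then have "b = inverse (2 ^ k)" by (simp only: b_def powr_minus)
    then have ak: "a k = M * b" "a (Suc k) = M * b * inverse 2" by (simp_all add: a_def field_simps)
    have "q ^ k = 2 powr ((p - s) * real k)" by (simp add: q_def powr_power mult.commute)
    also have "\<dots> = b powr (s - p)" by (simp add: b_def powr_powr algebra_simps)
    also have "\<dots> = b powr s * b powr (- p)" by (simp flip: powr_add)
    finally have qk: "q ^ k = b powr s * b powr (- p)" .
    have Mp: "M powr (s - p) = M powr s * M powr (- p)" by (simp flip: powr_add)
    have "inverse 2 = (2::real) powr (- 1)" by (simp add: powr_minus)
    then have "inverse 2 powr (- p) = (2::real) powr p" by (simp only: powr_powr) simp
    then have "a (Suc k) powr (- p) = M powr (- p) * b powr (- p) * 2 powr p"
      using M b by (simp only: ak powr_mult)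
    moreover have "a k powr s = M powr s * b powr s" using M b by (simp only: ak powr_mult)
    ultimately show ?thesis by (simp only: qk Mp mult_ac)
  qed
  have "(\<integral>\<^sup>+x. ennreal (norm (u x) powr s) \<partial>lborel)
     \<le> (\<integral>\<^sup>+x. (\<Sum>k. ennreal (a k powr s) * indicator {x. a (Suc k) < norm (u x)} x) \<partial>lborel)"
  proof (rule nn_integral_mono)
    fix x
    show "ennreal (norm (u x) powr s) \<le> (\<Sum>k. ennreal (a k powr s) * indicator {x. a (Suc k) < norm (u x)} x)"
    proof (cases "u x = 0")
      case False
      have ex: "\<exists>n. a n < norm (u x)"
      proof -
        obtain n where "M / norm (u x) < 2 ^ n" using real_arch_pow[of 2 "M / norm (u x)"] by auto
        then show ?thesis using False by (auto simp: a_def field_simps intro!: exI[of _ n])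
      qed
      (* The first dyadic height below norm (u x) determines the layer containing x. *)
      define n where "n = (LEAST n. a n < norm (u x))"
      have n: "a n < norm (u x)" unfolding n_def using ex by (rule LeastI_ex)
      have "n \<noteq> 0" using n M(1)[of x] by (cases n) (auto simp: a_def)
      then obtain k where k: "n = Suc k" by (cases n) auto
      have "\<not> a k < norm (u x)" using not_less_Least[of k "\<lambda>n. a n < norm (u x)"] k by (simp add: n_def)
      then have "ennreal (norm (u x) powr s) \<le> ennreal (a k powr s) * indicator {x. a (Suc k) < norm (u x)} x"
        using n p unfolding k by (auto intro!: ennreal_leI powr_mono2)
      also have "\<dots> \<le> (\<Sum>k. ennreal (a k powr s) * indicator {x. a (Suc k) < norm (u x)} x)"
      proof -
        have "f k \<le> (\<Sum>k. f k)" for f :: "nat \<Rightarrow> ennreal" using sum_le_suminf[of f "{k}"] by simp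
        then show ?thesis .
      qed
      finally show ?thesis .
    qed simp
  qed
  also have "\<dots> = (\<Sum>k. ennreal (a k powr s) * emeasure lborel {x. a (Suc k) < norm (u x)})"
    by (subst nn_integral_suminf) (auto simp: nn_integral_cmult_indicator)
  also have "\<dots> \<le> (\<Sum>k. ennreal ((W * M powr (s - p) * 2 powr p) * q ^ k))"
  proof (rule suminf_le)
    fix k
    have "ennreal (a k powr s) * emeasure lborel {x. a (Suc k) < norm (u x)} \<le> ennreal (a k powr s) * ennreal (W * a (Suc k) powr (- p))"
      by (intro mult_left_mono lev a) auto
    then show "ennreal (a k powr s) * emeasure lborel {x. a (Suc k) < norm (u x)} \<le> ennreal ((W * M powr (s - p) * 2 powr p) * q ^ k)"
      using W(1) by (simp flip: ennreal_mult add: geo)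
  qed auto
  also have "\<dots> < \<infinity>"
  proof -
    have "summable (\<lambda>k. (W * M powr (s - p) * 2 powr p) * q ^ k)"
      using q by (intro summable_mult summable_geometric) auto
    then have "(\<Sum>k. ennreal ((W * M powr (s - p) * 2 powr p) * q ^ k)) \<noteq> top"
      using W(1) q by (intro ennreal_suminf_neq_top) auto
    then show ?thesis by (simp add: less_top)
  qed
  finally show ?thesis .
qed

lemma emeasure_ball_eq:
  assumes "0 < R"
  shows "emeasure lborel (ball (x::real^3) R) = ennreal (R ^ 3 * measure lborel (ball (0::real^3) 1))"
proof -
  have "measure lborel (ball x R) = R ^ 3 * measure lborel (ball (0::real^3) 1)"
    using content_ball_conv_unit_ball[of R x] assms by simp
  moreover have "emeasure lborel (ball x R) \<noteq> top"
    using emeasure_lborel_ball_finite[of x R] by simp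
  ultimately show ?thesis by (simp add: emeasure_eq_ennreal_measure)
qed

text \<open>Hoelder's inequality with the volume of the ball, proved by splitting the values of \<open>\<bar>u\<bar>\<close> at the height
  \<open>l = R powr (- 2 / 3)\<close>, for which both parts have the same growth in \<open>R\<close>.\<close>

lemma local_norm_growth:
  fixes u :: "real^3 \<Rightarrow> real^3"
  assumes u: "continuous_on UNIV u" and L: "(\<integral>\<^sup>+x. ennreal (norm (u x) powr (9/2)) \<partial>lborel) < \<infinity>"
    and m: "0 < m" "m < 9 / 2"
  shows "\<exists>K>0. \<forall>R>0. (\<integral>\<^sup>+x\<in>ball 0 R. ennreal (norm (u x) powr m) \<partial>lborel) \<le> ennreal (K * R powr (3 - 2 * m / 3))"
proof -
  have [measurable]: "u \<in> borel_measurable borel" by (rule borel_measurable_continuous_onI[OF u])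
  obtain N where N: "N \<ge> 0" "(\<integral>\<^sup>+x. ennreal (norm (u x) powr (9/2)) \<partial>lborel) = ennreal N"
    using L by (cases "(\<integral>\<^sup>+x. ennreal (norm (u x) powr (9/2)) \<partial>lborel)") auto
  define V where "V = measure lborel (ball (0::real^3) 1)"
  have V: "V > 0" unfolding V_def by (rule content_ball_pos) simp
  have "(\<integral>\<^sup>+x\<in>ball 0 R. ennreal (norm (u x) powr m) \<partial>lborel) \<le> ennreal ((N + V) * R powr (3 - 2 * m / 3))"
    if R: "R > 0" for R
  proof -
    define l where "l = R powr (- 2 / 3)"
    have l: "l > 0" using R by (simp add: l_def)
    have pw: "y powr m \<le> l powr (m - 9 / 2) * y powr (9 / 2) + l powr m" if "y \<ge> 0" for y
    proof (cases "y \<le> l")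
      case True
      then show ?thesis using that m by (intro add_increasing powr_mono2) auto
    next
      case False
      have "y powr m = y powr (m - 9 / 2) * y powr (9 / 2)" using False l by (simp flip: powr_add)
      also have "\<dots> \<le> l powr (m - 9 / 2) * y powr (9 / 2)"
        using False l m by (intro mult_right_mono powr_mono2') auto
      finally show ?thesis by (simp add: add_increasing2)
    qed
    have "(\<integral>\<^sup>+x\<in>ball 0 R. ennreal (norm (u x) powr m) \<partial>lborel)
        \<le> (\<integral>\<^sup>+x. ennreal (l powr (m - 9 / 2)) * ennreal (norm (u x) powr (9 / 2)) + ennreal (l powr m) * indicator (ball 0 R) x \<partial>lborel)"
    proof (rule nn_integral_mono)
      fix x :: "real^3"
      show "ennreal (norm (u x) powr m) * indicator (ball 0 R) x \<le>
         ennreal (l powr (m - 9 / 2)) * ennreal (norm (u x) powr (9 / 2)) + ennreal (l powr m) * indicator (ball 0 R) x"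
        using pw[of "norm (u x)"]
        by (auto split: split_indicator simp flip: ennreal_mult ennreal_plus intro!: ennreal_leI)
    qed
    also have "\<dots> = ennreal (l powr (m - 9 / 2)) * ennreal N + ennreal (l powr m) * emeasure lborel (ball (0::real^3) R)"
    proof -
      have "ball (0::real^3) R \<in> sets lborel" by simp
      note [measurable] = this
      show ?thesis
        by (subst nn_integral_add; (measurable; fail)?)
           (simp add: nn_integral_cmult_indicator nn_integral_cmult N(2))
    qed
    also have "emeasure lborel (ball (0::real^3) R) = ennreal (R ^ 3 * V)"
      unfolding V_def by (rule emeasure_ball_eq[OF R])
    also have "ennreal (l powr (m - 9 / 2)) * ennreal N + ennreal (l powr m) * ennreal (R ^ 3 * V) =
        ennreal (N * l powr (m - 9 / 2) + V * (R ^ 3 * l powr m))"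
      using N(1) V R by (simp flip: ennreal_mult ennreal_plus add: mult_ac)
    also have "l powr (m - 9 / 2) = R powr (3 - 2 * m / 3)"
    proof -
      have "- 2 / 3 * (m - 9 / 2) = 3 - 2 * m / 3" by (simp add: field_simps)
      then show ?thesis by (simp only: l_def powr_powr)
    qed
    also have "R ^ 3 * l powr m = R powr (3 - 2 * m / 3)"
    proof -
      have "R ^ 3 = R powr 3" using R by simp
      then have "R ^ 3 * l powr m = R powr (3 + (- 2 / 3) * m)" by (simp add: l_def powr_powr flip: powr_add)
      also have "3 + (- 2 / 3) * m = 3 - 2 * m / 3" by simp
      finally show ?thesis .
    qed
    finally show ?thesis by (simp add: distrib_right)
  qed
  then show ?thesis using N V by (intro exI[of _ "N + V"]) auto
qed

section \<open>A polynomial cutoff\<close>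

lemma C1_id: "C1 (\<lambda>x. x)" and pd_id: "pd i (\<lambda>x. x) x = axis i 1"
proof -
  have D: "((\<lambda>x::real^3. x) has_derivative (\<lambda>h. h)) (at x)" for x by (rule has_derivative_ident)
  show *: "pd i (\<lambda>x. x) x = axis i 1" for i x using pd_eqI[OF D] .
  show "C1 (\<lambda>x. x)" unfolding C1_def using D
    by (auto simp: differentiable_def * cong: continuous_on_cong)
qed

lemma
  fixes h h' :: "real \<Rightarrow> real" and s :: "real^3 \<Rightarrow> real"
  assumes h: "\<And>t. (h has_real_derivative h' t) (at t)" and h': "continuous_on UNIV h'" and s: "C1 s"
  shows C1_compose_real: "C1 (\<lambda>x. h (s x))"
    and pd_compose_real: "pd i (\<lambda>x. h (s x)) x = h' (s x) * pd i s x"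
proof -
  have D: "((\<lambda>x. h (s x)) has_derivative (\<lambda>v. frechet_derivative s (at x) v * h' (s x))) (at x)" for x
    using C1_differentiable[OF s, of x] by (intro DERIV_compose_FDERIV[OF h]) (simp add: frechet_derivative_works)
  show *: "pd i (\<lambda>x. h (s x)) x = h' (s x) * pd i s x" for i x
    using pd_eqI[OF D, of i x] by (simp add: pd_def)
  show "C1 (\<lambda>x. h (s x))" unfolding C1_def using D
    by (auto simp: differentiable_def * cong: continuous_on_cong
       intro!: continuous_on_mult[OF continuous_on_compose2[OF h' C1_cont[OF s]] C1_pd_cont[OF s]])
qed

lemma max0_power2_DERIV: "((\<lambda>s. (max 0 s)\<^sup>2) has_real_derivative 2 * max 0 s) (at (s::real))"
proof -
  consider "s < 0" | "s = 0" | "s > 0" by linarith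
  then show ?thesis
  proof cases
    case 1
    have "((\<lambda>s. (max 0 s)\<^sup>2) has_real_derivative 0) (at s)"
      by (rule has_field_derivative_transform_within_open[of "\<lambda>_. 0" _ _ "{..<0}"]) (use 1 in auto)
    then show ?thesis using 1 by simp
  next
    case 2
    have "((\<lambda>s. (max 0 s)\<^sup>2) has_real_derivative 0) (at s)"
      by (rule DERIV_zero_of_quadratic[of _ _ 1]) (auto simp: 2 max_def)
    then show ?thesis using 2 by simp
  next
    case 3
    have "((\<lambda>s::real. s\<^sup>2) has_real_derivative 2 * s) (at s)"
      by (auto intro!: derivative_eq_intros)
    then have "((\<lambda>s. (max 0 s)\<^sup>2) has_real_derivative 2 * s) (at s)"
      by (rule has_field_derivative_transform_within_open[of _ _ _ "{0<..}"]) (use 3 in auto)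
    then show ?thesis using 3 by simp
  qed
qed

lemma max0_power3_DERIV: "((\<lambda>s. (max 0 s) ^ 3) has_real_derivative 3 * (max 0 s)\<^sup>2) (at (s::real))"
proof -
  have "((\<lambda>s. s * (max 0 s)\<^sup>2) has_real_derivative 1 * (max 0 s)\<^sup>2 + 2 * max 0 s * s) (at s)"
    by (rule DERIV_mult'[THEN DERIV_cong, OF DERIV_ident max0_power2_DERIV]) simp
  moreover have "(\<lambda>s. s * (max 0 s)\<^sup>2) = (\<lambda>s::real. (max 0 s) ^ 3)"
    by (auto simp: fun_eq_iff max_def power3_eq_cube power2_eq_square)
  moreover have "1 * (max 0 s)\<^sup>2 + 2 * max 0 s * s = 3 * (max 0 s)\<^sup>2"
    by (auto simp: max_def power2_eq_square)
  ultimately show ?thesis by (simp only:)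
qed

text \<open>The cube of the positive part is twice continuously differentiable, which is all that the
  identities below ask of a cutoff, and its derivatives are explicit. It is not constant near the
  origin; a positive lower bound on the ball of half the radius replaces this.\<close>

definition cutarg :: "real \<Rightarrow> real^3 \<Rightarrow> real" where
  "cutarg R x = 1 - (1 / R\<^sup>2) * (x \<bullet> x)"

definition cutoff :: "real \<Rightarrow> real^3 \<Rightarrow> real" where
  "cutoff R x = (max 0 (cutarg R x)) ^ 3"

definition cutoff_grad :: "real \<Rightarrow> real^3 \<Rightarrow> real^3" where
  "cutoff_grad R x = (- (6 / R\<^sup>2) * (max 0 (cutarg R x))\<^sup>2) *\<^sub>R x"

lemma C1_cutarg: "C1 (cutarg R)"
  unfolding cutarg_def[abs_def] by (intro C1_minus C1_mult C1_const C1_inner C1_id)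

lemma pd_cutarg: "pd i (cutarg R) x = - (2 / R\<^sup>2) * x $ i"
proof -
  have i: "C1 (\<lambda>x::real^3. x \<bullet> x)" by (rule C1_inner[OF C1_id C1_id])
  have m: "C1 (\<lambda>x::real^3. (1 / R\<^sup>2) * (x \<bullet> x))" by (rule C1_mult[OF C1_const i])
  have "pd i (cutarg R) x = 0 - ((1 / R\<^sup>2) * (x \<bullet> axis i 1 + axis i 1 \<bullet> x) + 0 * (x \<bullet> x))"
    unfolding cutarg_def[abs_def]
    by (simp only: pd_diff[OF C1_differentiable[OF C1_const] C1_differentiable[OF m]] pd_mult[OF C1_differentiable[OF C1_const] C1_differentiable[OF i]]
        pd_inner[OF C1_differentiable[OF C1_id] C1_differentiable[OF C1_id]] pd_id pd_const)
  then show ?thesis by (simp add: inner_axis inner_axis')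
qed

lemma C1_cutoff: "C1 (cutoff R)"
  unfolding cutoff_def[abs_def]
  by (rule C1_compose_real[OF max0_power3_DERIV _ C1_cutarg]) (intro continuous_intros)

lemma pd_cutoff: "pd i (cutoff R) x = cutoff_grad R x $ i"
  unfolding cutoff_def[abs_def]
  by (subst pd_compose_real[OF max0_power3_DERIV _ C1_cutarg])
     (auto simp: pd_cutarg cutoff_grad_def intro!: continuous_intros)

lemma
  shows C1_cutoff_grad: "C1 (cutoff_grad R)"
    and pd_cutoff_grad: "pd j (cutoff_grad R) x = (- (6 / R\<^sup>2) * (max 0 (cutarg R x))\<^sup>2) *\<^sub>R axis j 1
        + ((24 / R ^ 4) * max 0 (cutarg R x) * x $ j) *\<^sub>R x"
proof -
  have c: "C1 (\<lambda>x. (max 0 (cutarg R x))\<^sup>2)"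
    by (rule C1_compose_real[OF max0_power2_DERIV _ C1_cutarg]) (intro continuous_intros)
  have pdc: "pd j (\<lambda>x. (max 0 (cutarg R x))\<^sup>2) x = 2 * max 0 (cutarg R x) * (- (2 / R\<^sup>2) * x $ j)"
    by (subst pd_compose_real[OF max0_power2_DERIV _ C1_cutarg])
       (auto simp: pd_cutarg intro!: continuous_intros)
  have c': "C1 (\<lambda>x. - (6 / R\<^sup>2) * (max 0 (cutarg R x))\<^sup>2)"
    by (rule C1_mult[OF C1_const c])
  show "C1 (cutoff_grad R)"
    unfolding cutoff_grad_def[abs_def] by (rule C1_scaleR[OF c' C1_id])
  have "pd j (cutoff_grad R) x = (- (6 / R\<^sup>2) * (max 0 (cutarg R x))\<^sup>2) *\<^sub>R axis j 1
        + (- (6 / R\<^sup>2) * (2 * max 0 (cutarg R x) * (- (2 / R\<^sup>2) * x $ j))) *\<^sub>R x"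
    unfolding cutoff_grad_def[abs_def]
    by (subst pd_scaleR[OF C1_differentiable[OF c'] C1_differentiable[OF C1_id]], subst pd_mult[OF C1_differentiable[OF C1_const] C1_differentiable[OF c]])
       (simp only: pd_id pdc pd_const mult_zero_left add_0_right)
  also have "- (6 / R\<^sup>2) * (2 * max 0 (cutarg R x) * (- (2 / R\<^sup>2) * x $ j)) = (24 / R ^ 4) * max 0 (cutarg R x) * x $ j"
    by (simp add: power4_eq_xxxx power2_eq_square)
  finally show "pd j (cutoff_grad R) x = (- (6 / R\<^sup>2) * (max 0 (cutarg R x))\<^sup>2) *\<^sub>R axis j 1
        + ((24 / R ^ 4) * max 0 (cutarg R x) * x $ j) *\<^sub>R x" .
qed

lemma cutarg_le_1: "cutarg R x \<le> 1"
  by (simp add: cutarg_def)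

lemma cutarg_nonpos: "0 < R \<Longrightarrow> R \<le> norm x \<Longrightarrow> cutarg R x \<le> 0"
  using power_mono[of R "norm x" 2] by (simp add: cutarg_def power2_norm_eq_inner field_simps)

lemma cutoff_outside:
  assumes "0 < R" "R \<le> norm x"
  shows "cutoff R x = 0" "cutoff_grad R x = 0" "pd j (cutoff_grad R) x = 0"
  using cutarg_nonpos[OF assms] by (simp_all add: cutoff_def cutoff_grad_def pd_cutoff_grad max_absorb1)

lemma cutoff_nonneg: "0 \<le> cutoff R x"
  by (simp add: cutoff_def)

lemma cutoff_inside:
  assumes "0 < R" "2 * norm x \<le> R" shows "27 / 64 \<le> cutoff R x"
proof -
  have "(2 * norm x)\<^sup>2 \<le> R\<^sup>2" using assms by (intro power_mono) auto
  then have "3 / 4 \<le> cutarg R x"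
    using assms by (simp add: cutarg_def field_simps power_mult_distrib power2_norm_eq_inner)
  then have "(3 / 4) ^ 3 \<le> cutoff R x" unfolding cutoff_def by (intro power_mono) auto
  then show ?thesis by (simp add: power3_eq_cube)
qed

lemma norm_cutoff_grad_le:
  assumes R: "0 < R" shows "norm (cutoff_grad R x) \<le> 6 / R"
proof (cases "norm x \<le> R")
  case True
  have "norm (cutoff_grad R x) = 6 / R\<^sup>2 * (max 0 (cutarg R x))\<^sup>2 * norm x"
    by (simp add: cutoff_grad_def abs_mult)
  also have "\<dots> \<le> 6 / R\<^sup>2 * 1 * R"
    using True R cutarg_le_1[of R x] by (intro mult_mono power_le_one) auto
  finally show ?thesis using R by (simp add: power2_eq_square)
next
  case False
  then show ?thesis using R cutoff_outside(2)[of R x] by simp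
qed

lemma norm_pd_cutoff_grad_le:
  assumes R: "0 < R" shows "norm (pd j (cutoff_grad R) x) \<le> 30 / R\<^sup>2"
proof (cases "norm x \<le> R")
  case True
  have "norm (pd j (cutoff_grad R) x) \<le> norm ((- (6 / R\<^sup>2) * (max 0 (cutarg R x))\<^sup>2) *\<^sub>R axis j (1::real) :: real^3)
      + norm (((24 / R ^ 4) * max 0 (cutarg R x) * x $ j) *\<^sub>R x)"
    unfolding pd_cutoff_grad by (rule norm_triangle_ineq)
  also have "\<dots> = 6 / R\<^sup>2 * (max 0 (cutarg R x))\<^sup>2 + (24 / R ^ 4) * max 0 (cutarg R x) * (\<bar>x $ j\<bar> * norm x)"
    using R by (simp add: abs_mult norm_axis_1)
  also have "\<dots> \<le> 6 / R\<^sup>2 * 1 + (24 / R ^ 4) * 1 * (R * R)"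
    using True R cutarg_le_1[of R x] component_le_norm_cart[of x j]
    by (intro add_mono mult_mono power_le_one) auto
  also have "\<dots> = 30 / R\<^sup>2" using R by (simp add: power2_eq_square power4_eq_xxxx)
  finally show ?thesis .
next
  case False
  then show ?thesis using R cutoff_outside(3)[of R x] by simp
qed

lemma csupp_cutoff: "0 < R \<Longrightarrow> csupp (cutoff R)" and csupp_cutoff_grad: "0 < R \<Longrightarrow> csupp (cutoff_grad R)"
  using cutoff_outside unfolding csupp_def by blast+

section \<open>The vorticity form of the equations\<close>

lemma grad_eq: "grad P x = (\<Sum>i\<in>UNIV. pd i P x *\<^sub>R axis i 1)"
  by (simp add: grad_def vec_eq_iff forall_3 sum_3 axis_def)

lemma C1_grad: "C2 P \<Longrightarrow> C1 (grad P)"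
  unfolding grad_eq[abs_def] by (intro C1_sum C1_scaleR C1_const C2_pd)

lemma curl_grad: assumes P: "C2 P" shows "curl (grad P) x = 0"
proof -
  have "pd i (grad P) x $ j = pd i (pd j P) x" for i j
  proof -
    have "pd i (grad P) x $ j = pd i (\<lambda>x. grad P x $ j) x"
      by (rule pd_component[symmetric, OF C1_differentiable[OF C1_grad[OF P]]])
    then show ?thesis by (simp add: grad_def)
  qed
  then show ?thesis by (simp add: curl_def vec_eq_iff forall_3 pd_commute[OF P, of 3 2] pd_commute[OF P, of 3 1] pd_commute[OF P, of 2 1])
qed

lemma pd_commute_vec:
  fixes u :: "real^3 \<Rightarrow> real^3"
  assumes u: "C2 u" shows "pd i (pd j u) x = pd j (pd i u) x"
proof -
  have c: "pd i (\<lambda>x. u x $ k) = (\<lambda>x. pd i u x $ k)" for i k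
    by (rule ext, rule pd_component[OF C1_differentiable[OF C2_C1[OF u]]])
  have cc: "pd j (pd i (\<lambda>x. u x $ k)) x = pd j (pd i u) x $ k" for i j k
    unfolding c by (rule pd_component[OF C1_differentiable[OF C2_pd[OF u]]])
  have "C2 (\<lambda>x. u x $ k)" for k
    unfolding C2_def c using u by (auto intro: C1_component C2_C1 C2_pd)
  from pd_commute[OF this, of i j _ x] have "pd i (pd j u) x $ k = pd j (pd i u) x $ k" for k unfolding cc .
  then show ?thesis by (simp add: vec_eq_iff)
qed

lemma pd_curl: "C2 u \<Longrightarrow> pd i (curl u) x = (\<Sum>j\<in>UNIV. cross3 (axis j 1) (pd i (pd j u) x))"
proof -
  assume u: "C2 u"
  have "C1 (\<lambda>x. cross3 (axis j 1) (pd j u x))" for j by (rule C1_cross[OF C1_const C2_pd[OF u]])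
  then show ?thesis unfolding curl_eq[abs_def]
    by (subst pd_sum) (auto simp: C1_differentiable pd_cross C1_differentiable[OF C2_pd[OF u]] C1_differentiable[OF C1_const])
qed

lemma curl_curl:
  assumes u: "C2 u" and div: "\<And>x. divergence u x = 0"
  shows "curl (curl u) x = - laplacian u x"
proof -
  have d: "pd k (pd 1 u) x $ 1 + pd k (pd 2 u) x $ 2 + pd k (pd 3 u) x $ 3 = 0" for k
  proof -
    have "divergence u = (\<lambda>x. \<Sum>i\<in>UNIV. pd i u x $ i)" by (simp add: divergence_def fun_eq_iff)
    then have "pd k (divergence u) x = (\<Sum>i\<in>UNIV. pd k (pd i u) x $ i)"
      by (simp add: pd_sum C1_differentiable[OF C1_component[OF C2_pd[OF u]]] pd_component C1_differentiable[OF C2_pd[OF u]])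
    moreover have "divergence u = (\<lambda>x. 0)" using div by auto
    ultimately show ?thesis by (simp add: sum_3)
  qed
  have s: "pd 2 (pd 1 u) x = pd 1 (pd 2 u) x" "pd 3 (pd 1 u) x = pd 1 (pd 3 u) x" "pd 3 (pd 2 u) x = pd 2 (pd 3 u) x"
    by (rule pd_commute_vec[OF u])+
  show ?thesis
    using d[of 1] d[of 2] d[of 3]
    unfolding curl_eq[of "curl u"] pd_curl[OF u] laplacian_def
    by (simp add: vec_eq_iff forall_3 sum_3 cross_components axis_def s)
qed

text \<open>The convection term equals \<open>curl u \<times> u\<close> plus the gradient of half the squared speed, and the Laplacian is
  minus the double curl; \<open>P\<close> is the total head pressure.\<close>

lemma vorticity_form:
  assumes "D_solution u"
  shows "\<exists>P. C2 P \<and> (\<forall>x. curl (curl u) x + cross3 (curl u x) (u x) + grad P x = 0)"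
proof -
  note d = assms[unfolded D_solution_def]
  have u: "C2 u" by (rule D_solution_C2[OF assms])
  note u1 = C2_C1[OF u]
  obtain p where p: "smooth p" "\<And>x. - laplacian u x + convection u x + grad p x = 0" using d by blast
  define q where "q x = (1 / 2) * (u x \<bullet> u x)" for x
  have q1: "C1 q" unfolding q_def by (intro C1_mult C1_const C1_inner u1)
  have pdq: "pd i q x = u x \<bullet> pd i u x" for i x
  proof -
    have "pd i q x = (1 / 2) * (u x \<bullet> pd i u x + pd i u x \<bullet> u x) + 0 * (u x \<bullet> u x)"
      unfolding q_def
      by (simp only: pd_mult[OF C1_differentiable[OF C1_const] C1_differentiable[OF C1_inner[OF u1 u1]]] pd_inner[OF C1_differentiable[OF u1] C1_differentiable[OF u1]] pd_const)
    then show ?thesis by (simp add: inner_commute)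
  qed
  have q2: "C2 q" unfolding C2_def using q1 by (auto simp: pdq[abs_def] intro!: C1_inner u1 C2_pd[OF u])
  have p2: "C2 p" by (rule smooth_C2[OF p(1)])
  have pdP: "pd i (\<lambda>x. p x + q x) x = pd i p x + pd i q x" for i x
    by (rule pd_add[OF C1_differentiable[OF C2_C1[OF p2]] C1_differentiable[OF q1]])
  have "C2 (\<lambda>x. p x + q x)"
    unfolding C2_def pdP[abs_def]
    by (intro conjI allI C1_add C2_C1[OF p2] C2_pd[OF p2] q1 C2_pd[OF q2])
  moreover have "curl (curl u) x + cross3 (curl u x) (u x) + grad (\<lambda>x. p x + q x) x = 0" for x
  proof -
    have "convection u x = cross3 (curl u x) (u x) + grad q x"
      unfolding convection_def curl_eq grad_eq pdq
      by (simp add: vec_eq_iff forall_3 sum_3 cross_components axis_def inner_vec_def algebra_simps)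
    moreover have "grad (\<lambda>x. p x + q x) x = grad p x + grad q x"
      unfolding grad_eq pdP by (simp add: scaleR_add_left sum.distrib)
    ultimately show ?thesis
      using p(2)[of x] curl_curl[OF u, of x] d by (simp add: algebra_simps)
  qed
  ultimately show ?thesis by blast
qed

section \<open>The localised enstrophy identity\<close>

lemma curl_scaleR:
  assumes "C1 c" "C1 f"
  shows "curl (\<lambda>x. c x *\<^sub>R f x) x = c x *\<^sub>R curl f x + cross3 (grad c x) (f x)"
  unfolding curl_eq grad_eq
  by (simp add: pd_scaleR C1_differentiable assms sum_3 cross_add_right cross_add_left cross_mult_right cross_mult_left algebra_simps)

lemma curl_add: "C1 f \<Longrightarrow> C1 g \<Longrightarrow> curl (\<lambda>x. f x + g x) x = curl f x + curl g x"
  unfolding curl_eq by (simp add: pd_add C1_differentiable cross_add_right sum.distrib)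

lemma grad_cutoff: "grad (cutoff R) x = cutoff_grad R x"
  by (simp add: grad_def pd_cutoff vec_eq_iff)

text \<open>Testing with \<open>w = curl (\<phi> \<Psi>) = \<phi> u + v\<close> removes \<open>P\<close>, because a gradient is orthogonal to every compactly supported curl.
  The part \<open>\<phi> u\<close> of \<open>w\<close> is orthogonal to \<open>curl u \<times> u\<close>, so the nonlinearity only meets \<open>v\<close>,
  which carries a derivative of the cutoff.\<close>

lemma enstrophy_identity:
  assumes u: "C2 u" and P: "C2 P"
    and mom: "\<And>x. curl (curl u) x + cross3 (curl u x) (u x) + grad P x = 0"
    and \<Psi>: "C1 \<Psi>" "\<And>x. curl \<Psi> x = u x" and R: "R > 0"
  defines "v \<equiv> (\<lambda>x. cross3 (cutoff_grad R x) (\<Psi> x))"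
  shows "(\<integral>x. cutoff R x * (curl u x \<bullet> curl u x) \<partial>lborel) =
    (\<integral>x. - (curl u x \<bullet> cross3 (cutoff_grad R x) (u x) + curl u x \<bullet> curl v x + cross3 (curl u x) (u x) \<bullet> v x) \<partial>lborel)"
proof -
  note u1 = C2_C1[OF u]
  define w where "w x = cutoff R x *\<^sub>R u x + v x" for x
  define \<eta> where "\<eta> x = cutoff R x *\<^sub>R \<Psi> x" for x
  have v: "C1 v" "csupp v"
    unfolding v_def by (intro C1_cross C1_cutoff_grad \<Psi>)
      (intro csupp_bilinear_left[OF bounded_bilinear_cross3] csupp_cutoff_grad R)
  have \<eta>: "C1 \<eta>" "csupp \<eta>"
    unfolding \<eta>_def by (intro C1_scaleR C1_cutoff \<Psi>)
      (intro csupp_bilinear_left[OF bounded_bilinear_scaleR] csupp_cutoff R)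
  have cu: "C1 (\<lambda>x. cutoff R x *\<^sub>R u x)" by (intro C1_scaleR C1_cutoff u1)
  have w: "C1 w" unfolding w_def by (intro C1_add cu v)
  have curl_\<eta>: "curl \<eta> x = w x" for x
    unfolding \<eta>_def w_def v_def by (simp add: curl_scaleR C1_cutoff \<Psi> grad_cutoff)
  have ws: "csupp w" using csupp_curl[OF \<eta>(2)] by (simp add: curl_\<eta>[abs_def])
  have curl_w: "curl w x = cutoff R x *\<^sub>R curl u x + cross3 (cutoff_grad R x) (u x) + curl v x" for x
    unfolding w_def using curl_add[OF cu v(1), of x] by (simp add: curl_scaleR C1_cutoff u1 grad_cutoff)
  note [continuous_intros] = C1_cont continuous_on_curl continuous_on_cross
  have wcs: "csupp (\<lambda>x. f x \<bullet> w x)" "csupp (\<lambda>x. f x \<bullet> curl w x)" for f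
    by (intro csupp_bilinear_right[OF bounded_bilinear_inner] csupp_curl ws)+
  have i1: "integrable lborel (\<lambda>x. curl (curl u) x \<bullet> w x)"
    by (intro csupp_integrable wcs continuous_intros C1_curl u w)
  have i2: "integrable lborel (\<lambda>x. cross3 (curl u x) (u x) \<bullet> w x)"
    by (intro csupp_integrable wcs continuous_intros C1_curl u u1 w)
  have i3: "integrable lborel (\<lambda>x. grad P x \<bullet> w x)"
    by (intro csupp_integrable wcs continuous_intros C1_grad P w)
  have i4: "integrable lborel (\<lambda>x. curl u x \<bullet> curl w x)"
    by (intro csupp_integrable wcs continuous_intros C1_curl u u1 w)
  have "(\<integral>x. grad P x \<bullet> w x \<partial>lborel) = 0"
    using integral_curl_by_parts[OF C1_grad[OF P] \<eta>] by (simp add: curl_\<eta> curl_grad[OF P])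
  moreover have "(\<integral>x. curl (curl u) x \<bullet> w x \<partial>lborel) = (\<integral>x. curl u x \<bullet> curl w x \<partial>lborel)"
    by (rule integral_curl_by_parts[symmetric, OF C1_curl[OF u] w ws])
  moreover have "(\<integral>x. curl (curl u) x \<bullet> w x + cross3 (curl u x) (u x) \<bullet> w x + grad P x \<bullet> w x \<partial>lborel) = 0"
    by (simp add: mom flip: inner_add_left)
  ultimately have z: "(\<integral>x. curl u x \<bullet> curl w x + cross3 (curl u x) (u x) \<bullet> w x \<partial>lborel) = 0"
    using i1 i2 i3 i4 by simp
  define rest where "rest x = curl u x \<bullet> cross3 (cutoff_grad R x) (u x) + curl u x \<bullet> curl v x + cross3 (curl u x) (u x) \<bullet> v x" for x
  have sp: "curl u x \<bullet> curl w x + cross3 (curl u x) (u x) \<bullet> w x = cutoff R x * (curl u x \<bullet> curl u x) + rest x" for x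
    unfolding curl_w w_def rest_def by (simp add: inner_add_right dot_cross_self)
  have i5: "integrable lborel (\<lambda>x. cutoff R x * (curl u x \<bullet> curl u x))"
    by (intro csupp_integrable continuous_intros C1_cutoff u1 csupp_bilinear_left[OF bounded_bilinear_mult] csupp_cutoff R)
  have i6: "integrable lborel rest"
    using Bochner_Integration.integrable_diff[OF Bochner_Integration.integrable_add[OF i4 i2] i5]
    unfolding sp by simp
  from z have "(\<integral>x. cutoff R x * (curl u x \<bullet> curl u x) \<partial>lborel) + (\<integral>x. rest x \<partial>lborel) = 0"
    unfolding sp using i5 i6 by simp
  then show ?thesis unfolding rest_def[symmetric] by simp
qed

text \<open>The squares, up to constants, of the factors that multiply the vorticity on the right-hand side of the
  enstrophy identity.\<close>

definition energy_density :: "real \<Rightarrow> (real^3 \<Rightarrow> real^3) \<Rightarrow> (real^3 \<Rightarrow> real^3) \<Rightarrow> real^3 \<Rightarrow> real" where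
  "energy_density R u \<Psi> x = (norm (u x))\<^sup>2 / R\<^sup>2 + (norm (\<Psi> x))\<^sup>2 / R ^ 4 + 3 * grad_norm2 \<Psi> x / R\<^sup>2
      + (norm (u x))\<^sup>2 * (norm (\<Psi> x))\<^sup>2 / R\<^sup>2"

text \<open>Every term on the right-hand side of the enstrophy identity contains the vorticity linearly, apart from factors
  that live on the ball of radius \<open>R\<close>; the Cauchy-Schwarz inequality separates the two.\<close>

lemma enstrophy_bound:
  assumes u: "C2 u" and P: "C2 P"
    and mom: "\<And>x. curl (curl u) x + cross3 (curl u x) (u x) + grad P x = 0"
    and \<Psi>: "C1 \<Psi>" "\<And>x. curl \<Psi> x = u x" and R: "R > 0"
  shows "(\<integral>\<^sup>+x. ennreal (cutoff R x * (norm (curl u x))\<^sup>2) \<partial>lborel)\<^sup>2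
     \<le> (\<integral>\<^sup>+x. ennreal ((norm (curl u x))\<^sup>2) \<partial>lborel) *
       (ennreal 32400 * (\<integral>\<^sup>+x\<in>ball 0 R. ennreal (energy_density R u \<Psi> x) \<partial>lborel))"
proof -
  note u1 = C2_C1[OF u]
  define v where "v = (\<lambda>x. cross3 (cutoff_grad R x) (\<Psi> x))"
  have v: "C1 v" unfolding v_def by (intro C1_cross C1_cutoff_grad \<Psi>)
  define rest where "rest x = - (curl u x \<bullet> cross3 (cutoff_grad R x) (u x) + curl u x \<bullet> curl v x + cross3 (curl u x) (u x) \<bullet> v x)" for x
  define F where "F x = indicator (ball 0 R) x * (6 / R * norm (u x) + 90 / R\<^sup>2 * norm (\<Psi> x)
     + 6 / R * (\<Sum>i\<in>UNIV. norm (pd i \<Psi> x)) + 6 / R * (norm (u x) * norm (\<Psi> x)))" for x :: "real^3"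
  note [continuous_intros] = C1_cont C1_pd_cont continuous_on_curl continuous_on_cross
  have [measurable]: "u \<in> borel_measurable borel" "\<Psi> \<in> borel_measurable borel"
    "curl u \<in> borel_measurable borel" "\<And>i. pd i \<Psi> \<in> borel_measurable borel" "rest \<in> borel_measurable borel"
    unfolding rest_def[abs_def]
    by (intro borel_measurable_continuous_onI continuous_intros u1 \<Psi> v C1_cutoff_grad)+
  have "ball (0::real^3) R \<in> sets borel" by simp
  note [measurable] = this
  have [measurable]: "F \<in> borel_measurable borel" unfolding F_def by measurable
  have F0: "0 \<le> F x" for x
    unfolding F_def using R by (intro mult_nonneg_nonneg add_nonneg_nonneg sum_nonneg) auto
  have eq: "pd i v x = cross3 (cutoff_grad R x) (pd i \<Psi> x) + cross3 (pd i (cutoff_grad R) x) (\<Psi> x)" for i x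
    unfolding v_def by (rule pd_cross[OF C1_differentiable[OF C1_cutoff_grad] C1_differentiable[OF \<Psi>(1)]])
  have rest_le: "\<bar>rest x\<bar> \<le> norm (curl u x) * F x" for x
  proof (cases "x \<in> ball 0 R")
    case True
    have pdv: "norm (pd i v x) \<le> 6 / R * norm (pd i \<Psi> x) + 30 / R\<^sup>2 * norm (\<Psi> x)" for i
    proof -
      have "norm (pd i v x) \<le> norm (cutoff_grad R x) * norm (pd i \<Psi> x) + norm (pd i (cutoff_grad R) x) * norm (\<Psi> x)"
        unfolding eq using norm_triangle_ineq[of "cross3 (cutoff_grad R x) (pd i \<Psi> x)" "cross3 (pd i (cutoff_grad R) x) (\<Psi> x)"]
          norm_cross3_le[of "cutoff_grad R x" "pd i \<Psi> x"] norm_cross3_le[of "pd i (cutoff_grad R) x" "\<Psi> x"] by linarith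
      also have "\<dots> \<le> 6 / R * norm (pd i \<Psi> x) + 30 / R\<^sup>2 * norm (\<Psi> x)"
        by (intro add_mono mult_right_mono norm_cutoff_grad_le norm_pd_cutoff_grad_le R norm_ge_zero)
      finally show ?thesis .
    qed
    have cv: "norm (curl v x) \<le> 6 / R * (\<Sum>i\<in>UNIV. norm (pd i \<Psi> x)) + 90 / R\<^sup>2 * norm (\<Psi> x)"
      using norm_curl_le[of v x] pdv[of 1] pdv[of 2] pdv[of 3] by (simp add: sum_3 distrib_left)
    have a1: "\<bar>curl u x \<bullet> cross3 (cutoff_grad R x) (u x)\<bar> \<le> norm (curl u x) * (6 / R * norm (u x))"
      by (intro order_trans[OF Cauchy_Schwarz_ineq2] mult_left_mono order_trans[OF norm_cross3_le]
          mult_right_mono norm_cutoff_grad_le R norm_ge_zero)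
    have a2: "\<bar>curl u x \<bullet> curl v x\<bar> \<le> norm (curl u x) * (6 / R * (\<Sum>i\<in>UNIV. norm (pd i \<Psi> x)) + 90 / R\<^sup>2 * norm (\<Psi> x))"
      by (intro order_trans[OF Cauchy_Schwarz_ineq2] mult_left_mono cv norm_ge_zero)
    have "\<bar>cross3 (curl u x) (u x) \<bullet> v x\<bar> \<le> (norm (curl u x) * norm (u x)) * (6 / R * norm (\<Psi> x))"
      unfolding v_def
      by (intro order_trans[OF Cauchy_Schwarz_ineq2] mult_mono order_trans[OF norm_cross3_le] mult_right_mono
          norm_cutoff_grad_le R norm_ge_zero order_refl mult_nonneg_nonneg)
    then have a3: "\<bar>cross3 (curl u x) (u x) \<bullet> v x\<bar> \<le> norm (curl u x) * (6 / R * (norm (u x) * norm (\<Psi> x)))"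
      by (simp add: mult_ac)
    have "\<bar>rest x\<bar> \<le> norm (curl u x) * (6 / R * norm (u x)) + norm (curl u x) * (6 / R * (\<Sum>i\<in>UNIV. norm (pd i \<Psi> x)) + 90 / R\<^sup>2 * norm (\<Psi> x))
       + norm (curl u x) * (6 / R * (norm (u x) * norm (\<Psi> x)))"
      unfolding rest_def using a1 a2 a3 by linarith
    also have "\<dots> = norm (curl u x) * F x"
      unfolding F_def using True by (simp add: distrib_left)
    finally show ?thesis .
  next
    case False
    then have o: "R \<le> norm x" by simp
    have vx: "v x = 0" "pd i v x = 0" for i
      unfolding eq by (simp_all add: v_def cutoff_outside[OF R o])
    have "curl v x = 0" unfolding curl_eq by (simp add: vx)
    then show ?thesis by (simp add: rest_def vx cutoff_outside[OF R o] F0)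
  qed
  have sq: "norm (curl u x) ^ 2 = curl u x \<bullet> curl u x" for x by (simp add: power2_norm_eq_inner)
  have i5: "integrable lborel (\<lambda>x. cutoff R x * (norm (curl u x))\<^sup>2)"
    by (intro csupp_integrable continuous_intros C1_cutoff u1 csupp_bilinear_left[OF bounded_bilinear_mult] csupp_cutoff R)
  have "(\<integral>\<^sup>+x. ennreal (cutoff R x * (norm (curl u x))\<^sup>2) \<partial>lborel) = ennreal (\<integral>x. cutoff R x * (norm (curl u x))\<^sup>2 \<partial>lborel)"
    by (rule nn_integral_eq_integral[OF i5]) (simp add: cutoff_nonneg)
  also have "(\<integral>x. cutoff R x * (norm (curl u x))\<^sup>2 \<partial>lborel) = (\<integral>x. rest x \<partial>lborel)"
    using enstrophy_identity[OF u P mom \<Psi> R] unfolding sq rest_def v_def .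
  also have "ennreal (\<integral>x. rest x \<partial>lborel) \<le> (\<integral>\<^sup>+x. ennreal (norm (curl u x)) * ennreal (F x) \<partial>lborel)"
  proof (cases "integrable lborel rest")
    case True
    have "ennreal (\<integral>x. rest x \<partial>lborel) \<le> ennreal (norm (\<integral>x. rest x \<partial>lborel))" by (intro ennreal_leI) simp
    also have "\<dots> \<le> (\<integral>\<^sup>+x. norm (rest x) \<partial>lborel)" by (rule integral_norm_bound_ennreal[OF True])
    also have "\<dots> \<le> (\<integral>\<^sup>+x. ennreal (norm (curl u x)) * ennreal (F x) \<partial>lborel)"
      using rest_le F0 by (intro nn_integral_mono) (simp flip: ennreal_mult add: ennreal_leI)
    finally show ?thesis .
  qed (simp add: not_integrable_integral_eq)
  finally have "(\<integral>\<^sup>+x. ennreal (cutoff R x * (norm (curl u x))\<^sup>2) \<partial>lborel)\<^sup>2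
      \<le> (\<integral>\<^sup>+x. ennreal (norm (curl u x)) * ennreal (F x) \<partial>lborel)\<^sup>2"
    by (intro power_mono) auto
  also have "\<dots> \<le> (\<integral>\<^sup>+x. (ennreal (norm (curl u x)))\<^sup>2 \<partial>lborel) * (\<integral>\<^sup>+x. (ennreal (F x))\<^sup>2 \<partial>lborel)"
    by (rule Cauchy_Schwarz_nn_integral) measurable
  also have "(\<integral>\<^sup>+x. (ennreal (norm (curl u x)))\<^sup>2 \<partial>lborel) = (\<integral>\<^sup>+x. ennreal ((norm (curl u x))\<^sup>2) \<partial>lborel)"
    by (simp add: ennreal_power)
  also have "(\<integral>\<^sup>+x. (ennreal (F x))\<^sup>2 \<partial>lborel) \<le> (\<integral>\<^sup>+x. ennreal 32400 * (ennreal (energy_density R u \<Psi> x) * indicator (ball 0 R) x) \<partial>lborel)"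
  proof (rule nn_integral_mono)
    fix x :: "real^3"
    show "(ennreal (F x))\<^sup>2 \<le> ennreal 32400 * (ennreal (energy_density R u \<Psi> x) * indicator (ball 0 R) x)"
    proof (cases "x \<in> ball 0 R")
      case True
      define a b c d where "a = norm (u x) / R" and "b = norm (\<Psi> x) / R\<^sup>2"
        and "c = (\<Sum>i\<in>UNIV. norm (pd i \<Psi> x)) / R" and "d = norm (u x) * norm (\<Psi> x) / R"
      have nn: "a \<ge> 0" "b \<ge> 0" "c \<ge> 0" "d \<ge> 0" using R by (auto simp: a_def b_def c_def d_def sum_nonneg)
      have "F x = 6 * a + 90 * b + 6 * c + 6 * d" using True by (simp add: F_def a_def b_def c_def d_def)
      also have "\<dots> \<le> 90 * (a + b + c + d)" using nn by simp
      finally have "(F x)\<^sup>2 \<le> (90 * (a + b + c + d))\<^sup>2" by (intro power_mono F0)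
      also have "\<dots> \<le> 32400 * (a\<^sup>2 + b\<^sup>2 + c\<^sup>2 + d\<^sup>2)"
        using sum_squares_bound[of a b] sum_squares_bound[of a c] sum_squares_bound[of a d]
          sum_squares_bound[of b c] sum_squares_bound[of b d] sum_squares_bound[of c d]
        by (simp add: power2_eq_square algebra_simps)
      also have "\<dots> \<le> 32400 * energy_density R u \<Psi> x"
      proof -
        have "c\<^sup>2 \<le> 3 * grad_norm2 \<Psi> x / R\<^sup>2"
          unfolding c_def power_divide by (intro divide_right_mono sum_norm_pd_le) simp
        then show ?thesis
          unfolding energy_density_def a_def b_def d_def
          by (simp add: power_divide power_mult_distrib flip: power_mult)
      qed
      finally show ?thesis using True F0
        by (simp add: ennreal_power flip: ennreal_mult' del: ennreal_numeral add: ennreal_leI)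
    qed (simp add: F_def)
  qed
  also have "\<dots> = ennreal 32400 * (\<integral>\<^sup>+x\<in>ball 0 R. ennreal (energy_density R u \<Psi> x) \<partial>lborel)"
    unfolding energy_density_def grad_norm2_def by (rule nn_integral_cmult) measurable
  finally show ?thesis by (simp add: mult_left_mono)
qed

section \<open>The energy density is small on large balls\<close>

text \<open>Bundling measurability and nonnegativity with the bound makes the predicate stable under nonnegative
  linear combinations.\<close>

definition local_bound :: "real \<Rightarrow> (real^3 \<Rightarrow> real) \<Rightarrow> real \<Rightarrow> bool" where
  "local_bound R f b \<longleftrightarrow> f \<in> borel_measurable borel \<and> (\<forall>x. 0 \<le> f x) \<and> 0 \<le> b \<and>
     (\<integral>\<^sup>+x\<in>ball 0 R. ennreal (f x) \<partial>lborel) \<le> ennreal b"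

lemma ball_borel [measurable]: "ball (x::'a::euclidean_space) R \<in> sets borel"
  by simp

lemma local_bound_add:
  assumes "local_bound R f a" "local_bound R g b"
  shows "local_bound R (\<lambda>x. f x + g x) (a + b)"
proof -
  have [measurable]: "f \<in> borel_measurable borel" "g \<in> borel_measurable borel"
    using assms by (auto simp: local_bound_def)
  have "(\<integral>\<^sup>+x\<in>ball 0 R. ennreal (f x + g x) \<partial>lborel) =
      (\<integral>\<^sup>+x. ennreal (f x) * indicator (ball 0 R) x + ennreal (g x) * indicator (ball 0 R) x \<partial>lborel)"
    using assms by (intro nn_integral_cong) (simp add: local_bound_def distrib_right)
  also have "\<dots> = (\<integral>\<^sup>+x\<in>ball 0 R. ennreal (f x) \<partial>lborel) + (\<integral>\<^sup>+x\<in>ball 0 R. ennreal (g x) \<partial>lborel)"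
    by (rule nn_integral_add) measurable
  also have "\<dots> \<le> ennreal a + ennreal b"
    using assms by (intro add_mono) (simp_all add: local_bound_def)
  finally show ?thesis using assms by (simp add: local_bound_def)
qed

lemma local_bound_cmult:
  assumes "local_bound R f a" "0 \<le> c"
  shows "local_bound R (\<lambda>x. c * f x) (c * a)"
proof -
  have [measurable]: "f \<in> borel_measurable borel" using assms by (auto simp: local_bound_def)
  have "(\<integral>\<^sup>+x\<in>ball 0 R. ennreal (c * f x) \<partial>lborel) = (\<integral>\<^sup>+x. ennreal c * (ennreal (f x) * indicator (ball 0 R) x) \<partial>lborel)"
    using assms by (intro nn_integral_cong) (simp add: local_bound_def ennreal_mult mult.assoc)
  also have "\<dots> = ennreal c * (\<integral>\<^sup>+x\<in>ball 0 R. ennreal (f x) \<partial>lborel)"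
    by (rule nn_integral_cmult) measurable
  also have "\<dots> \<le> ennreal c * ennreal a"
    using assms by (intro mult_left_mono) (simp_all add: local_bound_def)
  finally show ?thesis using assms by (simp add: local_bound_def ennreal_mult)
qed

lemma error_potential_bounds:
  assumes u: "C1 u" and r: "0 < r" and R: "r \<le> R"
    and D: "(\<integral>\<^sup>+x. ennreal (grad_norm2 u x) \<partial>lborel) \<le> ennreal E" "E \<ge> 0"
    and b2: "local_bound (2 * R) (\<lambda>x. (norm (u x))\<^sup>2) B2"
    and b4: "local_bound (2 * R) (\<lambda>x. norm (u x) ^ 4) B4"
  shows "local_bound R (\<lambda>x. (norm (error_potential r u x))\<^sup>2) (r\<^sup>2 * B2)"
    and "local_bound R (\<lambda>x. norm (error_potential r u x) ^ 4) (r ^ 4 * B4)"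
    and "local_bound R (grad_norm2 (error_potential r u)) (r\<^sup>2 * E)"
proof -
  define G where "G = error_potential r u"
  have G: "C1 G" unfolding G_def by (rule C1_error_potential[OF u r])
  interpret m: finite_measure "mu r" by (rule finite_measureI) (simp add: emeasure_mu_space r)
  have [measurable]: "u \<in> borel_measurable borel" "\<And>i. pd i u \<in> borel_measurable borel"
    "G \<in> borel_measurable borel" "\<And>i. pd i G \<in> borel_measurable borel"
    using u G by (auto intro!: borel_measurable_continuous_onI C1_cont C1_pd_cont)
  have Gm [measurable]: "grad_norm2 G \<in> borel_measurable borel" unfolding grad_norm2_def by measurable
  have sub: "(\<integral>\<^sup>+x\<in>ball 0 (R + r). h x \<partial>lborel) \<le> (\<integral>\<^sup>+x\<in>ball 0 (2 * R). h x \<partial>lborel)" for h :: "real^3 \<Rightarrow> ennreal"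
    using R by (intro nn_integral_mono mult_left_mono) (auto split: split_indicator)
  have le: "ennreal (norm (G x)) \<le> ennreal r * (mean r (\<lambda>x. ennreal (norm (u x))) x)" for x
    unfolding G_def by (rule norm_error_potential_le[OF u r])
  have pw: "ennreal (norm (G x) ^ k) \<le> ennreal (r ^ k) * (mean r (\<lambda>x. ennreal (norm (u x))) x) ^ k" for x k
    using power_mono[OF le zero_le, of x k] r by (simp add: power_mult_distrib ennreal_power)
  have "(\<integral>\<^sup>+x\<in>ball 0 R. ennreal ((norm (G x))\<^sup>2) \<partial>lborel)
     \<le> (\<integral>\<^sup>+x. ennreal (r\<^sup>2) * ((mean r (\<lambda>x. ennreal (norm (u x))) x)\<^sup>2 * indicator (ball 0 R) x) \<partial>lborel)"
    using pw[of _ 2] by (intro nn_integral_mono) (auto split: split_indicator)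
  also have "\<dots> = ennreal (r\<^sup>2) * (\<integral>\<^sup>+x\<in>ball 0 R. (mean r (\<lambda>x. ennreal (norm (u x))) x)\<^sup>2 \<partial>lborel)"
    by (rule nn_integral_cmult) measurable
  also have "\<dots> \<le> ennreal (r\<^sup>2) * (\<integral>\<^sup>+x\<in>ball 0 (R + r). (ennreal (norm (u x)))\<^sup>2 \<partial>lborel)"
    by (intro mult_left_mono mu_average_L2_local[where h="\<lambda>x. ennreal (norm (u x))"] r) auto
  also have "\<dots> \<le> ennreal (r\<^sup>2) * ennreal B2"
    using b2 order_trans[OF sub, of "\<lambda>x. (ennreal (norm (u x)))\<^sup>2" "ennreal B2"]
    by (intro mult_left_mono) (simp_all add: local_bound_def ennreal_power)
  finally show "local_bound R (\<lambda>x. (norm (error_potential r u x))\<^sup>2) (r\<^sup>2 * B2)"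
    using b2 unfolding G_def[symmetric] local_bound_def by (simp add: ennreal_mult)
  have "(\<integral>\<^sup>+x\<in>ball 0 R. ennreal (norm (G x) ^ 4) \<partial>lborel)
     \<le> (\<integral>\<^sup>+x. ennreal (r ^ 4) * ((mean r (\<lambda>x. ennreal (norm (u x))) x) ^ 4 * indicator (ball 0 R) x) \<partial>lborel)"
    using pw[of _ 4] by (intro nn_integral_mono) (auto split: split_indicator)
  also have "\<dots> = ennreal (r ^ 4) * (\<integral>\<^sup>+x\<in>ball 0 R. (mean r (\<lambda>x. ennreal (norm (u x))) x) ^ 4 \<partial>lborel)"
    by (rule nn_integral_cmult) measurable
  also have "\<dots> \<le> ennreal (r ^ 4) * (\<integral>\<^sup>+x\<in>ball 0 (R + r). (ennreal (norm (u x))) ^ 4 \<partial>lborel)"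
    by (intro mult_left_mono mu_average_L4_local[where h="\<lambda>x. ennreal (norm (u x))"] r) auto
  also have "\<dots> \<le> ennreal (r ^ 4) * ennreal B4"
    using b4 order_trans[OF sub, of "\<lambda>x. (ennreal (norm (u x))) ^ 4" "ennreal B4"]
    by (intro mult_left_mono) (simp_all add: local_bound_def ennreal_power)
  finally show "local_bound R (\<lambda>x. norm (error_potential r u x) ^ 4) (r ^ 4 * B4)"
    using b4 unfolding G_def[symmetric] local_bound_def by (simp add: ennreal_mult)
  have pdG: "(\<integral>\<^sup>+x. ennreal ((norm (pd i G x))\<^sup>2) \<partial>lborel) \<le> ennreal (r\<^sup>2) * (\<integral>\<^sup>+x. ennreal ((norm (pd i u x))\<^sup>2) \<partial>lborel)" for i
  proof -
    have le': "ennreal (norm (pd i G x)) \<le> ennreal r * (mean r (\<lambda>x. ennreal (norm (pd i u x))) x)" for x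
      unfolding G_def by (rule norm_error_potential_le[OF u r])
    have "ennreal ((norm (pd i G x))\<^sup>2) \<le> ennreal (r\<^sup>2) * (mean r (\<lambda>x. ennreal (norm (pd i u x))) x)\<^sup>2" for x
      using power_mono[OF le' zero_le, of x 2] r by (simp add: power_mult_distrib ennreal_power)
    then have "(\<integral>\<^sup>+x. ennreal ((norm (pd i G x))\<^sup>2) \<partial>lborel)
       \<le> (\<integral>\<^sup>+x. ennreal (r\<^sup>2) * (mean r (\<lambda>x. ennreal (norm (pd i u x))) x)\<^sup>2 \<partial>lborel)"
      by (intro nn_integral_mono)
    also have "\<dots> = ennreal (r\<^sup>2) * (\<integral>\<^sup>+x. (mean r (\<lambda>x. ennreal (norm (pd i u x))) x)\<^sup>2 \<partial>lborel)"
      by (rule nn_integral_cmult) measurable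
    also have "\<dots> \<le> ennreal (r\<^sup>2) * (\<integral>\<^sup>+x. (ennreal (norm (pd i u x)))\<^sup>2 \<partial>lborel)"
      by (intro mult_left_mono mu_average_L2[where h="\<lambda>x. ennreal (norm (pd i u x))"] r) auto
    finally show ?thesis by (simp add: ennreal_power)
  qed
  have gs: "(\<integral>\<^sup>+x. ennreal (grad_norm2 f x) \<partial>lborel) = (\<Sum>i\<in>UNIV. \<integral>\<^sup>+x. ennreal ((norm (pd i f x))\<^sup>2) \<partial>lborel)"
    if "C1 f" for f
  proof -
    have [measurable]: "pd i f \<in> borel_measurable borel" for i
      using that by (intro borel_measurable_continuous_onI C1_pd_cont)
    show ?thesis unfolding grad_norm2_def by (subst nn_integral_sum[symmetric]) (auto simp: sum_ennreal)
  qed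
  have "(\<integral>\<^sup>+x\<in>ball 0 R. ennreal (grad_norm2 G x) \<partial>lborel) \<le> (\<integral>\<^sup>+x. ennreal (grad_norm2 G x) \<partial>lborel)"
    by (intro nn_integral_mono) (auto split: split_indicator)
  also have "\<dots> \<le> (\<Sum>i\<in>UNIV. ennreal (r\<^sup>2) * (\<integral>\<^sup>+x. ennreal ((norm (pd i u x))\<^sup>2) \<partial>lborel))"
    unfolding gs[OF G] by (intro sum_mono pdG)
  also have "\<dots> = ennreal (r\<^sup>2) * (\<integral>\<^sup>+x. ennreal (grad_norm2 u x) \<partial>lborel)"
    unfolding gs[OF u] by (simp add: sum_distrib_left)
  also have "\<dots> \<le> ennreal (r\<^sup>2) * ennreal E"
    by (intro mult_left_mono D) auto
  finally show "local_bound R (grad_norm2 (error_potential r u)) (r\<^sup>2 * E)"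
    unfolding G_def[symmetric] local_bound_def using D(2) Gm
    by (simp add: ennreal_mult grad_norm2_def sum_nonneg)
qed

lemma norm_add_power2_le: "(norm (a + b))\<^sup>2 \<le> 2 * (norm a)\<^sup>2 + 2 * (norm b)\<^sup>2"
proof -
  have "(norm (a + b))\<^sup>2 \<le> (norm a + norm b)\<^sup>2" by (intro power_mono norm_triangle_ineq) auto
  also have "\<dots> \<le> 2 * (norm a)\<^sup>2 + 2 * (norm b)\<^sup>2"
    using sum_squares_bound[of "norm a" "norm b"] by (simp add: power2_sum)
  finally show ?thesis .
qed

text \<open>The potential is a slowly growing part \<open>a\<close> with small gradient plus an error potential \<open>g\<close>. The
  product \<open>\<bar>u\<bar>\<^sup>2 \<bar>g\<bar>\<^sup>2\<close> is split by the inequality of arithmetic and geometric means with weight \<open>r\<close>,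
  since \<open>g\<close> is of size \<open>r \<bar>u\<bar>\<close>.\<close>

lemma energy_density_split:
  assumes R: "R > 0" and r: "r > 0" and a: "norm a \<le> A" and \<Psi>: "\<Psi> x = a + g"
    and da: "\<And>i. norm (da i) \<le> A'" and d\<Psi>: "\<And>i. pd i \<Psi> x = da i + dg i"
  shows "energy_density R u \<Psi> x \<le>
    (1 + 2 * A\<^sup>2) / R\<^sup>2 * (norm (u x))\<^sup>2 + (2 * A\<^sup>2 / R ^ 4 + 18 * A'\<^sup>2 / R\<^sup>2) * 1
    + 2 / R ^ 4 * (norm g)\<^sup>2 + 6 / R\<^sup>2 * (\<Sum>i\<in>UNIV. (norm (dg i))\<^sup>2)
    + r\<^sup>2 / R\<^sup>2 * norm (u x) ^ 4 + 1 / (r\<^sup>2 * R\<^sup>2) * norm g ^ 4"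
proof -
  have a2: "(norm a)\<^sup>2 \<le> A\<^sup>2" using a by (intro power_mono) auto
  have da2: "(norm (da i))\<^sup>2 \<le> A'\<^sup>2" for i using da by (intro power_mono) auto
  have p2: "(norm (\<Psi> x))\<^sup>2 \<le> 2 * A\<^sup>2 + 2 * (norm g)\<^sup>2"
    unfolding \<Psi> using norm_add_power2_le[of a g] a2 by linarith
  have "grad_norm2 \<Psi> x \<le> (\<Sum>i\<in>UNIV. 2 * A'\<^sup>2 + 2 * (norm (dg i))\<^sup>2)"
    unfolding grad_norm2_def d\<Psi>
    using norm_add_power2_le[of "da _" "dg _"] da2 by (intro sum_mono) (smt (verit))
  then have g2: "grad_norm2 \<Psi> x \<le> 6 * A'\<^sup>2 + 2 * (\<Sum>i\<in>UNIV. (norm (dg i))\<^sup>2)"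
    by (simp add: sum.distrib sum_distrib_left)
  have y: "2 * ((norm (u x))\<^sup>2 * (norm g)\<^sup>2) \<le> r\<^sup>2 * norm (u x) ^ 4 + 1 / r\<^sup>2 * norm g ^ 4"
  proof -
    have "2 * (r * (norm (u x))\<^sup>2) * ((norm g)\<^sup>2 / r) \<le> (r * (norm (u x))\<^sup>2)\<^sup>2 + ((norm g)\<^sup>2 / r)\<^sup>2"
      by (rule sum_squares_bound)
    then show ?thesis using r by (simp add: power_mult_distrib power_divide flip: power_mult)
  qed
  have "(norm (u x))\<^sup>2 * (norm (\<Psi> x))\<^sup>2 \<le> (norm (u x))\<^sup>2 * (2 * A\<^sup>2 + 2 * (norm g)\<^sup>2)"
    using p2 by (intro mult_left_mono) auto
  also have "\<dots> \<le> 2 * A\<^sup>2 * (norm (u x))\<^sup>2 + r\<^sup>2 * norm (u x) ^ 4 + 1 / r\<^sup>2 * norm g ^ 4"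
    using y by (simp add: algebra_simps)
  finally have up: "(norm (u x))\<^sup>2 * (norm (\<Psi> x))\<^sup>2 \<le> 2 * A\<^sup>2 * (norm (u x))\<^sup>2 + r\<^sup>2 * norm (u x) ^ 4 + 1 / r\<^sup>2 * norm g ^ 4" .
  have "energy_density R u \<Psi> x \<le> (norm (u x))\<^sup>2 / R\<^sup>2 + (2 * A\<^sup>2 + 2 * (norm g)\<^sup>2) / R ^ 4
      + 3 * (6 * A'\<^sup>2 + 2 * (\<Sum>i\<in>UNIV. (norm (dg i))\<^sup>2)) / R\<^sup>2
      + (2 * A\<^sup>2 * (norm (u x))\<^sup>2 + r\<^sup>2 * norm (u x) ^ 4 + 1 / r\<^sup>2 * norm g ^ 4) / R\<^sup>2"
    unfolding energy_density_def using p2 g2 up R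
    by (intro add_mono divide_right_mono mult_left_mono) auto
  also have "\<dots> = (1 + 2 * A\<^sup>2) / R\<^sup>2 * (norm (u x))\<^sup>2 + (2 * A\<^sup>2 / R ^ 4 + 18 * A'\<^sup>2 / R\<^sup>2) * 1
    + 2 / R ^ 4 * (norm g)\<^sup>2 + 6 / R\<^sup>2 * (\<Sum>i\<in>UNIV. (norm (dg i))\<^sup>2)
    + r\<^sup>2 / R\<^sup>2 * norm (u x) ^ 4 + 1 / (r\<^sup>2 * R\<^sup>2) * norm g ^ 4"
    by (simp add: add_divide_distrib algebra_simps)
  finally show ?thesis .
qed

lemma local_bound_norm_power:
  assumes u: "continuous_on UNIV u" and K: "K > 0" and m: "m > 0"
    and le: "\<forall>R>0. (\<integral>\<^sup>+x\<in>ball 0 R. ennreal (norm (u x) powr real m) \<partial>lborel) \<le> ennreal (K * R powr e)"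
    and R: "R > 0"
  shows "local_bound R (\<lambda>x. norm (u x) ^ m) (K * R powr e)"
proof -
  have "(\<lambda>x. norm (u x) ^ m) \<in> borel_measurable borel"
    by (intro borel_measurable_continuous_onI continuous_intros u)
  moreover have "norm (u x) powr real m = norm (u x) ^ m" for x
    using m by (cases "u x = 0") (auto simp: powr_realpow)
  ultimately show ?thesis using K le R by (simp add: local_bound_def)
qed

lemma local_bound_one:
  "R > 0 \<Longrightarrow> local_bound R (\<lambda>x. 1) (R ^ 3 * measure lborel (ball (0::real^3) 1))"
  using emeasure_ball_eq[of R "0::real^3"] by (simp add: local_bound_def)

text \<open>The growth rates, in this order, of the contributions of \<open>\<bar>u\<bar>\<^sup>2\<close>, of \<open>\<bar>u\<bar>\<^sup>2 \<bar>a\<bar>\<^sup>2\<close>, \<open>\<bar>a\<bar>\<^sup>2\<close> and \<open>\<bar>\<nabla>a\<bar>\<^sup>2\<close> for the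
  mollified potential \<open>a\<close>, and of \<open>\<bar>g\<bar>\<^sup>2\<close>, \<open>\<bar>\<nabla>g\<bar>\<^sup>2\<close> and \<open>\<bar>u\<bar>\<^sup>2 \<bar>g\<bar>\<^sup>2\<close> for the error potential \<open>g\<close>.\<close>

definition energy_rate :: "real \<Rightarrow> real \<Rightarrow> real \<Rightarrow> real" where
  "energy_rate \<alpha> r R = R powr (- 1 / 3) + R powr (2 * \<alpha> - 1 / 3) + R powr (2 * \<alpha> - 1)
          + R * r powr (2 * \<alpha> - 2) + r powr 2 * R powr (- 7 / 3)
          + r powr 2 * R powr (- 2) + r powr 2 * R powr (- 5 / 3)"

text \<open>The mollified potential at scale \<open>r\<close>, normalised by a constant, has curl \<open>u\<^sub>r\<close>; adding the error potential
  repairs the curl. The scale \<open>r\<close> stays free because a large \<open>r\<close> makes the gradient of the mollified part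
  small and a small \<open>r\<close> makes the error potential small.\<close>

lemma potential_with_small_energy:
  assumes D: "D_solution u" and s: "s \<ge> 1" and f: "locally_L1 \<psi>" and w: "is_weak_curl u \<psi>"
    and C: "C > 0" and \<alpha>: "0 < \<alpha>" and o: "oscillation_bound \<psi> s C \<alpha>"
    and L: "(\<integral>\<^sup>+x. ennreal (norm (u x) powr (9/2)) \<partial>lborel) < \<infinity>"
  shows "\<exists>Q>0. \<forall>r>1. \<forall>n. \<exists>\<Psi>. C1 \<Psi> \<and> (\<forall>x. curl \<Psi> x = u x) \<and>
     (\<integral>\<^sup>+x\<in>ball 0 (2 ^ n * r). ennreal (energy_density (2 ^ n * r) u \<Psi> x) \<partial>lborel)
       \<le> ennreal (Q * energy_rate \<alpha> r (2 ^ n * r))"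
proof -
  note u = C2_C1[OF D_solution_C2[OF D]]
  note uc = C1_cont[OF u]
  obtain K1 where K1: "K1 > 0" "\<forall>r>1. \<forall>x i. norm (pd i (mollify r \<psi>) x) \<le> K1 * r powr (\<alpha> - 1)"
    using mollify_oscillation[OF f o s C] by (elim exE conjE) (rule that)
  obtain K where K: "K > 0" "\<forall>r>1. \<forall>n x. norm x \<le> 2 ^ n * r \<longrightarrow>
     norm (mollify r \<psi> x - average (ball 0 (2 * 2 ^ n * r)) \<psi>) \<le> K * (2 ^ n * r) powr \<alpha>"
    using mollify_growth[OF f o s C \<alpha>] by (elim exE conjE) (rule that)
  obtain E where E: "E > 0" "(\<integral>\<^sup>+x. ennreal (grad_norm2 u x) \<partial>lborel) \<le> ennreal E"
    using D_solution_dirichlet[OF D] by blast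
  obtain K2 where K2: "K2 > 0" "\<forall>R>0. (\<integral>\<^sup>+x\<in>ball 0 R. ennreal (norm (u x) powr 2) \<partial>lborel) \<le> ennreal (K2 * R powr (3 - 2 * 2 / 3))"
    using local_norm_growth[OF uc L, of 2] by auto
  obtain K4 where K4: "K4 > 0" "\<forall>R>0. (\<integral>\<^sup>+x\<in>ball 0 R. ennreal (norm (u x) powr 4) \<partial>lborel) \<le> ennreal (K4 * R powr (3 - 2 * 4 / 3))"
    using local_norm_growth[OF uc L, of 4] by auto
  define V where "V = measure lborel (ball (0::real^3) 1)"
  have V: "V > 0" unfolding V_def by (rule content_ball_pos) simp
  define Q where "Q = K2 + 2 * K\<^sup>2 * K2 + 2 * K\<^sup>2 * V + 18 * K1\<^sup>2 * V + 2 * K2 * 2 powr (5 / 3) + 6 * E + (K4 + K4 * 2 powr (1 / 3))"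
  have "Q > 0" unfolding Q_def using K2 K4 V E by (intro add_pos_nonneg) auto
  moreover have "\<exists>\<Psi>. C1 \<Psi> \<and> (\<forall>x. curl \<Psi> x = u x) \<and>
     (\<integral>\<^sup>+x\<in>ball 0 R. ennreal (energy_density R u \<Psi> x) \<partial>lborel)
       \<le> ennreal (Q * energy_rate \<alpha> r R)"
    if r: "r > 1" and Rdef: "R = 2 ^ n * r" for r n R
  proof -
    have r0: "r > 0" using r by simp
    have rR: "r \<le> R" unfolding Rdef using r by simp
    have R0: "R > 0" using r0 rR by simp
    define c where "c = average (ball 0 (2 * R)) \<psi>"
    define G where "G = error_potential r u"
    define \<Psi> where "\<Psi> x = (mollify r \<psi> x - c) + G x" for x
    have m1: "C1 (mollify r \<psi>)" by (rule C1_mollify[OF f r0])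
    have G1: "C1 G" unfolding G_def by (rule C1_error_potential[OF u r0])
    have \<Psi>1: "C1 \<Psi>" unfolding \<Psi>_def by (intro C1_add C1_minus m1 G1 C1_const)
    have pd\<Psi>: "pd i \<Psi> x = pd i (mollify r \<psi>) x + pd i G x" for i x
      unfolding \<Psi>_def
      by (simp add: pd_add pd_diff C1_differentiable[OF C1_minus[OF m1 C1_const]] C1_differentiable[OF G1] C1_differentiable[OF m1])
    have curl\<Psi>: "curl \<Psi> x = u x" for x
    proof -
      have "curl \<Psi> x = curl (mollify r \<psi>) x + curl G x"
        unfolding curl_eq pd\<Psi> by (simp add: cross_add_right sum.distrib)
      then show ?thesis
        unfolding curl_mollify[OF f w uc r0] G_def curl_error_potential[OF u r0 D_solution_div[OF D]] by simp
    qed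
    define A where "A = K * R powr \<alpha>"
    define A' where "A' = K1 * r powr (\<alpha> - 1)"
    have b2: "local_bound S (\<lambda>x. (norm (u x))\<^sup>2) (K2 * S powr (3 - 2 * 2 / 3))" if "S > 0" for S
      using local_bound_norm_power[OF uc K2(1), of 2 "3 - 2 * 2 / 3" S] K2(2) that by simp
    have b4: "local_bound S (\<lambda>x. norm (u x) ^ 4) (K4 * S powr (3 - 2 * 4 / 3))" if "S > 0" for S
      using local_bound_norm_power[OF uc K4(1), of 4 "3 - 2 * 4 / 3" S] K4(2) that by simp
    have R2: "2 * R > 0" using R0 by simp
    note gb = error_potential_bounds[OF u r0 rR E(2) less_imp_le[OF E(1)] b2[OF R2] b4[OF R2], folded G_def]
    define h where "h x = (1 + 2 * A\<^sup>2) / R\<^sup>2 * (norm (u x))\<^sup>2 + (2 * A\<^sup>2 / R ^ 4 + 18 * A'\<^sup>2 / R\<^sup>2) * 1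
      + 2 / R ^ 4 * (norm (G x))\<^sup>2 + 6 / R\<^sup>2 * grad_norm2 G x
      + r\<^sup>2 / R\<^sup>2 * norm (u x) ^ 4 + 1 / (r\<^sup>2 * R\<^sup>2) * norm (G x) ^ 4" for x
    define b where "b = (1 + 2 * A\<^sup>2) / R\<^sup>2 * (K2 * R powr (3 - 2 * 2 / 3)) + (2 * A\<^sup>2 / R ^ 4 + 18 * A'\<^sup>2 / R\<^sup>2) * (R ^ 3 * V)
      + 2 / R ^ 4 * (r\<^sup>2 * (K2 * (2 * R) powr (3 - 2 * 2 / 3))) + 6 / R\<^sup>2 * (r\<^sup>2 * E)
      + r\<^sup>2 / R\<^sup>2 * (K4 * R powr (3 - 2 * 4 / 3)) + 1 / (r\<^sup>2 * R\<^sup>2) * (r ^ 4 * (K4 * (2 * R) powr (3 - 2 * 4 / 3)))"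
    have hb: "local_bound R h b"
      unfolding h_def b_def V_def
      by (intro local_bound_add local_bound_cmult b2 b4 gb local_bound_one R0) auto
    have "(\<integral>\<^sup>+x\<in>ball 0 R. ennreal (energy_density R u \<Psi> x) \<partial>lborel) \<le> (\<integral>\<^sup>+x\<in>ball 0 R. ennreal (h x) \<partial>lborel)"
    proof (rule nn_integral_mono)
      fix x :: "real^3"
      show "ennreal (energy_density R u \<Psi> x) * indicator (ball 0 R) x \<le> ennreal (h x) * indicator (ball 0 R) x"
      proof (cases "x \<in> ball 0 R")
        case True
        have "norm (mollify r \<psi> x - c) \<le> A"
          using K(2)[rule_format, OF r, of x n] True unfolding A_def c_def Rdef by (simp add: mult.assoc)
        moreover have "norm (pd i (mollify r \<psi>) x) \<le> A'" for i
          unfolding A'_def using K1(2) r by blast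
        ultimately have "energy_density R u \<Psi> x \<le> h x"
          unfolding h_def grad_norm2_def[of G]
          by (intro energy_density_split[OF R0 r0 _ _ _ pd\<Psi>]) (simp_all add: \<Psi>_def)
        then show ?thesis by (simp add: mult_right_mono ennreal_leI)
      qed simp
    qed
    also have "\<dots> \<le> ennreal b" using hb by (simp add: local_bound_def)
    also have "ennreal b \<le> ennreal (Q * energy_rate \<alpha> r R)"
    proof (rule ennreal_leI)
      have A2: "A\<^sup>2 = K\<^sup>2 * R powr (2 * \<alpha>)" unfolding A_def power_mult_distrib power2_eq_square[of "R powr \<alpha>"]
        by (simp flip: powr_add)
      have A'2: "A'\<^sup>2 = K1\<^sup>2 * r powr (2 * \<alpha> - 2)" unfolding A'_def power_mult_distrib power2_eq_square[of "r powr (\<alpha> - 1)"]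
        by (simp flip: powr_add)
      have Rk: "R ^ k = R powr real k" for k using R0 by (simp add: powr_realpow)
      have iR2: "1 / R\<^sup>2 = R powr (- 2)" using R0 by (simp add: powr_minus_divide)
      have iR4: "1 / R ^ 4 = R powr (- 4)" using R0 by (simp add: powr_minus_divide)
      have R3: "R ^ 3 = R powr 3" using R0 by simp
      have r2: "r\<^sup>2 = r powr 2" using r0 by simp
      have r4: "1 / (r\<^sup>2 * R\<^sup>2) * r ^ 4 = r\<^sup>2 * (1 / R\<^sup>2)"
        using r0 by (simp add: power4_eq_xxxx power2_eq_square)
      have P: "R powr e * R powr e' = R powr (e + e')" for e e' by (simp add: powr_add)
      have t1: "(1 + 2 * A\<^sup>2) / R\<^sup>2 * (K2 * R powr (3 - 2 * 2 / 3)) = K2 * R powr (- 1 / 3) + 2 * K\<^sup>2 * K2 * R powr (2 * \<alpha> - 1 / 3)"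
      proof -
        have "(1 + 2 * A\<^sup>2) / R\<^sup>2 * (K2 * R powr (3 - 2 * 2 / 3)) =
          K2 * (R powr (- 2) * R powr (3 - 2 * 2 / 3)) + 2 * K\<^sup>2 * K2 * (R powr (2 * \<alpha>) * R powr (- 2) * R powr (3 - 2 * 2 / 3))"
          unfolding A2 iR2[symmetric] by (simp add: add_divide_distrib algebra_simps)
        then show ?thesis unfolding P by simp
      qed
      have t2: "(2 * A\<^sup>2 / R ^ 4 + 18 * A'\<^sup>2 / R\<^sup>2) * (R ^ 3 * V) = 2 * K\<^sup>2 * V * R powr (2 * \<alpha> - 1) + 18 * K1\<^sup>2 * V * (R * r powr (2 * \<alpha> - 2))"
      proof -
        have "(2 * A\<^sup>2 / R ^ 4 + 18 * A'\<^sup>2 / R\<^sup>2) * (R ^ 3 * V) =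
          2 * K\<^sup>2 * V * (R powr (2 * \<alpha>) * R powr (- 4) * R powr 3) + 18 * K1\<^sup>2 * V * ((R powr (- 2) * R powr 3) * r powr (2 * \<alpha> - 2))"
          unfolding A2 A'2 iR2[symmetric] iR4[symmetric] R3 by (simp add: add_divide_distrib algebra_simps)
        then show ?thesis unfolding P using R0 by simp
      qed
      have t3: "2 / R ^ 4 * (r\<^sup>2 * (K2 * (2 * R) powr (3 - 2 * 2 / 3))) = 2 * K2 * 2 powr (5 / 3) * (r powr 2 * R powr (- 7 / 3))"
      proof -
        have "2 / R ^ 4 * (r\<^sup>2 * (K2 * (2 * R) powr (3 - 2 * 2 / 3))) = 2 * K2 * 2 powr (5 / 3) * (r powr 2 * (R powr (- 4) * R powr (5 / 3)))"
          unfolding r2[symmetric] iR4[symmetric] using R0 by (simp add: powr_mult)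
        then show ?thesis unfolding P by simp
      qed
      have t4: "6 / R\<^sup>2 * (r\<^sup>2 * E) = 6 * E * (r powr 2 * R powr (- 2))"
        unfolding r2[symmetric] iR2[symmetric] by simp
      have t5: "r\<^sup>2 / R\<^sup>2 * (K4 * R powr (3 - 2 * 4 / 3)) = K4 * (r powr 2 * R powr (- 5 / 3))"
      proof -
        have "r\<^sup>2 / R\<^sup>2 * (K4 * R powr (3 - 2 * 4 / 3)) = K4 * (r powr 2 * (R powr (- 2) * R powr (1 / 3)))"
          unfolding r2[symmetric] iR2[symmetric] by simp
        then show ?thesis unfolding P by simp
      qed
      have t6: "1 / (r\<^sup>2 * R\<^sup>2) * (r ^ 4 * (K4 * (2 * R) powr (3 - 2 * 4 / 3))) = (K4 * 2 powr (1 / 3)) * (r powr 2 * R powr (- 5 / 3))"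
      proof -
        have "1 / (r\<^sup>2 * R\<^sup>2) * (r ^ 4 * (K4 * (2 * R) powr (3 - 2 * 4 / 3))) = (K4 * 2 powr (1 / 3)) * (r powr 2 * (R powr (- 2) * R powr (1 / 3)))"
          unfolding r2[symmetric] iR2[symmetric] mult.assoc[symmetric, of "1 / (r\<^sup>2 * R\<^sup>2)"] r4 using R0 by (simp add: powr_mult)
        then show ?thesis unfolding P by simp
      qed
      have q: "0 \<le> K2" "0 \<le> 2 * K\<^sup>2 * K2" "0 \<le> 2 * K\<^sup>2 * V" "0 \<le> 18 * K1\<^sup>2 * V" "0 \<le> 2 * K2 * 2 powr (5 / 3)" "0 \<le> 6 * E"
        "0 \<le> K4 + K4 * 2 powr (1 / 3)" using K2 K4 V E by auto
      have comb: "q1 * y1 + q2 * y2 + (q3 * y3 + q4 * y4) + q5 * y5 + q6 * y6 + p7 * y7 + p8 * y7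
          \<le> (q1 + q2 + q3 + q4 + q5 + q6 + (p7 + p8)) * (y1 + y2 + y3 + y4 + y5 + y6 + y7)"
        if "0 \<le> q1" "0 \<le> q2" "0 \<le> q3" "0 \<le> q4" "0 \<le> q5" "0 \<le> q6" "0 \<le> p7 + p8"
          "0 \<le> y1" "0 \<le> y2" "0 \<le> y3" "0 \<le> y4" "0 \<le> y5" "0 \<le> y6" "0 \<le> y7"
        for q1 q2 q3 q4 q5 q6 p7 p8 y1 y2 y3 y4 y5 y6 y7 :: real
      proof -
        define q7 where "q7 = p7 + p8"
        define S where "S = y1 + y2 + y3 + y4 + y5 + y6 + y7"
        have "q1 * y1 \<le> q1 * S" "q2 * y2 \<le> q2 * S" "q3 * y3 \<le> q3 * S" "q4 * y4 \<le> q4 * S"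
          "q5 * y5 \<le> q5 * S" "q6 * y6 \<le> q6 * S" "q7 * y7 \<le> q7 * S"
          using that by (auto simp: S_def q7_def intro!: mult_left_mono)
        then show ?thesis unfolding S_def[symmetric] by (simp add: q7_def distrib_right)
      qed
      show "b \<le> Q * energy_rate \<alpha> r R"
        unfolding b_def t1 t2 t3 t4 t5 t6 Q_def energy_rate_def using R0 by (intro comb q) auto
    qed
    finally show ?thesis using \<Psi>1 curl\<Psi> by blast
  qed
  ultimately show ?thesis by blast
qed

section \<open>Vanishing\<close>

text \<open>If \<open>f\<close> were positive at a point, the integrals would stay above a positive constant once \<open>R k\<close> is so large that the
  cutoff is at least \<open>27 / 64\<close> near that point.\<close>

lemma vanishing_of_cutoff_integrals:
  fixes f :: "real^3 \<Rightarrow> real"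
  assumes f: "continuous_on UNIV f" "\<And>x. 0 \<le> f x"
    and R: "filterlim R at_top sequentially"
    and b: "\<And>k. (\<integral>\<^sup>+x. ennreal (cutoff (R k) x * f x) \<partial>lborel)\<^sup>2 \<le> ennreal (b k)" "b \<longlonglongrightarrow> 0"
  shows "f x = 0"
proof (rule ccontr)
  assume "f x \<noteq> 0"
  then have fx: "f x > 0" using f(2)[of x] by simp
  have "open {y. f x / 2 < f y}" by (rule open_Collect_less[OF continuous_on_const f(1)])
  moreover have "x \<in> {y. f x / 2 < f y}" using fx by simp
  ultimately obtain d where "d > 0" "ball x d \<subseteq> {y. f x / 2 < f y}"
    unfolding open_contains_ball by blast
  then have d: "d > 0" "\<And>y. dist x y < d \<Longrightarrow> f x / 2 < f y" by auto
  define m where "m = (27 / 64) * (f x / 2) * measure lborel (ball x d)"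
  have m: "m > 0" unfolding m_def using fx d content_ball_pos[of d x] by simp
  have "eventually (\<lambda>k. R k \<ge> 2 * (norm x + d)) sequentially"
    using R by (simp add: filterlim_at_top)
  then have ev: "eventually (\<lambda>k. m\<^sup>2 \<le> max 0 (b k)) sequentially"
  proof eventually_elim
    case (elim k)
    have "0 < 2 * (norm x + d)" using d(1) by (simp add: add_nonneg_pos)
    then have Rk: "R k > 0" using elim by (rule less_le_trans)
    have "ennreal m = (\<integral>\<^sup>+y. ennreal ((27 / 64) * (f x / 2)) * indicator (ball x d) y \<partial>lborel)"
    proof -
      have "emeasure lborel (ball x d) = ennreal (measure lborel (ball x d))"
        using emeasure_lborel_ball_finite[of x d] by (intro emeasure_eq_ennreal_measure) auto
      then show ?thesis
        using fx ennreal_mult[of "27 / 64 * (f x / 2)" "measure lborel (ball x d)"]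
        by (subst nn_integral_cmult_indicator) (auto simp: m_def)
    qed
    also have "\<dots> \<le> (\<integral>\<^sup>+y. ennreal (cutoff (R k) y * f y) \<partial>lborel)"
    proof (rule nn_integral_mono)
      fix y
      show "ennreal ((27 / 64) * (f x / 2)) * indicator (ball x d) y \<le> ennreal (cutoff (R k) y * f y)"
      proof (cases "y \<in> ball x d")
        case True
        then have "norm y \<le> norm x + d" using norm_triangle_sub[of y x] by (simp add: dist_norm norm_minus_commute)
        then have "27 / 64 \<le> cutoff (R k) y" using elim by (intro cutoff_inside Rk) auto
        then have "(27 / 64) * (f x / 2) \<le> cutoff (R k) y * f y"
          using d(2)[of y] True fx by (intro mult_mono) auto
        then show ?thesis using True by (simp add: ennreal_leI)
      qed simp
    qed
    finally have "(ennreal m)\<^sup>2 \<le> ennreal (b k)" using b(1)[of k] by (meson order_trans power_mono zero_le)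
    then have "ennreal (m\<^sup>2) \<le> ennreal (b k)" using m by (simp add: ennreal_power)
    then show ?case by (cases "b k \<ge> 0") (auto simp: ennreal_neg max_def)
  qed
  have lim: "(\<lambda>k. max 0 (b k)) \<longlonglongrightarrow> max 0 0" by (intro tendsto_max tendsto_const b(2))
  have "m\<^sup>2 \<le> max 0 0" by (rule tendsto_lowerbound[OF lim ev]) simp
  then show False using m by simp
qed

text \<open>An irrotational solenoidal field is harmonic. Testing \<open>\<Delta> u = 0\<close> with the cutoff times \<open>u\<close> bounds the localised
  Dirichlet integral by the square root of \<open>R powr (- 1 / 3)\<close>, so \<open>u\<close> is constant.\<close>

lemma irrotational_D_solution_vanishes:
  assumes D: "D_solution u" and L: "(\<integral>\<^sup>+x. ennreal (norm (u x) powr (9/2)) \<partial>lborel) < \<infinity>"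
    and irr: "\<And>x. curl u x = 0"
  shows "u x = 0"
proof -
  note u2 = D_solution_C2[OF D] note u = C2_C1[OF u2]
  note uc = C1_cont[OF u]
  have lap: "laplacian u x = 0" for x
  proof -
    have "curl u = (\<lambda>x. 0)" using irr by auto
    then have "curl (curl u) x = 0" by (simp add: curl_eq[of "\<lambda>x. 0"])
    then show ?thesis using curl_curl[OF u2 D_solution_div[OF D], of x] by simp
  qed
  obtain E where E: "E > 0" "(\<integral>\<^sup>+x. ennreal (grad_norm2 u x) \<partial>lborel) \<le> ennreal E"
    using D_solution_dirichlet[OF D] by blast
  obtain K2 where K2: "K2 > 0" "\<forall>R>0. (\<integral>\<^sup>+x\<in>ball 0 R. ennreal (norm (u x) powr 2) \<partial>lborel) \<le> ennreal (K2 * R powr (3 - 2 * 2 / 3))"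
    using local_norm_growth[OF uc L, of 2] by auto
  have gc: "continuous_on UNIV (grad_norm2 u)"
    unfolding grad_norm2_def[abs_def] by (intro continuous_intros C1_pd_cont u)
  have [measurable]: "u \<in> borel_measurable borel" "\<And>i. pd i u \<in> borel_measurable borel" "grad_norm2 u \<in> borel_measurable borel"
    using u gc by (auto intro!: borel_measurable_continuous_onI C1_cont C1_pd_cont)
  have main: "(\<integral>\<^sup>+x. ennreal (cutoff R x * grad_norm2 u x) \<partial>lborel)\<^sup>2 \<le> ennreal (108 * K2 * E * R powr (- 1 / 3))"
    if R: "R > 0" for R
  proof -
    define Z where "Z i x = cutoff R x * (u x \<bullet> pd i u x)" for i x
    define rest where "rest x = (\<Sum>i\<in>UNIV. cutoff_grad R x $ i * (u x \<bullet> pd i u x))" for x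
    have uu: "C1 (\<lambda>x. u x \<bullet> pd i u x)" for i by (intro C1_inner u C2_pd u2)
    have Z: "C1 (Z i)" "csupp (Z i)" for i
      unfolding Z_def by (intro C1_mult C1_cutoff uu) (intro csupp_bilinear_left[OF bounded_bilinear_mult] csupp_cutoff R)
    have pdZ: "pd i (Z i) x = cutoff R x * (u x \<bullet> pd i (pd i u) x + (norm (pd i u x))\<^sup>2) + cutoff_grad R x $ i * (u x \<bullet> pd i u x)" for i x
      unfolding Z_def power2_norm_eq_inner
      by (simp only: pd_mult[OF C1_differentiable[OF C1_cutoff] C1_differentiable[OF uu]] pd_inner[OF C1_differentiable[OF u] C1_differentiable[OF C2_pd[OF u2]]] pd_cutoff)
    have sumZ: "(\<Sum>i\<in>UNIV. pd i (Z i) x) = cutoff R x * grad_norm2 u x + rest x" for x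
    proof -
      have "(\<Sum>i\<in>UNIV. pd i (Z i) x) = cutoff R x * (u x \<bullet> laplacian u x) + cutoff R x * grad_norm2 u x + rest x"
        unfolding pdZ rest_def laplacian_def grad_norm2_def
        by (simp add: sum.distrib distrib_left sum_distrib_left inner_sum_right)
      then show ?thesis by (simp add: lap)
    qed
    have i1: "integrable lborel (\<lambda>x. cutoff R x * grad_norm2 u x)"
      by (intro csupp_integrable continuous_intros C1_cont C1_cutoff gc csupp_bilinear_left[OF bounded_bilinear_mult] csupp_cutoff R)
    have iZ: "integrable lborel (\<lambda>x. pd i (Z i) x)" for i
      by (intro csupp_integrable C1_pd_cont csupp_pd Z)
    have i2: "integrable lborel rest"
    proof -
      have "integrable lborel (\<lambda>x. (\<Sum>i\<in>UNIV. pd i (Z i) x) - cutoff R x * grad_norm2 u x)"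
        by (intro Bochner_Integration.integrable_diff Bochner_Integration.integrable_sum iZ i1)
      then show ?thesis by (simp add: sumZ)
    qed
    have "(\<integral>x. (\<Sum>i\<in>UNIV. pd i (Z i) x) \<partial>lborel) = 0"
      using iZ Z by (simp add: integral_pd_eq_0)
    then have eq: "(\<integral>x. cutoff R x * grad_norm2 u x \<partial>lborel) = - (\<integral>x. rest x \<partial>lborel)"
      unfolding sumZ using i1 i2 by simp
    define S where "S x = (\<Sum>i\<in>UNIV. norm (pd i u x))" for x
    have rest_le: "\<bar>rest x\<bar> \<le> (6 / R * norm (u x) * indicator (ball 0 R) x) * S x" for x
    proof (cases "x \<in> ball 0 R")
      case True
      have "\<bar>rest x\<bar> \<le> (\<Sum>i\<in>UNIV. \<bar>cutoff_grad R x $ i * (u x \<bullet> pd i u x)\<bar>)" unfolding rest_def by (rule sum_abs)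
      also have "\<dots> \<le> (\<Sum>i\<in>UNIV. (6 / R) * (norm (u x) * norm (pd i u x)))"
        unfolding abs_mult
        by (intro sum_mono mult_mono Cauchy_Schwarz_ineq2 order_trans[OF component_le_norm_cart norm_cutoff_grad_le[OF R]]) (use R in auto)
      finally show ?thesis using True by (simp add: S_def sum_distrib_left mult.assoc)
    next
      case False
      then show ?thesis using cutoff_outside[OF R, of x] by (simp add: rest_def)
    qed
    have S0: "0 \<le> S x" for x by (simp add: S_def sum_nonneg)
    have [measurable]: "S \<in> borel_measurable borel" unfolding S_def by measurable
    have gn: "0 \<le> grad_norm2 u x" for x by (simp add: grad_norm2_def sum_nonneg)
    have "(\<integral>\<^sup>+x. ennreal (cutoff R x * grad_norm2 u x) \<partial>lborel) = ennreal (- (\<integral>x. rest x \<partial>lborel))"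
      unfolding eq[symmetric] by (rule nn_integral_eq_integral[OF i1]) (simp add: cutoff_nonneg gn)
    also have "\<dots> \<le> ennreal (norm (\<integral>x. rest x \<partial>lborel))" by (intro ennreal_leI) simp
    also have "\<dots> \<le> (\<integral>\<^sup>+x. norm (rest x) \<partial>lborel)" by (rule integral_norm_bound_ennreal[OF i2])
    also have "\<dots> \<le> (\<integral>\<^sup>+x. ennreal (6 / R * norm (u x) * indicator (ball 0 R) x) * ennreal (S x) \<partial>lborel)"
      using rest_le S0 R by (intro nn_integral_mono) (simp flip: ennreal_mult add: ennreal_leI)
    finally have "(\<integral>\<^sup>+x. ennreal (cutoff R x * grad_norm2 u x) \<partial>lborel)\<^sup>2 \<le>
        (\<integral>\<^sup>+x. ennreal (6 / R * norm (u x) * indicator (ball 0 R) x) * ennreal (S x) \<partial>lborel)\<^sup>2"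
      by (intro power_mono) auto
    also have "\<dots> \<le> (\<integral>\<^sup>+x. (ennreal (6 / R * norm (u x) * indicator (ball 0 R) x))\<^sup>2 \<partial>lborel) * (\<integral>\<^sup>+x. (ennreal (S x))\<^sup>2 \<partial>lborel)"
      by (rule Cauchy_Schwarz_nn_integral) measurable
    also have "\<dots> \<le> ennreal (36 / R\<^sup>2 * (K2 * R powr (3 - 2 * 2 / 3))) * ennreal (3 * E)"
    proof (rule mult_mono)
      have b: "local_bound R (\<lambda>x. 36 / R\<^sup>2 * (norm (u x))\<^sup>2) (36 / R\<^sup>2 * (K2 * R powr (3 - 2 * 2 / 3)))"
        using local_bound_norm_power[OF uc K2(1), of 2 "3 - 2 * 2 / 3" R] K2(2) R by (intro local_bound_cmult) auto
      have "(\<integral>\<^sup>+x. (ennreal (6 / R * norm (u x) * indicator (ball 0 R) x))\<^sup>2 \<partial>lborel) = (\<integral>\<^sup>+x\<in>ball 0 R. ennreal (36 / R\<^sup>2 * (norm (u x))\<^sup>2) \<partial>lborel)"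
        using R by (intro nn_integral_cong) (auto simp: ennreal_power power_mult_distrib power_divide split: split_indicator)
      then show "(\<integral>\<^sup>+x. (ennreal (6 / R * norm (u x) * indicator (ball 0 R) x))\<^sup>2 \<partial>lborel) \<le> ennreal (36 / R\<^sup>2 * (K2 * R powr (3 - 2 * 2 / 3)))"
        using b by (simp add: local_bound_def)
      have "(\<integral>\<^sup>+x. (ennreal (S x))\<^sup>2 \<partial>lborel) \<le> (\<integral>\<^sup>+x. ennreal 3 * ennreal (grad_norm2 u x) \<partial>lborel)"
        using sum_norm_pd_le[of u] S0 by (intro nn_integral_mono)
          (auto simp: ennreal_power ennreal_mult'[symmetric] S_def simp del: ennreal_numeral intro!: ennreal_leI)
      also have "\<dots> = ennreal 3 * (\<integral>\<^sup>+x. ennreal (grad_norm2 u x) \<partial>lborel)" by (rule nn_integral_cmult) measurable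
      also have "\<dots> \<le> ennreal 3 * ennreal E" by (intro mult_left_mono E) auto
      finally show "(\<integral>\<^sup>+x. (ennreal (S x))\<^sup>2 \<partial>lborel) \<le> ennreal (3 * E)" using E(1) by (simp add: ennreal_mult)
    qed auto
    also have "\<dots> = ennreal (36 / R\<^sup>2 * (K2 * R powr (3 - 2 * 2 / 3)) * (3 * E))"
      using K2(1) E(1) R by (intro ennreal_mult[symmetric]) auto
    also have "36 / R\<^sup>2 * (K2 * R powr (3 - 2 * 2 / 3)) * (3 * E) = 108 * K2 * E * (R powr (- 2) * R powr (3 - 2 * 2 / 3))"
    proof -
      have "36 / R\<^sup>2 = 36 * R powr (- 2)" using R by (simp add: powr_minus_divide)
      then show ?thesis by simp
    qed
    also have "R powr (- 2) * R powr (3 - 2 * 2 / 3) = R powr (- 1 / 3)" by (simp flip: powr_add)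
    finally show ?thesis .
  qed
  have "grad_norm2 u x = 0" for x
  proof (rule vanishing_of_cutoff_integrals[OF gc])
    show "0 \<le> grad_norm2 u x" for x by (simp add: grad_norm2_def sum_nonneg)
    show R: "filterlim (\<lambda>k. real (Suc k)) at_top sequentially"
      by (rule filterlim_compose[OF filterlim_real_sequentially filterlim_Suc])
    show "(\<integral>\<^sup>+x. ennreal (cutoff (real (Suc k)) x * grad_norm2 u x) \<partial>lborel)\<^sup>2 \<le> ennreal (108 * K2 * E * real (Suc k) powr (- 1 / 3))" for k
      by (rule main) simp
    have "(\<lambda>k. real (Suc k) powr (- 1 / 3)) \<longlonglongrightarrow> 0"
      by (rule tendsto_neg_powr[OF _ R]) simp
    then show "(\<lambda>k. 108 * K2 * E * real (Suc k) powr (- 1 / 3)) \<longlonglongrightarrow> 0"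
      by (rule tendsto_mult_right_zero)
  qed
  then have pd0: "pd i u x = 0" for i x
    by (simp add: grad_norm2_def sum_nonneg_eq_0_iff)
  have "(u has_derivative (\<lambda>h. 0)) (at x within UNIV)" for x
    using has_derivative_pd[OF C1_differentiable[OF u], of x] by (simp add: pd0)
  then obtain c where c: "\<And>x. u x = c"
    using has_derivative_zero_constant[of UNIV u] by auto
  have "(u \<longlongrightarrow> 0) at_infinity" using D by (simp add: D_solution_def)
  moreover have "u = (\<lambda>x. c)" using c by auto
  ultimately have "((\<lambda>x::real^3. c) \<longlongrightarrow> 0) at_infinity" by simp
  then have "c = 0" using tendsto_unique[OF trivial_limit_at_infinity tendsto_const] by blast
  then show ?thesis using c by simp
qed

lemma liouville:
  assumes D: "D_solution u" and s: "s \<ge> 1" and f: "locally_L1 \<psi>" and w: "is_weak_curl u \<psi>"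
    and C: "C > 0" and \<alpha>: "0 < \<alpha>" "\<alpha> < 1 / 9" and o: "oscillation_bound \<psi> s C \<alpha>"
    and L: "(\<integral>\<^sup>+x. ennreal (norm (u x) powr (9/2)) \<partial>lborel) < \<infinity>"
  shows "u x = 0"
proof (rule irrotational_D_solution_vanishes[OF D L])
  note u2 = D_solution_C2[OF D] note u = C2_C1[OF u2]
  obtain P where P: "C2 P" "\<And>x. curl (curl u) x + cross3 (curl u x) (u x) + grad P x = 0"
    using vorticity_form[OF D] by blast
  obtain E where E: "E > 0" "(\<integral>\<^sup>+x. ennreal (grad_norm2 u x) \<partial>lborel) \<le> ennreal E"
    using D_solution_dirichlet[OF D] by blast
  obtain Q where Q: "Q > 0" "\<forall>r>1. \<forall>n. \<exists>\<Psi>. C1 \<Psi> \<and> (\<forall>x. curl \<Psi> x = u x) \<and>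
     (\<integral>\<^sup>+x\<in>ball 0 (2 ^ n * r). ennreal (energy_density (2 ^ n * r) u \<Psi> x) \<partial>lborel)
       \<le> ennreal (Q * energy_rate \<alpha> r (2 ^ n * r))"
    using potential_with_small_energy[OF D s f w C \<alpha>(1) o L] by (elim exE conjE) (rule that)
  have gc: "continuous_on UNIV (grad_norm2 u)"
    unfolding grad_norm2_def[abs_def] by (intro continuous_intros C1_pd_cont u)
  then have [measurable]: "grad_norm2 u \<in> borel_measurable borel" by (rule borel_measurable_continuous_onI)
  have om: "(\<integral>\<^sup>+x. ennreal ((norm (curl u x))\<^sup>2) \<partial>lborel) \<le> ennreal (3 * E)"
  proof -
    have "(\<integral>\<^sup>+x. ennreal ((norm (curl u x))\<^sup>2) \<partial>lborel) \<le> (\<integral>\<^sup>+x. ennreal 3 * ennreal (grad_norm2 u x) \<partial>lborel)"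
    proof (rule nn_integral_mono)
      fix x
      have "(norm (curl u x))\<^sup>2 \<le> (\<Sum>i\<in>UNIV. norm (pd i u x))\<^sup>2"
        by (intro power_mono norm_curl_le) auto
      also have "\<dots> \<le> 3 * grad_norm2 u x" by (rule sum_norm_pd_le)
      finally show "ennreal ((norm (curl u x))\<^sup>2) \<le> ennreal 3 * ennreal (grad_norm2 u x)"
        by (simp add: ennreal_mult'[symmetric] ennreal_leI del: ennreal_numeral)
    qed
    also have "\<dots> = ennreal 3 * (\<integral>\<^sup>+x. ennreal (grad_norm2 u x) \<partial>lborel)" by (rule nn_integral_cmult) measurable
    also have "\<dots> \<le> ennreal 3 * ennreal E" by (intro mult_left_mono E) auto
    finally show ?thesis using E(1) by (simp add: ennreal_mult)
  qed
  define X :: "nat \<Rightarrow> real" where "X k = 2 ^ Suc k" for k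
  have X1: "X k > 1" for k unfolding X_def by (rule power_gt1) simp
  define b where "b k = 3 * E * (32400 * (Q * (7 * X k powr (- 8 / 9))))" for k
  have main: "(\<integral>\<^sup>+x. ennreal (cutoff (X k ^ 8) x * (norm (curl u x))\<^sup>2) \<partial>lborel)\<^sup>2 \<le> ennreal (b k)" for k
  proof -
    (* The gradient of the mollified part needs r above R^(9/16), the nonlinear term needs r below R^(5/6); the ratio 5/8 satisfies both, and powers of two make R a dyadic multiple of r. *)
    define r where "r = X k ^ 5"
    define R where "R = X k ^ 8"
    have r: "r > 1" unfolding r_def using X1[of k] by (intro one_less_power) auto
    have R0: "R > 0" using X1[of k] by (simp add: R_def)
    have eR: "2 ^ (3 * Suc k) * r = R"
    proof -
      have "2 ^ (3 * Suc k) = X k ^ 3" unfolding X_def by (simp only: power_mult[symmetric] mult.commute)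
      then show ?thesis by (simp only: R_def r_def power_add[symmetric]) simp
    qed
    obtain \<Psi> where \<Psi>: "C1 \<Psi>" "\<And>x. curl \<Psi> x = u x"
      "(\<integral>\<^sup>+x\<in>ball 0 R. ennreal (energy_density R u \<Psi> x) \<partial>lborel)
       \<le> ennreal (Q * energy_rate \<alpha> r R)"
      using Q(2)[rule_format, OF r, of "3 * Suc k"] unfolding eR by blast
    have XR: "R = X k powr 8" "r = X k powr 5" using X1[of k] by (simp_all add: R_def r_def)
    have e: "X k powr e \<le> X k powr (- 8 / 9)" if "e \<le> - 8 / 9" for e
      using that X1[of k] by (intro powr_mono) auto
    have "energy_rate \<alpha> r R
       = X k powr (8 * (- 1 / 3)) + X k powr (8 * (2 * \<alpha> - 1 / 3)) + X k powr (8 * (2 * \<alpha> - 1))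
          + X k powr (8 + 5 * (2 * \<alpha> - 2)) + X k powr (5 * 2 + 8 * (- 7 / 3))
          + X k powr (5 * 2 + 8 * (- 2)) + X k powr (5 * 2 + 8 * (- 5 / 3))"
      unfolding energy_rate_def XR powr_powr powr_add ..
    also have "\<dots> \<le> 7 * X k powr (- 8 / 9)"
      using e[of "8 * (- 1 / 3)"] e[of "8 * (2 * \<alpha> - 1 / 3)"] e[of "8 * (2 * \<alpha> - 1)"]
        e[of "8 + 5 * (2 * \<alpha> - 2)"] e[of "5 * 2 + 8 * (- 7 / 3)"] e[of "5 * 2 + 8 * (- 2)"]
        e[of "5 * 2 + 8 * (- 5 / 3)"] \<alpha>(2) by simp
    finally have le: "energy_rate \<alpha> r R \<le> 7 * X k powr (- 8 / 9)" .
    have "(\<integral>\<^sup>+x\<in>ball 0 R. ennreal (energy_density R u \<Psi> x) \<partial>lborel) \<le> ennreal (Q * (7 * X k powr (- 8 / 9)))"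
      by (rule order_trans[OF \<Psi>(3)], intro ennreal_leI mult_left_mono le) (use Q(1) in simp)
    then have "(\<integral>\<^sup>+x. ennreal (cutoff R x * (norm (curl u x))\<^sup>2) \<partial>lborel)\<^sup>2
      \<le> ennreal (3 * E) * (ennreal 32400 * ennreal (Q * (7 * X k powr (- 8 / 9))))"
      by (intro order_trans[OF enstrophy_bound[OF u2 P \<Psi>(1,2) R0]] mult_mono om mult_left_mono) auto
    also have "\<dots> = ennreal (b k)"
    proof -
      have q: "0 \<le> 3 * E" "0 \<le> Q * (7 * X k powr (- 8 / 9))" using E(1) Q(1) by auto
      have "ennreal 32400 * ennreal (Q * (7 * X k powr (- 8 / 9))) = ennreal (32400 * (Q * (7 * X k powr (- 8 / 9))))"
        by (rule ennreal_mult[symmetric]) (use q in auto)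
      then show ?thesis unfolding b_def by (simp only:) (rule ennreal_mult[symmetric], use q in auto)
    qed
    finally show ?thesis unfolding R_def .
  qed
  fix x
  have "(norm (curl u x))\<^sup>2 = 0"
  proof (rule vanishing_of_cutoff_integrals[OF _ _ _ main])
    show "continuous_on UNIV (\<lambda>x. (norm (curl u x))\<^sup>2)" by (intro continuous_intros continuous_on_curl u)
    have X: "filterlim X at_top sequentially"
    proof (rule filterlim_at_top_mono[OF filterlim_real_sequentially], intro always_eventually allI)
      fix k
      have "real k \<le> 2 ^ k" using of_nat_less_two_power[of k, where 'a=real] by simp
      also have "\<dots> \<le> X k" by (simp add: X_def)
      finally show "real k \<le> X k" .
    qed
    show "filterlim (\<lambda>k. X k ^ 8) at_top sequentially"
      by (rule filterlim_pow_at_top[OF _ X]) simp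
    have "(\<lambda>k. X k powr (- 8 / 9)) \<longlonglongrightarrow> 0" by (rule tendsto_neg_powr[OF _ X]) simp
    then have "(\<lambda>k. (3 * E * (32400 * (Q * 7))) * X k powr (- 8 / 9)) \<longlonglongrightarrow> 0" by (rule tendsto_mult_right_zero)
    then show "b \<longlonglongrightarrow> 0" unfolding b_def[abs_def] by (simp add: mult_ac)
  qed simp
  then show "curl u x = 0" by simp
qed

section \<open>Decay and the Liouville property\<close>

theorem theorem1p1:
  fixes u \<psi> :: "real^3 \<Rightarrow> real^3" and s C \<alpha> :: real
  assumes "D_solution u"
    and "s \<ge> 1"
    and "locally_L1 \<psi>"
    and "is_weak_curl u \<psi>"
    and "C > 0" and "0 < \<alpha>" and "\<alpha> < 1"
    and "oscillation_bound \<psi> s C \<alpha>"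
  shows "(\<forall>p::real. p > 4 / (1 - \<alpha>) \<longrightarrow> weak_Lp p u) \<and>
         (\<alpha> < 1 / 9 \<longrightarrow> (\<forall>x. u x = 0))"
proof -
  have uc: "continuous_on UNIV u" by (rule C1_cont[OF C2_C1[OF D_solution_C2[OF assms(1)]]])
  obtain M where M: "M > 0" "\<And>x. norm (u x) \<le> M" using D_solution_bounded[OF assms(1)] by blast
  obtain K t0 where K: "K > 0" "t0 > 0"
    "\<And>t. 0 < t \<Longrightarrow> t < t0 \<Longrightarrow> emeasure lborel {x. t < norm (u x)} \<le> ennreal (K * t powr (- (2 + 2 / (1 - \<alpha>))))"
    using level_set_decay[OF assms(1-5) assms(7-8)] by blast
  have weak: "weak_Lp p u" if p: "p > 4 / (1 - \<alpha>)" for p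
  proof (rule weak_Lp_of_level_set_decay[OF uc M(2) M(1) K])
    have "2 * (1 - \<alpha>) \<le> 2" using assms(6) by simp
    then have "2 \<le> 2 / (1 - \<alpha>)" using assms(7) by (simp add: le_divide_eq)
    then show "2 + 2 / (1 - \<alpha>) \<le> p" using p by simp
    show "p > 0" using p assms(7) by (smt (verit) divide_pos_pos)
  qed
  moreover have "u x = 0" if \<alpha>: "\<alpha> < 1 / 9" for x
  proof -
    have "4 / (1 - \<alpha>) < 9 / 2" using \<alpha> assms(7) by (simp add: divide_less_eq)
    then obtain p where p: "4 / (1 - \<alpha>) < p" "p < 9 / 2" using dense by blast
    have "(\<integral>\<^sup>+x. ennreal (norm (u x) powr (9/2)) \<partial>lborel) < \<infinity>"
      by (rule Lp_of_weak_Lp[OF uc M(2) M(1) weak[OF p(1)] p(2)]) simp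
    from liouville[OF assms(1-6) \<alpha> assms(8) this] show ?thesis .
  qed
  ultimately show ?thesis by blast
qed

end
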